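(* For every permutation $w\in S_n$ there is a shape preserving bijection between $\mathrm{RT}(w)$, the set of reduced word tableaux for $w$, and $\mathrm{EG}(w)$, the set of EG-pipedreams of $w$; i.e. a bijection $\mathrm{RT}(w)\to\mathrm{EG}(w)$ sending each tableau of shape $\lambda$ to an EG-pipedream of shape $\lambda$.
   Context: Permutations are written in one-line notation $w=w_1w_2\cdots w_n$. Let $s_i$ be the simple transposition of $i,i+1$, with the convention that $ws_i$ is obtained from $w$ by swapping $w_i$ and $w_{i+1}$. A sequence $(a_1,\ldots,a_\ell)$ is a reduced word of $w$ if $w=s_{a_1}\cdots s_{a_\ell}$ and $\ell$ is minimal (equal to the number of inversions of $w$). An increasing tableau of shape $\lambda$ (a partition) is a filling of the boxes of the Young diagram of $\lambda$ with positive integers strictly increasing along each row and each column. Its column reading word is obtained by reading the entries column by column, each column from top to bottom, starting with the rightmost column and moving left. A reduced word tableau for $w$ is an increasing tableau whose column reading word is a reduced word of $w$; $\mathrm{RT}(w)$ is the set of these, and the shape of such a tableau is its shape $\lambda$. Bumpless pipedreams: consider an $n\times n$ grid of unit boxes with matrix coordinates, $(i,j)$ being the box in row $i$ (rows numbered top to bottom) and column $j$ (left to right). A bumpless pipedream of $w$ consists of $n$ pipes labeled $1,\ldots,n$ such that: pipe $i$ enters from the south boundary in column $i$ and exits through the east boundary in row $w^{-1}(i)$; pipes move only north or east; no two pipes share a step and no two pipes cross more than once; and each box is one of six tiles: empty, an NW elbow (a pipe entering from the west turns and exits north), an SE elbow (a pipe entering from the south turns and exits east), a horizontal segment, a vertical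 segment, or a crossing of two pipes (in particular two pipes never both turn in the same box). An EG-pipedream of $w$ is a bumpless pipedream of $w$ whose empty boxes form the Young diagram of a partition $\lambda$ placed at the northwest corner of the grid (i.e. the empty boxes are exactly $\{(i,j): 1\le j\le \lambda_i\}$); $\lambda$ is its shape. $\mathrm{EG}(w)$ denotes the set of EG-pipedreams of $w$. *)

theory Defs
  imports "HOL-Combinatorics.Permutations" "HOL-Library.FuncSet"
begin

section \<open>Reduced words\<close>

text \<open>Products of permutations are compositions, so \<open>w \<circ> s i\<close> swaps the entries in positions
  \<open>i\<close> and \<open>i + 1\<close> of the one-line notation of \<open>w\<close>.\<close>

definition word_perm :: "nat list \<Rightarrow> nat \<Rightarrow> nat" where
  "word_perm a = foldr (\<lambda>i u. Transposition.transpose i (Suc i) \<circ> u) a id"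

definition word_for :: "nat \<Rightarrow> (nat \<Rightarrow> nat) \<Rightarrow> nat list \<Rightarrow> bool" where
  "word_for n w a \<longleftrightarrow> set a \<subseteq> {1..<n} \<and> word_perm a = w"

definition reduced_word :: "nat \<Rightarrow> (nat \<Rightarrow> nat) \<Rightarrow> nat list \<Rightarrow> bool" where
  "reduced_word n w a \<longleftrightarrow>
     word_for n w a \<and> (\<forall>b. word_for n w b \<longrightarrow> length a \<le> length b)"

section \<open>Partitions and tableaux\<close>

definition partition_shape :: "nat list \<Rightarrow> bool" where
  "partition_shape lam \<longleftrightarrow> sorted_wrt (\<ge>) lam \<and> 0 \<notin> set lam"

definition young :: "nat list \<Rightarrow> (nat \<times> nat) set" where
  "young lam = {(i, j). 1 \<le> i \<and> i \<le> length lam \<and> 1 \<le> j \<and> j \<le> lam ! (i - 1)}"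

text \<open>A tableau is the list of its rows, from top to bottom; \<^const>\<open>List.transpose\<close> then
  yields the list of its columns, from left to right, each read from top to bottom.\<close>

definition tableau_shape :: "nat list list \<Rightarrow> nat list" where
  "tableau_shape T = map length T"

definition increasing_tableau :: "nat list list \<Rightarrow> bool" where
  "increasing_tableau T \<longleftrightarrow>
     partition_shape (tableau_shape T) \<and>
     (\<forall>r \<in> set T. 0 \<notin> set r \<and> sorted_wrt (<) r) \<and>
     (\<forall>c \<in> set (List.transpose T). sorted_wrt (<) c)"

definition column_reading_word :: "nat list list \<Rightarrow> nat list" where
  "column_reading_word T = concat (rev (List.transpose T))"

definition RT :: "nat \<Rightarrow> (nat \<Rightarrow> nat) \<Rightarrow> nat list list set" where
  "RT n w = {T. increasing_tableau T \<and> reduced_word n w (column_reading_word T)}"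

section \<open>Bumpless pipedreams\<close>

definition grid :: "nat \<Rightarrow> (nat \<times> nat) set" where
  "grid n = {1..n} \<times> {1..n}"

text \<open>Boxes carry matrix coordinates, so a step north decreases the first coordinate.\<close>

definition ne_step :: "nat \<times> nat \<Rightarrow> nat \<times> nat \<Rightarrow> bool" where
  "ne_step b c \<longleftrightarrow>
     (fst b = Suc (fst c) \<and> snd c = snd b) \<or> (fst c = fst b \<and> snd c = Suc (snd b))"

text \<open>A pipe is the list of boxes it traverses, preceded by the position just below the grid
  from which it enters and followed by the position just right of the grid to which it exits.
  Hence the steps across the south and east boundary are among its steps.\<close>

type_synonym pipe = "(nat \<times> nat) list"

definition is_pipe :: "nat \<Rightarrow> nat \<Rightarrow> nat \<Rightarrow> pipe \<Rightarrow> bool" where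
  "is_pipe n col row p \<longleftrightarrow>
     (\<exists>q. p = (Suc n, col) # q @ [(row, Suc n)] \<and> set q \<subseteq> grid n) \<and> successively ne_step p"

definition steps :: "pipe \<Rightarrow> ((nat \<times> nat) \<times> (nat \<times> nat)) set" where
  "steps p = set (zip p (tl p))"

definition enters_south :: "pipe \<Rightarrow> nat \<times> nat \<Rightarrow> bool" where
  "enters_south p b \<longleftrightarrow> ((Suc (fst b), snd b), b) \<in> steps p"

definition enters_west :: "pipe \<Rightarrow> nat \<times> nat \<Rightarrow> bool" where
  "enters_west p b \<longleftrightarrow> ((fst b, snd b - 1), b) \<in> steps p"

definition exits_north :: "pipe \<Rightarrow> nat \<times> nat \<Rightarrow> bool" where
  "exits_north p b \<longleftrightarrow> (b, (fst b - 1, snd b)) \<in> steps p"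

definition exits_east :: "pipe \<Rightarrow> nat \<times> nat \<Rightarrow> bool" where
  "exits_east p b \<longleftrightarrow> (b, (fst b, Suc (snd b))) \<in> steps p"

definition pipes_through :: "nat \<Rightarrow> (nat \<Rightarrow> pipe) \<Rightarrow> nat \<times> nat \<Rightarrow> nat set" where
  "pipes_through n P b = {k \<in> {1..n}. b \<in> set (P k)}"

datatype tile = Blank | NW_Elbow | SE_Elbow | Horizontal | Vertical | Crossing

fun has_tile :: "nat \<Rightarrow> (nat \<Rightarrow> pipe) \<Rightarrow> nat \<times> nat \<Rightarrow> tile \<Rightarrow> bool" where
  "has_tile n P b Blank \<longleftrightarrow> pipes_through n P b = {}"
| "has_tile n P b NW_Elbow \<longleftrightarrow>
     (\<exists>k. pipes_through n P b = {k} \<and> enters_west (P k) b \<and> exits_north (P k) b)"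
| "has_tile n P b SE_Elbow \<longleftrightarrow>
     (\<exists>k. pipes_through n P b = {k} \<and> enters_south (P k) b \<and> exits_east (P k) b)"
| "has_tile n P b Horizontal \<longleftrightarrow>
     (\<exists>k. pipes_through n P b = {k} \<and> enters_west (P k) b \<and> exits_east (P k) b)"
| "has_tile n P b Vertical \<longleftrightarrow>
     (\<exists>k. pipes_through n P b = {k} \<and> enters_south (P k) b \<and> exits_north (P k) b)"
| "has_tile n P b Crossing \<longleftrightarrow>
     (\<exists>k l. k \<noteq> l \<and> pipes_through n P b = {k, l} \<and>
        enters_west (P k) b \<and> exits_east (P k) b \<and>
        enters_south (P l) b \<and> exits_north (P l) b)"

definition crossings :: "nat \<Rightarrow> (nat \<Rightarrow> pipe) \<Rightarrow> nat \<Rightarrow> nat \<Rightarrow> (nat \<times> nat) set" where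
  "crossings n P k l = {b \<in> grid n. has_tile n P b Crossing \<and> pipes_through n P b = {k, l}}"

text \<open>A bumpless pipedream is the family of its pipes \<open>P k\<close> for \<open>k \<in> {1..n}\<close>. Being
  \<^const>\<open>extensional\<close> makes the values of \<open>P\<close> outside \<open>{1..n}\<close> irrelevant to equality.\<close>

definition bumpless_pipedream :: "nat \<Rightarrow> (nat \<Rightarrow> nat) \<Rightarrow> (nat \<Rightarrow> pipe) \<Rightarrow> bool" where
  "bumpless_pipedream n w P \<longleftrightarrow>
     P \<in> extensional {1..n} \<and>
     (\<forall>k \<in> {1..n}. is_pipe n k (inv w k) (P k)) \<and>
     (\<forall>k \<in> {1..n}. \<forall>l \<in> {1..n}. k \<noteq> l \<longrightarrow>
        steps (P k) \<inter> steps (P l) = {} \<and> card (crossings n P k l) \<le> 1) \<and>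
     (\<forall>b \<in> grid n. \<exists>t. has_tile n P b t)"

definition empty_boxes :: "nat \<Rightarrow> (nat \<Rightarrow> pipe) \<Rightarrow> (nat \<times> nat) set" where
  "empty_boxes n P = {b \<in> grid n. has_tile n P b Blank}"

definition has_shape :: "nat \<Rightarrow> (nat \<Rightarrow> pipe) \<Rightarrow> nat list \<Rightarrow> bool" where
  "has_shape n P lam \<longleftrightarrow> partition_shape lam \<and> empty_boxes n P = young lam"

definition EG :: "nat \<Rightarrow> (nat \<Rightarrow> nat) \<Rightarrow> (nat \<Rightarrow> pipe) set" where
  "EG n w = {P. bumpless_pipedream n w P \<and> (\<exists>lam. has_shape n P lam)}"

end

theory Submission
  imports Defs
begin

text \<open>Both sides satisfy the same transition recursion. Let \<open>(a, b)\<close> be the last box, in row-reading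
  order, of the Rothe diagram of \<open>w\<close> that is not in its dominant part (the boxes with no dot of the
  permutation matrix to the northwest). Put \<open>s = w\<inverse>(b)\<close> and \<open>v = w (a s)\<close>; the children of \<open>w\<close> are the
  permutations \<open>v (i a)\<close> with \<open>i < a\<close> that cover \<open>v\<close> in Bruhat order.

  Little's bump is a bijection from the reduced words of \<open>w\<close> to those of its children which
  decrements every letter at most once. Therefore, letter by letter, it preserves the property of
  being the column reading word of an increasing tableau of a given shape: strict inequalities
  become weak ones, and reducedness makes them strict again.

  In an EG-pipedream of \<open>w\<close> the rows below \<open>a\<close> consist of hooks, and some pipe \<open>w\<^sub>i\<close> turns north in the
  box \<open>(a, b)\<close>. Let it run straight to the right instead, let pipe \<open>b\<close> come up column \<open>b\<close> and take over its
  course above row \<open>a\<close>, and let pipe \<open>w\<^sub>a\<close> leave in row \<open>s\<close>. This is a pipedream of the child given by \<open>i\<close>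
  with the same empty boxes, and the operation is invertible.

  The recursion ends at dominant permutations, which have exactly one tableau and exactly one
  EG-pipedream, both of the shape of the Rothe diagram.\<close>

section \<open>Reduced words and inversions\<close>

text \<open>The induction climbs: where the one-line word of a child first differs from that of
  \<open>w\<close>, its letter is larger, so lexicographic order terminates it. Choosing the last
  nondominant box serves both sides. It makes \<open>(a, s)\<close> the only transposition
  \<open>(a, s')\<close> with \<open>a < s'\<close> that leads to a cover of \<open>v\<close>, so
  the source of Little's bump consists of the words of \<open>w\<close> alone; and it leaves no
  freedom to the pipes below row \<open>a\<close>. The dot northwest of the box also keeps the
  letter \<open>0\<close> out of the bumped words.

  Little's bump is treated as a graph instead of an algorithm. Its states are reduced words of
  \<open>v\<close> with a marked gap. When a letter is inserted into the gap, at most one other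
  letter can be deleted to restore \<open>v\<close>; so the graph consists of chains, and sending
  first states to last states is a bijection. Surgery on lists of boxes is awkward, so a pipe is
  encoded by the columns in which it crosses the row boundaries; the surgery then exchanges two such
  sequences above one row. The bijections of the children glue because their sets of tableaux, and
  of pipedreams, are pairwise disjoint.\<close>

lemma word_perm_Nil [simp]: "word_perm [] = id"
  by (simp add: word_perm_def)

lemma word_perm_Cons [simp]:
  "word_perm (h # y) = Transposition.transpose h (Suc h) \<circ> word_perm y"
  by (simp add: word_perm_def)

lemma word_perm_append [simp]: "word_perm (x @ y) = word_perm x \<circ> word_perm y"
  by (induction x) (simp_all add: o_assoc)

lemma bij_word_perm [simp]: "bij (word_perm a)"
proof (induction a)
  case (Cons h y)
  then show "bij (word_perm (h # y))" unfolding word_perm_Cons by (intro bij_comp bij_transpose)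
next
  show "bij (word_perm [])" by simp
qed

lemma word_perm_inj [simp]: "word_perm a p = word_perm a q \<longleftrightarrow> p = q"
  by (meson bij_is_inj bij_word_perm inj_eq)

lemma word_perm_permutes: "set a \<subseteq> {m..<n} \<Longrightarrow> word_perm a permutes {m..n}"
proof (induction a)
  case (Cons h y)
  have "Transposition.transpose h (Suc h) permutes {m..n}"
    using Cons.prems by (intro permutes_swap_id) auto
  then show "word_perm (h # y) permutes {m..n}"
    using Cons unfolding word_perm_Cons by (auto intro: permutes_compose)
next
  show "word_perm [] permutes {m..n}" by (simp add: permutes_id)
qed

definition inversions :: "(nat \<Rightarrow> nat) \<Rightarrow> (nat \<times> nat) set" where
  "inversions u = {(p, q). p < q \<and> u q < u p}"

lemma inversions_id [simp]: "inversions id = {}"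
  by (auto simp: inversions_def)

text \<open>Left multiplication by an adjacent transposition exchanges two neighbouring values,
  which compare alike with all others; only the pair of their positions can change its
  status.\<close>

lemma inversions_step:
  assumes "u p = h" "u q = Suc h" "bij u" "p < q"
  shows "inversions (Transposition.transpose h (Suc h) \<circ> u) = insert (p, q) (inversions u)"
    and "(p, q) \<notin> inversions u"
proof -
  have inj: "u i = u j \<longleftrightarrow> i = j" for i j
    using assms(3) by (simp add: bij_is_inj inj_eq)
  have e: "u i = h \<longleftrightarrow> i = p" "u i = Suc h \<longleftrightarrow> i = q" for i
    using inj assms(1,2) by metis+
  have *: "(i, j) \<in> inversions (Transposition.transpose h (Suc h) \<circ> u)
      \<longleftrightarrow> (i, j) \<in> insert (p, q) (inversions u)" for i j
    using e[of i] e[of j] assms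
    by (auto simp: inversions_def Transposition.transpose_def)
  then show "inversions (Transposition.transpose h (Suc h) \<circ> u) = insert (p, q) (inversions u)"
    by auto
  show "(p, q) \<notin> inversions u" using assms by (auto simp: inversions_def)
qed

lemma finite_inversions [simp]: "finite (inversions (word_perm a))"
proof (induction a)
  show "finite (inversions (word_perm []))" by simp
next
  case (Cons h y)
  let ?u = "word_perm y"
  let ?t = "Transposition.transpose h (Suc h)"
  have "?t \<circ> (?t \<circ> ?u) = ?u" by (simp add: o_assoc)
  moreover have b: "bij (?t \<circ> ?u)" by (simp add: bij_comp)
  obtain p q where pq: "?u p = h" "?u q = Suc h"
    using bij_word_perm[of y] by (metis bij_pointE)
  show "finite (inversions (word_perm (h # y)))"
  proof (cases "p < q")
    case True
    then show ?thesis using inversions_step[OF pq _ True] Cons by simp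
  next
    case False
    then have "q < p" using pq by (metis n_not_Suc_n linorder_neqE_nat)
    then have "inversions (?t \<circ> (?t \<circ> ?u)) = insert (q, p) (inversions (?t \<circ> ?u))"
      by (intro inversions_step) (use pq b in auto)
    with \<open>?t \<circ> (?t \<circ> ?u) = ?u\<close> Cons show ?thesis by simp
  qed
qed

text \<open>Counting inversions avoids both the bound \<open>n\<close> and the comparison with all
  other words in \<open>reduced_word\<close>; \<open>reduced_word_iff\<close> reconciles the two
  notions.\<close>

definition reduced :: "nat list \<Rightarrow> bool" where
  "reduced a \<longleftrightarrow> card (inversions (word_perm a)) = length a"

lemma card_inversions_Cons:
  assumes "word_perm y p = h" "word_perm y q = Suc h"
  shows "p < q \<Longrightarrow> card (inversions (word_perm (h # y))) = Suc (card (inversions (word_perm y)))"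
    and "\<not> p < q \<Longrightarrow> Suc (card (inversions (word_perm (h # y)))) = card (inversions (word_perm y))"
proof -
  let ?u = "word_perm y"
  let ?t = "Transposition.transpose h (Suc h)"
  show "card (inversions (word_perm (h # y))) = Suc (card (inversions (word_perm y)))" if "p < q"
    using inversions_step[OF assms bij_word_perm that] by simp
  show "Suc (card (inversions (word_perm (h # y)))) = card (inversions (word_perm y))" if "\<not> p < q"
  proof -
    have "q < p" using assms that by (metis n_not_Suc_n linorder_neqE_nat)
    have e: "?t \<circ> (?t \<circ> ?u) = ?u" by (simp add: o_assoc)
    have b: "bij (?t \<circ> ?u)" by (simp add: bij_comp)
    have w: "(?t \<circ> ?u) q = h" "(?t \<circ> ?u) p = Suc h" using assms by simp_all
    have "inversions (?t \<circ> (?t \<circ> ?u)) = insert (q, p) (inversions (?t \<circ> ?u))"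
      "(q, p) \<notin> inversions (?t \<circ> ?u)"
      using inversions_step[OF w b \<open>q < p\<close>] by simp_all
    then show ?thesis using e finite_inversions[of "h # y"] by simp
  qed
qed

lemma ex_wires: obtains p q where "word_perm y p = h" "word_perm y q = Suc h"
  using bij_word_perm[of y] by (metis bij_pointE)

lemma card_inversions_le: "card (inversions (word_perm a)) \<le> length a"
proof (induction a)
  show "card (inversions (word_perm [])) \<le> length []" by simp
next
  case (Cons h y)
  obtain p q where "word_perm y p = h" "word_perm y q = Suc h" by (rule ex_wires)
  from card_inversions_Cons[OF this] Cons
  show "card (inversions (word_perm (h # y))) \<le> length (h # y)" by (cases "p < q") auto
qed

lemma reduced_Nil [simp]: "reduced []"
  by (simp add: reduced_def)

lemma reduced_Cons:
  assumes "word_perm y p = h" "word_perm y q = Suc h"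
  shows "reduced (h # y) \<longleftrightarrow> reduced y \<and> p < q"
  using card_inversions_Cons[OF assms] card_inversions_le[of y]
  by (cases "p < q") (auto simp: reduced_def)

lemma reduced_ConsD: "reduced (h # y) \<Longrightarrow> reduced y"
  by (metis ex_wires reduced_Cons)

lemma reduced_append2: "reduced (x @ y) \<Longrightarrow> reduced y"
  by (induction x) (auto dest: reduced_ConsD)

lemma inversions_mono: "reduced (x @ y) \<Longrightarrow> inversions (word_perm y) \<subseteq> inversions (word_perm (x @ y))"
proof (induction x)
  case (Cons h x)
  obtain p q where pq: "word_perm (x @ y) p = h" "word_perm (x @ y) q = Suc h" by (rule ex_wires)
  with Cons.prems have "p < q" "reduced (x @ y)" using reduced_Cons[OF pq] by auto
  then have "inversions (word_perm (h # x @ y)) = insert (p, q) (inversions (word_perm (x @ y)))"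
    using inversions_step(1)[OF pq bij_word_perm] by simp
  then have "inversions (word_perm y) \<subseteq> inversions (word_perm (h # x @ y))"
    using Cons.IH \<open>reduced (x @ y)\<close> by (auto simp del: word_perm_Cons word_perm_append)
  then show ?case by (simp del: word_perm_Cons word_perm_append)
qed simp

lemma word_perm_cong_reduced:
  "word_perm a = word_perm b \<Longrightarrow> length a = length b \<Longrightarrow> reduced a \<longleftrightarrow> reduced b"
  by (simp add: reduced_def)

lemma reduced_minimal: "reduced a \<Longrightarrow> word_perm a = word_perm b \<Longrightarrow> length a \<le> length b"
  using card_inversions_le[of b] by (simp add: reduced_def)

lemma comp_left_cancel [simp]: "word_perm a \<circ> f = word_perm a \<circ> g \<longleftrightarrow> f = g"
  by (auto simp: fun_eq_iff)

lemma comp_right_cancel [simp]: "f \<circ> word_perm a = g \<circ> word_perm a \<longleftrightarrow> f = g"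
proof
  assume *: "f \<circ> word_perm a = g \<circ> word_perm a"
  show "f = g"
  proof
    fix x
    obtain z where "x = word_perm a z" using bij_word_perm[of a] by (metis bij_pointE)
    then show "f x = g x" using fun_cong[OF *, of z] by simp
  qed
qed simp

text \<open>Each letter prepended to a reduced word adds exactly one inversion and destroys none. An
  inversion absent from \<open>y\<close> is therefore born at some letter of \<open>x\<close>, where
  the wires ending in positions \<open>p\<close> and \<open>q\<close> are at adjacent
  heights.\<close>

lemma inversion_letter:
  assumes "reduced (x @ y)" "(p, q) \<in> inversions (word_perm (x @ y))"
    "(p, q) \<notin> inversions (word_perm y)"
  obtains x1 g x2 where "x = x1 @ g # x2" "word_perm (x2 @ y) p = g" "word_perm (x2 @ y) q = Suc g"
    "p < q"
  using assms
proof (induction x arbitrary: thesis)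
  case (Cons h x)
  obtain p' q' where pq: "word_perm (x @ y) p' = h" "word_perm (x @ y) q' = Suc h" by (rule ex_wires)
  with Cons.prems have "p' < q'" "reduced (x @ y)" using reduced_Cons[OF pq] by auto
  then have eq: "inversions (word_perm (h # x @ y)) = insert (p', q') (inversions (word_perm (x @ y)))"
    using inversions_step(1)[OF pq bij_word_perm] by simp
  show ?case
  proof (cases "(p, q) \<in> inversions (word_perm (x @ y))")
    case True
    from Cons.IH[OF _ \<open>reduced (x @ y)\<close> True Cons.prems(4)] Cons.prems(1) show ?thesis
      by (metis append_Cons)
  next
    case False
    then have "p = p'" "q = q'"
      using eq Cons.prems(3) by (auto simp del: word_perm_Cons word_perm_append)
    then show ?thesis using Cons.prems(1)[of "[]" h x] pq \<open>p' < q'\<close> by simp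
  qed
qed simp

lemma inversion_letter':
  assumes "reduced y" "(p, q) \<in> inversions (word_perm y)"
  obtains x1 g x2 where "y = x1 @ g # x2" "word_perm x2 p = g" "word_perm x2 q = Suc g"
  using inversion_letter[of y "[]" p q] assms by (metis append_Nil2 empty_iff inversions_id word_perm_Nil)

lemma letter_as_reflection:
  assumes "word_perm y p = g" "word_perm y q = Suc g"
  shows "Transposition.transpose g (Suc g) \<circ> word_perm y = word_perm y \<circ> Transposition.transpose p q"
proof
  fix z
  show "(Transposition.transpose g (Suc g) \<circ> word_perm y) z = (word_perm y \<circ> Transposition.transpose p q) z"
    using assms word_perm_inj[of y z p] word_perm_inj[of y z q]
    by (auto simp: Transposition.transpose_def)
qed

text \<open>Pushed to the right through \<open>y\<close>, the letter becomes the transposition of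
  the positions where the two crossed wires end. Inserting or deleting a letter anywhere is thus a
  right multiplication.\<close>

lemma word_perm_insert:
  assumes "word_perm y p = g" "word_perm y q = Suc g"
  shows "word_perm (x @ g # y) = word_perm (x @ y) \<circ> Transposition.transpose p q"
  using letter_as_reflection[OF assms] by (simp add: o_assoc[symmetric])

section \<open>Bruhat covers, and the effect of a reflection on the number of inversions\<close>

definition covers :: "(nat \<Rightarrow> nat) \<Rightarrow> nat \<Rightarrow> nat \<Rightarrow> bool" where
  "covers v p q \<longleftrightarrow> p < q \<and> v p < v q \<and> (\<forall>m. p < m \<longrightarrow> m < q \<longrightarrow> v m < v p \<or> v q < v m)"

text \<open>The map \<open>f\<close> injects the inversions of \<open>v\<close> into those of the
  product other than \<open>(p, q)\<close>. What it misses comes from positions strictly between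
  \<open>p\<close> and \<open>q\<close> with an intermediate value, so it is onto exactly for a
  cover.\<close>

lemma card_inversions_reflection:
  assumes v: "bij v" "finite (inversions v)" and pq: "p < q"
  shows "covers v p q \<Longrightarrow> card (inversions (v \<circ> Transposition.transpose p q)) = Suc (card (inversions v))"
    and "v p < v q \<Longrightarrow> finite (inversions (v \<circ> Transposition.transpose p q)) \<Longrightarrow>
      card (inversions (v \<circ> Transposition.transpose p q)) \<ge> Suc (card (inversions v))"
    and "v p < v q \<Longrightarrow> finite (inversions (v \<circ> Transposition.transpose p q)) \<Longrightarrow>
      card (inversions (v \<circ> Transposition.transpose p q)) = Suc (card (inversions v)) \<Longrightarrow> covers v p q"
proof -
  let ?t = "Transposition.transpose p q"
  \<comment> \<open>Move an inversion along with the transposed positions where this keeps their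
    order, and leave it in place otherwise.\<close>
  define f where "f = (\<lambda>(i, j). if ?t i < ?t j then (?t i, ?t j) else (i, j))"
  have inj_v: "v i = v j \<longleftrightarrow> i = j" for i j
    using v(1) by (simp add: bij_is_inj inj_eq)
  have tt: "?t (?t i) = i" for i by simp
  have inj: "inj_on f (inversions v)"
  proof (rule inj_onI, clarify)
    fix i j k l assume "(i, j) \<in> inversions v" "(k, l) \<in> inversions v" "f (i, j) = f (k, l)"
    then have "i < j" "k < l" by (auto simp: inversions_def)
    with \<open>f (i, j) = f (k, l)\<close> show "i = k \<and> j = l"
      unfolding f_def by (auto simp: Transposition.transpose_def split: if_splits)
  qed
  define I where "I = inversions (v \<circ> ?t)"
  have pqI: "(p, q) \<in> I" if "v p < v q"
    using that pq by (auto simp: I_def inversions_def)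
  have sub: "f ` inversions v \<subseteq> I - {(p, q)}" if "v p < v q"
  proof -
    have "f (i, j) \<in> I - {(p, q)}" if ij: "(i, j) \<in> inversions v" for i j
    proof (cases "?t i < ?t j")
      case True
      then have "f (i, j) = (?t i, ?t j)" by (simp add: f_def)
      moreover have "(?t i, ?t j) \<in> I" using ij True by (simp add: I_def inversions_def)
      moreover have "(?t i, ?t j) \<noteq> (p, q)"
        using ij pq by (auto simp: inversions_def Transposition.transpose_def split: if_splits)
      ultimately show ?thesis by simp
    next
      case False
      then have "f (i, j) = (i, j)" by (simp add: f_def)
      with False ij pq \<open>v p < v q\<close> show ?thesis
        by (auto simp: I_def inversions_def Transposition.transpose_def split: if_splits)
    qed
    then show ?thesis by (metis (no_types, lifting) image_subsetI surj_pair)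
  qed
  show "card I \<ge> Suc (card (inversions v))" if "v p < v q" "finite I"
  proof -
    have "card (inversions v) = card (f ` inversions v)" using inj by (simp add: card_image)
    also have "\<dots> \<le> card (I - {(p, q)})" using sub that by (intro card_mono) auto
    also have "Suc \<dots> = card I" using that pqI by (metis card_Suc_Diff1)
    finally show ?thesis by simp
  qed
  show "card I = Suc (card (inversions v))" if c: "covers v p q"
  proof -
    have vpq: "v p < v q" using c by (simp add: covers_def)
    have "I - {(p, q)} \<subseteq> f ` inversions v"
    proof clarify
      fix i j assume ij: "(i, j) \<in> I" "(i, j) \<notin> f ` inversions v"
      show "i = p \<and> j = q"
      proof (rule ccontr)
        assume ne: "\<not> (i = p \<and> j = q)"
        show False
        proof (cases "?t i < ?t j")
          case True
          then have "(?t i, ?t j) \<in> inversions v" using ij by (auto simp: I_def inversions_def)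
          moreover have "f (?t i, ?t j) = (i, j)" using ij by (auto simp: f_def I_def inversions_def)
          ultimately show False using ij(2) by (metis image_eqI)
        next
          case False
          have b: "m < q \<Longrightarrow> p < m \<Longrightarrow> v m < v p \<or> v q < v m" for m
            using c by (auto simp: covers_def)
          have "(i, j) \<in> inversions v"
            using False ij(1) ne b[of i] b[of j] vpq pq
            by (auto simp: I_def inversions_def Transposition.transpose_def split: if_splits)
          moreover have "f (i, j) = (i, j)" using False by (simp add: f_def)
          ultimately show False using ij(2) by (metis image_eqI)
        qed
      qed
    qed
    with sub[OF vpq] have eq: "I - {(p, q)} = f ` inversions v" by auto
    then have "finite (I - {(p, q)})" using v(2) by simp
    then have "finite I" by simp
    then have "card I = Suc (card (I - {(p, q)}))" using pqI[OF vpq] by (metis card_Suc_Diff1)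
    then show ?thesis using eq inj by (simp add: card_image)
  qed
  show "covers v p q" if vpq: "v p < v q" and fin: "finite I"
    and card: "card I = Suc (card (inversions v))"
  proof (rule ccontr)
    assume "\<not> covers v p q"
    then obtain m where m: "p < m" "m < q" "\<not> v m < v p" "\<not> v q < v m"
      using vpq pq by (auto simp: covers_def)
    then have m': "v p < v m" "v m < v q" using inj_v[of m p] inj_v[of m q] by auto
    \<comment> \<open>A position \<open>m\<close> with intermediate value contributes a further
      inversion outside the image of \<open>f\<close>, so the count grows by more than one.\<close>
    have "(p, m) \<in> I" using m m' by (auto simp: I_def inversions_def Transposition.transpose_def)
    moreover have "(p, m) \<notin> f ` inversions v"
    proof
      assume "(p, m) \<in> f ` inversions v"
      then obtain i j where "(i, j) \<in> inversions v" "f (i, j) = (p, m)" by auto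
      then show False using m m'
        by (auto simp: f_def inversions_def Transposition.transpose_def split: if_splits)
    qed
    ultimately have "f ` inversions v \<subseteq> I - {(p, q)} - {(p, m)}" "(p, m) \<in> I - {(p, q)}"
      using sub[OF vpq] m by auto
    then have "card (f ` inversions v) < card (I - {(p, q)})"
      using fin by (intro psubset_card_mono) auto
    moreover have "card I = Suc (card (I - {(p, q)}))"
      using pqI[OF vpq] fin by (metis card_Suc_Diff1)
    ultimately show False using card inj by (simp add: card_image)
  qed
qed

text \<open>Counted from the right, the first letter \<open>h\<close> that destroys reducedness
  undoes an inversion of the reduced suffix. That inversion was created at some letter
  \<open>g\<close>; deleting \<open>g\<close> together with \<open>h\<close> preserves the
  permutation.\<close>

lemma nonreduced_shorten:
  "\<not> reduced a \<Longrightarrow> \<exists>b. word_perm b = word_perm a \<and> length b < length a \<and> set b \<subseteq> set a"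
proof (induction a)
  case (Cons h y)
  show ?case
  proof (cases "reduced y")
    case False
    with Cons.IH obtain b where "word_perm b = word_perm y" "length b < length y" "set b \<subseteq> set y"
      by auto
    then show ?thesis by (intro exI[of _ "h # b"]) auto
  next
    case True
    obtain p q where pq: "word_perm y p = h" "word_perm y q = Suc h" by (rule ex_wires)
    with True Cons.prems reduced_Cons[OF pq] have "\<not> p < q" by simp
    with pq have "q < p" by (metis n_not_Suc_n linorder_neqE_nat)
    with pq have "(q, p) \<in> inversions (word_perm y)" by (auto simp: inversions_def)
    with True obtain x1 g x2 where x: "y = x1 @ g # x2"
      "word_perm x2 q = g" "word_perm x2 p = Suc g"
      using inversion_letter' by blast
    have "word_perm (h # y) = word_perm y \<circ> Transposition.transpose p q"
      using letter_as_reflection[OF pq] by simp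
    also have "\<dots> = word_perm (x1 @ x2)"
      using word_perm_insert[of x2 q g p x1] x by (simp add: o_assoc[symmetric] transpose_commute)
    finally have "word_perm (x1 @ x2) = word_perm (h # y)" ..
    then show ?thesis using x by (intro exI[of _ "x1 @ x2"]) auto
  qed
qed simp

text \<open>The rightmost letter outside the range crosses a wire that ends in a position outside
  \<open>{m..n}\<close>. In a reduced word this crossing survives as an inversion, but no inversion
  of a permutation of an interval involves a position outside it.\<close>

lemma reduced_letters:
  assumes red: "reduced a" and perm: "word_perm a permutes {m..n}"
  shows "set a \<subseteq> {m..<n}"
proof (rule ccontr)
  assume "\<not> set a \<subseteq> {m..<n}"
  then have "\<exists>h\<in>set a. h \<notin> {m..<n}" by blast
  then obtain x h y where a: "a = x @ h # y" and h: "h \<notin> {m..<n}" and y: "\<forall>z\<in>set y. \<not> z \<notin> {m..<n}"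
    by (rule split_list_last_propE)
  from y have yp: "word_perm y permutes {m..n}" by (intro word_perm_permutes) auto
  obtain p q where pq: "word_perm y p = h" "word_perm y q = Suc h" by (rule ex_wires)
  have "reduced (h # y)" using red a reduced_append2 by blast
  then have "p < q" using reduced_Cons[OF pq] by simp
  then have "(p, q) \<in> inversions (word_perm (h # y))" using pq by (auto simp: inversions_def)
  then have "(p, q) \<in> inversions (word_perm a)" using inversions_mono red a by blast
  then have inv: "word_perm a q < word_perm a p" by (simp add: inversions_def)
  show False
  proof (cases "h < m")
    case True
    then have "word_perm y h = h" using yp by (auto intro: permutes_not_in)
    then have "p = h" using pq by (metis word_perm_inj)
    moreover have "word_perm a h = h" using True perm by (auto intro: permutes_not_in)
    ultimately have "word_perm a q < m" "word_perm a q < q" using inv True \<open>p < q\<close> by auto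
    then have "word_perm a (word_perm a q) = word_perm a q"
      by (intro permutes_not_in[OF perm]) simp
    then show False using \<open>word_perm a q < q\<close> by simp
  next
    case False
    then have hn: "n \<le> h" using h by auto
    then have "word_perm y (Suc h) = Suc h" using yp by (auto intro: permutes_not_in)
    then have "q = Suc h" using pq by (metis word_perm_inj)
    moreover have "word_perm a (Suc h) = Suc h" using hn perm by (auto intro: permutes_not_in)
    ultimately have "n < word_perm a p" "p < word_perm a p" using inv hn \<open>p < q\<close> by auto
    then have "word_perm a (word_perm a p) = word_perm a p"
      by (intro permutes_not_in[OF perm]) simp
    then show False using \<open>p < word_perm a p\<close> by simp
  qed
qed

lemma reduced_word_iff:
  assumes "w permutes {1..n}"
  shows "reduced_word n w a \<longleftrightarrow> word_perm a = w \<and> reduced a"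
proof
  assume r: "reduced_word n w a"
  then have a: "set a \<subseteq> {1..<n}" "word_perm a = w" by (auto simp: reduced_word_def word_for_def)
  have "reduced a"
  proof (rule ccontr)
    assume "\<not> reduced a"
    then obtain b where b: "word_perm b = word_perm a" "length b < length a" "set b \<subseteq> set a"
      using nonreduced_shorten by blast
    then have "word_for n w b" using a by (auto simp: word_for_def)
    with r b show False by (auto simp: reduced_word_def)
  qed
  with a show "word_perm a = w \<and> reduced a" by simp
next
  assume r: "word_perm a = w \<and> reduced a"
  then have "set a \<subseteq> {1..<n}" using reduced_letters assms by blast
  with r reduced_minimal show "reduced_word n w a"
    by (auto simp: reduced_word_def word_for_def)
qed

text \<open>If inserting the letter \<open>g\<close> into a reduced word destroys reducedness, then the two wires
  crossed by \<open>g\<close> already cross at some letter \<open>c\<close>, and deleting \<open>c\<close> restores the permutation.\<close>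

lemma exchange:
  assumes red: "reduced (x @ y)" and nonred: "\<not> reduced (x @ g # y)"
  obtains
    (left) x1 c x2 p q where "x = x1 @ c # x2" "p < q" "word_perm y p = g" "word_perm y q = Suc g"
      "word_perm (x2 @ y) p = c" "word_perm (x2 @ y) q = Suc c"
      "word_perm (x2 @ g # y) = word_perm (c # x2 @ y)"
  | (right) y1 c y2 p q where "y = y1 @ c # y2" "q < p" "word_perm y p = g" "word_perm y q = Suc g"
      "word_perm y2 q = c" "word_perm y2 p = Suc c"
      "word_perm (g # y1 @ y2) = word_perm y"
proof -
  let ?v = "word_perm (x @ y)"
  obtain p q where pq: "word_perm y p = g" "word_perm y q = Suc g" by (rule ex_wires)
  have ins: "word_perm (z @ g # y) = word_perm (z @ y) \<circ> Transposition.transpose p q" for z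
    by (rule word_perm_insert[OF pq])
  \<comment> \<open>For \<open>p < q\<close> the wires have not crossed in \<open>y\<close>, so the
    other crossing lies to the left of the gap; otherwise it has already happened in
    \<open>y\<close>.\<close>
  show thesis
  proof (cases "p < q")
    case True
    have "(p, q) \<in> inversions ?v"
    proof (rule ccontr)
      assume "(p, q) \<notin> inversions ?v"
      then have "?v p < ?v q" using True word_perm_inj[of "x @ y" p q]
        unfolding inversions_def by (metis (mono_tags, lifting) case_prod_conv linorder_neqE_nat mem_Collect_eq nat_neq_iff)
      then have "card (inversions (word_perm (x @ g # y))) \<ge> Suc (card (inversions ?v))"
        using card_inversions_reflection(2)[OF bij_word_perm finite_inversions True]
          finite_inversions[of "x @ g # y"] unfolding ins by blast
      then have "reduced (x @ g # y)"
        using red card_inversions_le[of "x @ g # y"] by (simp add: reduced_def)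
      with nonred show False by simp
    qed
    moreover have "(p, q) \<notin> inversions (word_perm y)" using pq by (auto simp: inversions_def)
    ultimately obtain x1 c x2 where c: "x = x1 @ c # x2"
      "word_perm (x2 @ y) p = c" "word_perm (x2 @ y) q = Suc c"
      using inversion_letter[OF red] by metis
    show thesis
    proof (rule left[OF c(1) True pq c(2,3)])
      show "word_perm (x2 @ g # y) = word_perm (c # x2 @ y)"
        using ins[of x2] word_perm_insert[OF c(2,3), of "[]"] by simp
    qed
  next
    case False
    with pq have qp: "q < p" by (metis n_not_Suc_n linorder_neqE_nat)
    with pq have "(q, p) \<in> inversions (word_perm y)" by (auto simp: inversions_def)
    moreover have "reduced y" using red reduced_append2 by simp
    ultimately obtain y1 c y2 where c: "y = y1 @ c # y2"
      and c': "word_perm y2 q = c" "word_perm y2 p = Suc c"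
      using inversion_letter' by blast
    have y: "word_perm y = word_perm (y1 @ y2) \<circ> Transposition.transpose q p"
      using word_perm_insert[OF c', of y1] c by simp
    have gy: "word_perm (g # y) = word_perm (y1 @ y2)"
      using ins[of "[]"] y by (simp add: o_assoc[symmetric] transpose_commute)
    show thesis
    proof (rule right[OF c qp pq c'])
      have "word_perm (g # y1 @ y2) = Transposition.transpose g (Suc g) \<circ> word_perm (g # y)"
        using gy by simp
      also have "\<dots> = word_perm y" by (simp add: o_assoc)
      finally show "word_perm (g # y1 @ y2) = word_perm y" .
    qed
  qed
qed

lemma deletion_conj:
  assumes "word_perm (x @ y @ h # z) = word_perm (x @ g # y @ z)"
  shows "word_perm (g # y) = word_perm (y @ [h])"
proof -
  have "word_perm ((y @ [h]) @ z) = word_perm ((g # y) @ z)"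
    using assms comp_left_cancel[of x] unfolding word_perm_append[of x] by simp
  then show ?thesis using comp_right_cancel[of _ z] unfolding word_perm_append[of _ z] by metis
qed

text \<open>If both deletions agreed, \<open>g\<close> could be carried through \<open>y\<close> to
  become \<open>h\<close>; then \<open>g y h\<close> acts as \<open>y h h\<close>, where the two
  copies of \<open>h\<close> cancel, and a word shorter by two remains.\<close>

lemma deletion_unique:
  assumes "reduced (x @ g # y @ h # z)"
  shows "word_perm (x @ y @ h # z) \<noteq> word_perm (x @ g # y @ z)"
proof
  assume "word_perm (x @ y @ h # z) = word_perm (x @ g # y @ z)"
  then have "word_perm (g # y) = word_perm (y @ [h])" by (rule deletion_conj)
  then have "word_perm (x @ (g # y) @ h # z) = word_perm (x @ (y @ [h]) @ h # z)"
    unfolding word_perm_append by simp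
  also have "\<dots> = word_perm (x @ y @ z)" by (simp add: o_assoc[symmetric]) (simp add: o_assoc)
  finally show False using reduced_minimal[OF assms, of "x @ y @ z"] by simp
qed

text \<open>Agreement of the last two deletions carries \<open>h\<close> through \<open>z\<close> to
  become \<open>k\<close>; hence \<open>h z k\<close> collapses to \<open>z\<close> in the word
  without \<open>g\<close>.\<close>

lemma deletions_at_most_two:
  assumes "word_perm (x @ y @ h # z @ k # u) = word_perm (x @ g # y @ z @ k # u)"
    "word_perm (x @ g # y @ z @ k # u) = word_perm (x @ g # y @ h # z @ u)"
  shows "\<not> reduced (x @ y @ h # z @ k # u)"
proof
  assume red: "reduced (x @ y @ h # z @ k # u)"
  have "word_perm ((x @ g # y) @ z @ k # u) = word_perm ((x @ g # y) @ h # z @ u)"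
    using assms(2) by simp
  then have e: "word_perm (h # z) = word_perm (z @ [k])" by (rule deletion_conj)
  then have "word_perm ((x @ y) @ (h # z) @ k # u) = word_perm ((x @ y) @ (z @ [k]) @ k # u)"
    unfolding word_perm_append by simp
  also have "\<dots> = word_perm (x @ y @ z @ u)" by (simp add: o_assoc[symmetric]) (simp add: o_assoc)
  finally show False using reduced_minimal[OF red, of "x @ y @ z @ u"] by simp
qed

section \<open>Little's bump\<close>

text \<open>Meant for the bump steps and for their converse: the two uses together match the first
  state of every chain with its last.\<close>

lemma partial_injection_ends:
  fixes m :: "'a \<Rightarrow> nat"
  assumes single: "\<And>x y z. F x y \<Longrightarrow> F x z \<Longrightarrow> y = z"
    and dec: "\<And>x y. F x y \<Longrightarrow> m y < m x"
  shows "\<exists>!z. F\<^sup>*\<^sup>* x z \<and> (\<nexists>y. F z y)"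
proof (induction "m x" arbitrary: x rule: less_induct)
  case less
  show ?case
  proof (cases "\<exists>y. F x y")
    case False
    then show ?thesis by (metis converse_rtranclpE rtranclp.rtrancl_refl)
  next
    case True
    then obtain y where y: "F x y" by blast
    from less[OF dec[OF this]] obtain z where z: "F\<^sup>*\<^sup>* y z" "\<nexists>u. F z u"
      and uni: "\<And>z'. F\<^sup>*\<^sup>* y z' \<Longrightarrow> \<nexists>u. F z' u \<Longrightarrow> z' = z" by blast
    show ?thesis
    proof (rule ex1I[of _ z])
      show "F\<^sup>*\<^sup>* x z \<and> (\<nexists>u. F z u)" using y z by (meson converse_rtranclp_into_rtranclp)
      fix z' assume "F\<^sup>*\<^sup>* x z' \<and> (\<nexists>u. F z' u)"
      then show "z' = z" using y uni single by (metis converse_rtranclpE)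
    qed
  qed
qed

text \<open>Little's bump of the wire ending in row \<open>r\<close>. A state is a reduced word \<open>x @ y\<close> of \<open>v\<close> with a
  marked gap. At the gap the wire has height \<open>word_perm y r\<close>; it is the lower of the two wires
  crossed by the letter inserted in \<open>low_word\<close>, and the upper one in \<open>high_word\<close>.\<close>

definition bump_states :: "(nat \<Rightarrow> nat) \<Rightarrow> (nat list \<times> nat list) set" where
  "bump_states v = {(x, y). reduced (x @ y) \<and> word_perm (x @ y) = v}"

definition low_word :: "nat \<Rightarrow> nat list \<times> nat list \<Rightarrow> nat list" where
  "low_word r = (\<lambda>(x, y). x @ word_perm y r # y)"

definition high_word :: "nat \<Rightarrow> nat list \<times> nat list \<Rightarrow> nat list" where
  "high_word r = (\<lambda>(x, y). x @ (word_perm y r - 1) # y)"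

text \<open>One move of the algorithm: within a state the inserted letter drops from its low to its
  high form, and the resulting word is then read as another state with its letter in low form. The
  inequality of lengths forces the gap to move.\<close>

definition bump_step :: "(nat \<Rightarrow> nat) \<Rightarrow> nat \<Rightarrow> nat list \<times> nat list \<Rightarrow> nat list \<times> nat list \<Rightarrow> bool" where
  "bump_step v r s s' \<longleftrightarrow> s \<in> bump_states v \<and> s' \<in> bump_states v \<and>
     high_word r s = low_word r s' \<and> length (fst s) \<noteq> length (fst s')"

lemma split_two:
  assumes "x @ g # y = x' @ h # y'" "length x < length x'"
  obtains z where "x' = x @ g # z" "y = z @ h # y'"
proof -
  from assms obtain us where "x' = x @ us" "g # y = us @ h # y'"
    by (auto simp: append_eq_append_conv2)
  with assms(2) show thesis using that by (cases us) auto
qed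

lemma two_deletions_reduced:
  assumes "x @ g # y = x' @ h # y'" "reduced (x @ g # y)" "word_perm (x @ y) = word_perm (x' @ y')"
  shows "x = x' \<and> y = y'"
proof -
  have "\<not> length x < length x'" if "x @ g # y = x' @ h # y'" "reduced (x @ g # y)"
    "word_perm (x @ y) = word_perm (x' @ y')" for x g y x' h y'
  proof
    assume "length x < length x'"
    with that(1) obtain z where z: "x' = x @ g # z" "y = z @ h # y'" by (rule split_two)
    then show False using deletion_unique[of x g z h y'] that by simp
  qed
  from this[of x g y x' h y'] this[of x' h y' x g y] assms have "length x = length x'"
    by (metis linorder_neqE_nat)
  then show ?thesis using assms(1) by simp
qed

text \<open>This makes the step relation a partial injection: besides the marked gap there is at
  most one other letter whose deletion restores the permutation. Each of the six orders of three
  distinct gaps is refuted by one instance of \<open>sorted\<close>.\<close>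

lemma three_deletions:
  assumes eq: "x @ g # y = x' @ h # y'" "x @ g # y = x'' @ k # y''"
    and red: "reduced (x @ y)"
    and perm: "word_perm (x @ y) = word_perm (x' @ y')" "word_perm (x @ y) = word_perm (x'' @ y'')"
    and ne: "length x \<noteq> length x'" "length x \<noteq> length x''"
  shows "x' = x'' \<and> y' = y''"
proof -
  have sorted: "\<not> (length x < length x' \<and> length x' < length x'')"
    if eq: "x @ g # y = x' @ h # y'" "x @ g # y = x'' @ k # y''"
    and red: "reduced (x @ y)"
    and perm: "word_perm (x @ y) = word_perm (x' @ y')" "word_perm (x @ y) = word_perm (x'' @ y'')"
    for x g y x' h y' x'' k and y'' :: "nat list"
  proof
    assume l: "length x < length x' \<and> length x' < length x''"
    obtain z where z: "x' = x @ g # z" "y = z @ h # y'" using eq(1) l by (auto elim: split_two)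
    have "x' @ h # y' = x'' @ k # y''" using eq by simp
    then obtain u where u: "x'' = x' @ h # u" "y' = u @ k # y''" using l by (auto elim: split_two)
    show False using deletions_at_most_two[of x z h u k y'' g] red perm z u by simp
  qed
  have red': "reduced (x' @ y')" "reduced (x'' @ y'')"
    using word_perm_cong_reduced[OF perm(1)] word_perm_cong_reduced[OF perm(2)] red
      arg_cong[OF eq(1), of length] arg_cong[OF eq(2), of length] by simp_all
  have eq': "x' @ h # y' = x'' @ k # y''" using eq by simp
  note perm' = perm(1)[symmetric] trans[OF perm(1)[symmetric] perm(2)]
    perm(2)[symmetric] trans[OF perm(2)[symmetric] perm(1)]
  have "length x' = length x''"
    using sorted[OF eq red perm] sorted[OF eq(2,1) red perm(2,1)]
      sorted[OF eq(1)[symmetric] eq' red'(1) perm'(1,2)]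
      sorted[OF eq' eq(1)[symmetric] red'(1) perm'(2,1)]
      sorted[OF eq(2)[symmetric] eq'[symmetric] red'(2) perm'(3,4)]
      sorted[OF eq'[symmetric] eq(2)[symmetric] red'(2) perm'(4,3)] ne
    by presburger
  moreover have "x' @ h # y' = x'' @ k # y''" using eq by simp
  ultimately show ?thesis by simp
qed

text \<open>The exchange lemma supplies some second crossing of the wire \<open>r\<close>;
  uniqueness of the other deletion identifies it with the target of the step.\<close>

lemma bump_step_cases:
  assumes step: "bump_step v r (x, y) (x', y')" and pos: "word_perm y r = Suc g"
  obtains
    (left) c z q where "x = x' @ c # z" "y' = z @ g # y" "q < r" "word_perm y q = g"
      "word_perm (z @ y) q = c" "word_perm (z @ y) r = Suc c"
      "word_perm (z @ g # y) = word_perm (c # z @ y)" "word_perm y' r = c"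
  | (right) c z p where "y = z @ c # y'" "x' = x @ g # z" "r < p" "word_perm y p = g"
      "word_perm y' r = c" "word_perm y' p = Suc c" "word_perm (g # z @ y') = word_perm y"
proof -
  from step have st: "reduced (x @ y)" "word_perm (x @ y) = v" "reduced (x' @ y')" "word_perm (x' @ y') = v"
    and eq: "x @ g # y = x' @ word_perm y' r # y'" and len: "length x \<noteq> length x'"
    using pos by (auto simp: bump_step_def bump_states_def low_word_def high_word_def)
  have nonred: "\<not> reduced (x @ g # y)"
    using two_deletions_reduced[OF eq] st len by auto
  have uniq: "u1 = x' \<and> u2 = y'"
    if "x @ g # y = u1 @ c # u2" "word_perm (u1 @ u2) = v" "length x \<noteq> length u1" for u1 u2 c
    using three_deletions[OF that(1) eq] st that len by auto
  from st(1) nonred show thesis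
  proof (cases rule: exchange)
    case (left x1 c x2 p q)
    have qr: "q = r" using left(4) pos by (metis word_perm_inj)
    have "word_perm (x1 @ x2 @ g # y) = word_perm (x @ y)"
      using left(1,7) unfolding word_perm_append[of x1] by simp
    then have xy: "x' = x1" "y' = x2 @ g # y" using uniq[of x1 c "x2 @ g # y"] left(1) st by simp_all
    then have c: "word_perm y' r = c" using eq left(1) by simp
    show thesis
      by (rule that(1)[of c x2 p]) (fact left(1)[folded xy(1)] xy(2) left[unfolded qr] c)+
  next
    case (right y1 c y2 p q)
    have qr: "q = r" using right(4) pos by (metis word_perm_inj)
    have "word_perm (x @ g # y1 @ y2) = word_perm (x @ y)"
      using right(7) unfolding word_perm_append[of x] by simp
    then have xy: "x' = x @ g # y1" "y' = y2" using uniq[of "x @ g # y1" c y2] right(1) st by simp_all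
    show thesis
      by (rule that(2)[of y1 c p]) (fact xy(1) right[folded xy(2), unfolded qr])+
  qed
qed

declare word_perm_append [simp del] word_perm_Cons [simp del]

text \<open>The two letters cross the same pair of wires, so the wire that is upper at one gap is
  lower at the other. Depending on which of the two is followed, this extends a chain forwards or
  backwards.\<close>

lemma other_deletion:
  assumes s: "(x, y) \<in> bump_states v" and nonred: "\<not> reduced (x @ g # y)"
  obtains x' c y' where "(x', y') \<in> bump_states v" "x @ g # y = x' @ c # y'" "length x \<noteq> length x'"
    "\<And>r. word_perm y r = Suc g \<Longrightarrow> word_perm y' r = c" "\<And>r. word_perm y r = g \<Longrightarrow> word_perm y' r = Suc c"
proof -
  have st: "reduced (x @ y)" "word_perm (x @ y) = v" using s by (auto simp: bump_states_def)
  note main = that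
  have other: "thesis" if eq: "x @ g # y = x' @ c # y'" "length x \<noteq> length x'"
    and perm: "word_perm (x' @ y') = word_perm (x @ y)"
    and pq: "word_perm y p = g" "word_perm y q = Suc g" "word_perm y' q = c" "word_perm y' p = Suc c" for x' c y' p q
  proof (rule main[OF _ eq])
    have "length (x' @ y') = length (x @ y)" using arg_cong[OF eq(1), of length] by simp
    then show "(x', y') \<in> bump_states v"
      using word_perm_cong_reduced[OF perm] perm st by (simp add: bump_states_def)
    show "word_perm y' r = c" if "word_perm y r = Suc g" for r using that pq by (metis word_perm_inj)
    show "word_perm y' r = Suc c" if "word_perm y r = g" for r using that pq by (metis word_perm_inj)
  qed
  from st(1) nonred show thesis
  proof (cases rule: exchange)
    case (left x1 c x2 p q)
    have h: "word_perm (x2 @ g # y) r = Transposition.transpose c (Suc c) (word_perm (x2 @ y) r)" for r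
      unfolding left(7) word_perm_Cons by simp
    show thesis
    proof (rule other[of x1 c "x2 @ g # y" p q])
      show "word_perm (x1 @ x2 @ g # y) = word_perm (x @ y)"
        using left(1,7) by (simp add: word_perm_append[of x1])
    qed (use left h[of p] h[of q] in auto)
  next
    case (right y1 c y2 p q)
    show thesis
    proof (rule other[of "x @ g # y1" c y2 p q])
      show "word_perm ((x @ g # y1) @ y2) = word_perm (x @ y)"
        using right(7) unfolding append.assoc append.simps word_perm_append[of x] by simp
    qed (use right in auto)
  qed
qed

lemma bump_step_exists:
  assumes s: "(x, y) \<in> bump_states v" and pos: "word_perm y r = Suc g"
    and nonred: "\<not> reduced (high_word r (x, y))"
  shows "\<exists>s'. bump_step v r (x, y) s'"
proof -
  have "\<not> reduced (x @ g # y)" using nonred pos by (simp add: high_word_def)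
  with s obtain x' c y' where o: "(x', y') \<in> bump_states v" "x @ g # y = x' @ c # y'" "length x \<noteq> length x'"
    "\<And>r. word_perm y r = Suc g \<Longrightarrow> word_perm y' r = c" using other_deletion by metis
  have "bump_step v r (x, y) (x', y')"
    using s o(1-3) o(4)[OF pos] pos by (simp add: bump_step_def high_word_def low_word_def)
  then show ?thesis by blast
qed

lemma bump_step_exists_back:
  assumes s: "(x, y) \<in> bump_states v" and nonred: "\<not> reduced (low_word r (x, y))"
  shows "\<exists>s'. bump_step v r s' (x, y)"
proof -
  define g where "g = word_perm y r"
  have "\<not> reduced (x @ g # y)" using nonred by (simp add: low_word_def g_def)
  with s obtain x' c y' where o: "(x', y') \<in> bump_states v" "x @ g # y = x' @ c # y'" "length x \<noteq> length x'"
    "\<And>r. word_perm y r = g \<Longrightarrow> word_perm y' r = Suc c" using other_deletion by metis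
  have "bump_step v r (x', y') (x, y)"
    using s o(1-3) o(4)[of r] by (simp add: bump_step_def high_word_def low_word_def g_def)
  then show ?thesis by blast
qed

lemma bump_stepD:
  assumes "bump_step v r (x, y) (x', y')"
  shows "reduced (x @ y)" "word_perm (x @ y) = v" "reduced (x' @ y')" "word_perm (x' @ y') = v"
    "x @ (word_perm y r - 1) # y = x' @ word_perm y' r # y'" "length x \<noteq> length x'"
  using assms by (auto simp: bump_step_def bump_states_def low_word_def high_word_def)

lemma bump_step_unique:
  assumes "bump_step v r s s'" "bump_step v r s s''"
  shows "s' = s''"
proof -
  obtain x y x' y' x'' y'' where s: "s = (x, y)" "s' = (x', y')" "s'' = (x'', y'')"
    by (cases s, cases s', cases s'') auto
  note a = bump_stepD[OF assms(1)[unfolded s]] and b = bump_stepD[OF assms(2)[unfolded s]]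
  show ?thesis
    using three_deletions[OF a(5) b(5) a(1) trans[OF a(2) a(4)[symmetric]]
      trans[OF b(2) b(4)[symmetric]] a(6) b(6)] s by simp
qed

lemma bump_step_unique_back:
  assumes "bump_step v r s' s" "bump_step v r s'' s"
  shows "s' = s''"
proof -
  obtain x y x' y' x'' y'' where s: "s = (x, y)" "s' = (x', y')" "s'' = (x'', y'')"
    by (cases s, cases s', cases s'') auto
  note a = bump_stepD[OF assms(1)[unfolded s]] and b = bump_stepD[OF assms(2)[unfolded s]]
  show ?thesis
    using three_deletions[OF a(5)[symmetric] b(5)[symmetric] a(3) trans[OF a(4) a(2)[symmetric]]
      trans[OF b(4) b(2)[symmetric]] a(6)[symmetric] b(6)[symmetric]] s by simp
qed

lemma bump_step_nonreduced:
  assumes "bump_step v r s s'"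
  shows "\<not> reduced (high_word r s)" "\<not> reduced (low_word r s')"
proof -
  obtain x y x' y' where s: "s = (x, y)" "s' = (x', y')" by (cases s, cases s') auto
  note a = bump_stepD[OF assms[unfolded s]]
  show "\<not> reduced (high_word r s)"
    using two_deletions_reduced[OF a(5) _ trans[OF a(2) a(4)[symmetric]]] a(6)
    by (auto simp: s high_word_def)
  then show "\<not> reduced (low_word r s')" using assms by (simp add: bump_step_def)
qed

text \<open>No letter is decremented twice: if the letter \<open>c\<close> was decremented (flag \<open>True\<close>), then the wire
  either passes strictly below \<open>c\<close>, or it crosses at \<open>c\<close>, descending towards the gap. The second
  coordinate of a flagged letter records whether it has been decremented.\<close>

definition original :: "nat \<times> bool \<Rightarrow> nat" where
  "original = (\<lambda>(c, f). if f then Suc c else c)"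

definition flags_ok :: "nat \<Rightarrow> (nat \<times> bool) list \<Rightarrow> (nat \<times> bool) list \<Rightarrow> bool" where
  "flags_ok r X Y \<longleftrightarrow>
     (\<forall>Xa c Xb. X = Xa @ (c, True) # Xb \<longrightarrow> word_perm (map fst Xb @ map fst Y) r \<le> c) \<and>
     (\<forall>Ya c Yb. Y = Ya @ (c, True) # Yb \<longrightarrow>
        word_perm (map fst Yb) r < c \<or> word_perm (map fst Yb) r = Suc c)"

lemma flags_okI:
  assumes "\<And>Xa c Xb. X = Xa @ (c, True) # Xb \<Longrightarrow> word_perm (map fst Xb @ map fst Y) r \<le> c"
    and "\<And>Ya c Yb. Y = Ya @ (c, True) # Yb \<Longrightarrow>
      word_perm (map fst Yb) r < c \<or> word_perm (map fst Yb) r = Suc c"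
  shows "flags_ok r X Y"
  using assms unfolding flags_ok_def by blast

lemma append_eq_splitE:
  assumes "xs @ z # ys = as @ c # bs"
  obtains (left) us where "xs = as @ c # us" "bs = us @ z # ys"
  | (mid) "xs = as" "z = c" "ys = bs"
  | (right) us where "as = xs @ z # us" "ys = us @ c # bs"
proof -
  from assms obtain us where
    "xs = as @ us \<and> us @ z # ys = c # bs \<or> xs @ us = as \<and> z # ys = us @ c # bs"
    by (auto simp: append_eq_append_conv2)
  then show thesis using left mid right by (cases us) auto
qed

text \<open>Outside the stretch between the old and the new gap the wire \<open>r\<close> keeps its
  heights. Inside it, \<open>r\<close> trades places with the wire that it meets at both ends; that
  wire ran below it there, so the bounds required by the flags persist.\<close>

lemma flags_ok_step:
  assumes step: "bump_step v r (map fst X, map fst Y) (x', y')"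
    and pos: "word_perm (map fst Y) r = Suc g" and flags: "flags_ok r X Y"
  obtains X' Y' c where "map fst X' = x'" "map fst Y' = y'" "flags_ok r X' Y'"
    "X @ (g, True) # Y = X' @ (c, False) # Y'" "word_perm y' r = c"
proof -
  have flagX: "word_perm (map fst Xb @ map fst Y) r \<le> c" if "X = Xa @ (c, True) # Xb" for Xa c Xb
    using flags that by (auto simp: flags_ok_def)
  have flagY: "word_perm (map fst Yb) r < c \<or> word_perm (map fst Yb) r = Suc c"
    if "Y = Ya @ (c, True) # Yb" for Ya c Yb
    using flags that by (auto simp: flags_ok_def)
  have red: "reduced (map fst X @ map fst Y)" using bump_stepD[OF step] by blast
  show thesis
    using step pos
  proof (cases rule: bump_step_cases)
    case (left c z q)
    then obtain X' f Z where X: "X = X' @ (c, f) # Z" "map fst X' = x'" "map fst Z = z"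
      by (auto simp: map_eq_append_conv map_eq_Cons_conv)
    \<comment> \<open>A flagged \<open>c\<close> left of the gap would need the wire at height at
      most \<open>c\<close> here, but it is at \<open>Suc c\<close>.\<close>
    have nf: "f = False"
      using flagX[of X' c Z] X left(6) by (cases f) auto
    have perm_eq: "word_perm (xb @ c # z @ map fst Y) = word_perm (xb @ z @ g # map fst Y)" for xb
      using left(7) by (simp add: word_perm_append[of xb])
    have "flags_ok r X' (Z @ (g, True) # Y)"
    proof (rule flags_okI)
      fix Xa k Xb assume "X' = Xa @ (k, True) # Xb"
      then show "word_perm (map fst Xb @ map fst (Z @ (g, True) # Y)) r \<le> k"
        using flagX[of Xa k "Xb @ (c, f) # Z"] X perm_eq[of "map fst Xb"] by simp
    next
      fix Ya k Yb assume "Z @ (g, True) # Y = Ya @ (k, True) # Yb"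
      then show "word_perm (map fst Yb) r < k \<or> word_perm (map fst Yb) r = Suc k"
      proof (cases rule: append_eq_splitE)
        case (left us)
        let ?y = "map fst us @ map fst Y"
        have old: "word_perm ?y r \<le> k" using flagX[of "X' @ (c, f) # Ya" k us] X left by simp
        have "reduced (z @ map fst Y)"
          using red X reduced_append2[of "x' @ [c]"] by simp
        then have "inversions (word_perm ?y) \<subseteq> inversions (word_perm (z @ map fst Y))"
          using inversions_mono[of "map fst Ya @ [k]" ?y] X(3)[symmetric] left by simp
        then have "(q, r) \<notin> inversions (word_perm ?y)"
          using \<open>word_perm (z @ map fst Y) q = c\<close> \<open>word_perm (z @ map fst Y) r = Suc c\<close>
          by (auto simp: inversions_def)
        then have "word_perm ?y q < word_perm ?y r"
          using \<open>q < r\<close> word_perm_inj[of ?y q r] by (auto simp: inversions_def simp del: word_perm_inj)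
        moreover have "word_perm (map fst us @ g # map fst Y) r = word_perm ?y q"
          using word_perm_insert[OF \<open>word_perm (map fst Y) q = g\<close> pos, of "map fst us"] by simp
        ultimately show ?thesis using left(2) old by simp
      next
        case mid then show ?thesis using pos by simp
      next
        case (right us) then show ?thesis using flagY[of us k Yb] by simp
      qed
    qed
    then show thesis
      using that[of X' "Z @ (g, True) # Y" c] X nf left by simp
  next
    case (right c z p)
    then obtain Z f Y' where Y: "Y = Z @ (c, f) # Y'" "map fst Z = z" "map fst Y' = y'"
      by (auto simp: map_eq_append_conv map_eq_Cons_conv)
    \<comment> \<open>The wire is at height \<open>c\<close> here, which is exactly the height
      forbidden by a flag right of the gap.\<close>
    have nf: "f = False"
      using flagY[of Z c Y'] Y right(5) by (cases f) auto
    have perm_eq: "word_perm (xb @ g # z @ y') = word_perm (xb @ map fst Y)" for xb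
      using right(7) by (simp add: word_perm_append[of xb])
    have "flags_ok r (X @ (g, True) # Z) Y'"
    proof (rule flags_okI)
      fix Ya k Yb assume "Y' = Ya @ (k, True) # Yb"
      then show "word_perm (map fst Yb) r < k \<or> word_perm (map fst Yb) r = Suc k"
        using flagY[of "Z @ (c, f) # Ya" k Yb] Y by simp
    next
      fix Xa k Xb assume "X @ (g, True) # Z = Xa @ (k, True) # Xb"
      then show "word_perm (map fst Xb @ map fst Y') r \<le> k"
      proof (cases rule: append_eq_splitE)
        case (left us)
        then show ?thesis using flagX[of Xa k us] perm_eq[of "map fst us"] Y by simp
      next
        case mid
        have "word_perm (g # z @ y') r = Suc g" using perm_eq[of "[]"] pos by simp
        then have "Transposition.transpose g (Suc g) (word_perm (z @ y') r) = Suc g"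
          by (simp add: word_perm_Cons)
        then have "word_perm (z @ y') r = g"
          by (metis transpose_apply_second transpose_involutory)
        then show ?thesis using mid Y by simp
      next
        case (right us)
        let ?y = "map fst Xb @ y'" and ?cy = "map fst Xb @ c # y'"
        have old: "word_perm ?cy r < k \<or> word_perm ?cy r = Suc k"
          using flagY[of us k "Xb @ (c, f) # Y'"] Y right by simp
        have "(r, p) \<in> inversions (word_perm (c # y'))"
          using \<open>r < p\<close> \<open>word_perm y' r = c\<close> \<open>word_perm y' p = Suc c\<close>
          by (simp add: inversions_def word_perm_Cons)
        moreover have "reduced ?cy"
          using red Y right(2) reduced_append2[of "map fst X @ map fst us @ [k]"] by simp
        ultimately have "(r, p) \<in> inversions (word_perm ?cy)"
          using inversions_mono[of "map fst Xb" "c # y'"] by blast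
        then have "word_perm ?cy p < word_perm ?cy r" by (simp add: inversions_def)
        moreover have "word_perm ?cy p = word_perm ?y r"
          using word_perm_insert[OF \<open>word_perm y' r = c\<close> \<open>word_perm y' p = Suc c\<close>, of "map fst Xb"]
          by simp
        ultimately show ?thesis using old Y(3) by auto
      qed
    qed
    then show thesis
      using that[of "X @ (g, True) # Z" Y' c] Y nf right by simp
  qed
qed

lemma bump_state_height:
  assumes v: "v permutes {1..n}" and s: "(x, y) \<in> bump_states v" and r: "r \<in> {1..n}"
  shows "word_perm y r \<in> {1..n}" "set (x @ y) \<subseteq> {1..<n}"
proof -
  show letters: "set (x @ y) \<subseteq> {1..<n}"
    using s v reduced_letters[of "x @ y" 1 n] by (auto simp: bump_states_def)
  then have "word_perm y permutes {1..n}" by (intro word_perm_permutes) auto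
  then show "word_perm y r \<in> {1..n}" using r by (metis permutes_in_image)
qed

lemma sum_list_le_length: "set a \<subseteq> {..n} \<Longrightarrow> sum_list a \<le> n * length a" for n :: nat
  by (induction a) auto

text \<open>A step decrements one letter and otherwise only reinterprets the word. The sum of the
  letters is thus the termination measure forwards, and its distance from the upper bound the one
  backwards.\<close>

lemma bump_step_sum:
  assumes v: "v permutes {1..n}" and r: "r \<in> {1..n}" and s: "bump_step v r s s'"
  shows "sum_list (low_word r s) = Suc (sum_list (low_word r s'))"
    "sum_list (low_word r s) \<le> n * Suc (card (inversions v))"
proof -
  obtain x y x' y' where xy: "s = (x, y)" "s' = (x', y')" by (cases s, cases s') auto
  have st: "(x, y) \<in> bump_states v" using s xy by (auto simp: bump_step_def)
  have h: "word_perm y r \<in> {1..n}" "set (x @ y) \<subseteq> {1..<n}" using bump_state_height[OF v st r] by auto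
  have "low_word r s' = high_word r s" using s by (simp add: bump_step_def)
  then show "sum_list (low_word r s) = Suc (sum_list (low_word r s'))"
    using h by (auto simp: xy low_word_def high_word_def)
  have "sum_list (low_word r s) \<le> n * length (low_word r s)"
    using h by (intro sum_list_le_length) (auto simp: xy low_word_def)
  moreover have "length (low_word r s) = Suc (card (inversions v))"
    using st by (auto simp: xy low_word_def bump_states_def reduced_def)
  ultimately show "sum_list (low_word r s) \<le> n * Suc (card (inversions v))" by simp
qed

definition decremented :: "nat list \<Rightarrow> nat list \<Rightarrow> bool" where
  "decremented = list_all2 (\<lambda>a b. a = b \<or> a = Suc b)"

text \<open>There are no flags at the start. Undoing the flags, with the current low letter at the
  gap, always gives back the initial word; the final drop to the high form decrements the letter at
  the gap, which is unflagged.\<close>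

lemma bump_steps_decremented:
  assumes v: "v permutes {1..n}" and r: "r \<in> {1..n}" and s: "s \<in> bump_states v"
    and steps: "(bump_step v r)\<^sup>*\<^sup>* s s'"
  shows "s' \<in> bump_states v" "decremented (low_word r s) (high_word r s')"
proof -
  show st: "s' \<in> bump_states v" using steps s by induction (auto simp: bump_step_def)
  have "\<exists>X Y. (map fst X, map fst Y) = s' \<and> flags_ok r X Y \<and>
    map original X @ word_perm (map fst Y) r # map original Y = low_word r s"
    using steps
  proof induction
    case base
    obtain x y where "s = (x, y)" by force
    then show ?case
      by (intro exI[of _ "map (\<lambda>c. (c, False)) x"] exI[of _ "map (\<lambda>c. (c, False)) y"])
        (auto simp: comp_def flags_ok_def original_def low_word_def map_eq_append_conv map_eq_Cons_conv)
  next
    case (step s1 s2)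
    then obtain X Y where XY: "(map fst X, map fst Y) = s1" "flags_ok r X Y"
      "map original X @ word_perm (map fst Y) r # map original Y = low_word r s" by blast
    obtain x' y' where s2: "s2 = (x', y')" by force
    have "(map fst X, map fst Y) \<in> bump_states v" using step(2) XY by (auto simp: bump_step_def)
    then have "word_perm (map fst Y) r \<in> {1..n}" by (rule bump_state_height[OF v _ r])
    then obtain g where g: "word_perm (map fst Y) r = Suc g" by (cases "word_perm (map fst Y) r") auto
    have "bump_step v r (map fst X, map fst Y) (x', y')" using step(2) XY(1) s2 by simp
    then obtain X' Y' c where X': "map fst X' = x'" "map fst Y' = y'" "flags_ok r X' Y'"
      "X @ (g, True) # Y = X' @ (c, False) # Y'" "word_perm y' r = c"
      using flags_ok_step[OF _ g XY(2)] by blast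
    from arg_cong[OF X'(4), of "map original"]
    have "map original X @ Suc g # map original Y = map original X' @ c # map original Y'"
      by (simp add: original_def)
    then show ?case using X' XY s2 g by auto
  qed
  then obtain X Y where XY: "(map fst X, map fst Y) = s'"
    "map original X @ word_perm (map fst Y) r # map original Y = low_word r s" by blast
  have "word_perm (map fst Y) r \<in> {1..n}" using bump_state_height[OF v _ r] st XY(1) by blast
  then have "word_perm (map fst Y) r = Suc (word_perm (map fst Y) r - 1)" by simp
  moreover have "decremented (map original Z) (map fst Z)" for Z
    by (auto simp: decremented_def list_all2_conv_all_nth original_def split: prod.split)
  ultimately show "decremented (low_word r s) (high_word r s')"
    using XY(1) unfolding XY(2)[symmetric] decremented_def
    by (auto simp: high_word_def intro!: list_all2_appendI)
qed

section \<open>Ends of chains as reduced words of covers\<close>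

lemma insert_letter_covers:
  assumes "reduced (x @ y)" "reduced (x @ g # y)" "word_perm y p = g" "word_perm y q = Suc g"
  shows "covers (word_perm (x @ y)) p q"
    and "word_perm (x @ g # y) = word_perm (x @ y) \<circ> Transposition.transpose p q"
proof -
  let ?v = "word_perm (x @ y)"
  show perm: "word_perm (x @ g # y) = ?v \<circ> Transposition.transpose p q"
    by (rule word_perm_insert[OF assms(3,4)])
  have "reduced (g # y)" using assms(2) reduced_append2 by blast
  then have pq: "p < q" using reduced_Cons[OF assms(3,4)] by simp
  then have "(p, q) \<in> inversions (word_perm (g # y))"
    using assms by (simp add: inversions_def word_perm_Cons)
  then have "(p, q) \<in> inversions (word_perm (x @ g # y))" using inversions_mono[OF assms(2)] by blast
  then have "?v p < ?v q" by (simp add: perm inversions_def)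
  then show "covers ?v p q"
    using card_inversions_reflection(3)[OF bij_word_perm finite_inversions pq, of "x @ y"]
      finite_inversions[of "x @ g # y"] assms(1,2) unfolding perm reduced_def by simp
qed

text \<open>The letter is the birthplace of the inversion \<open>(p, q)\<close>. Deleting it undoes
  the reflection, and the rest is reduced because a cover has exactly one inversion more.\<close>

lemma covers_letter:
  assumes "covers v p q" "reduced a" "word_perm a = v \<circ> Transposition.transpose p q"
  obtains x g y where "a = x @ g # y" "reduced (x @ y)" "word_perm (x @ y) = v"
    "word_perm y p = g" "word_perm y q = Suc g"
proof -
  have "(p, q) \<in> inversions (word_perm a)"
    using assms(1) unfolding assms(3) by (simp add: inversions_def covers_def)
  then obtain x g y where a: "a = x @ g # y" "word_perm y p = g" "word_perm y q = Suc g"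
    using inversion_letter'[OF assms(2)] by blast
  have "word_perm (x @ y) \<circ> Transposition.transpose p q \<circ> Transposition.transpose p q = v"
    using word_perm_insert[OF a(2,3), of x] assms(3) a(1) by (simp add: o_assoc[symmetric])
  then have v: "word_perm (x @ y) = v" by (simp add: o_assoc[symmetric])
  have "p < q" using assms(1) by (simp add: covers_def)
  from card_inversions_reflection(1)[OF bij_word_perm finite_inversions this, of "x @ y"]
  have "reduced (x @ y)"
    using assms a unfolding v reduced_def by simp
  with a v that show thesis by blast
qed

text \<open>Initial states correspond to \<open>A\<close> through their low words and final states
  to \<open>B\<close> through their high words, since inserting a letter with reduced result amounts
  to a cover. The index \<open>i = 0\<close> is still allowed in \<open>B\<close>; it would belong
  to words containing the letter \<open>0\<close>.\<close>

theorem little_bump: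
  assumes v: "v permutes {1..n}" and r: "r \<in> {1..n}"
  defines "A \<equiv> {a. reduced a \<and> (\<exists>s. covers v r s \<and> word_perm a = v \<circ> Transposition.transpose r s)}"
    and "B \<equiv> {b. reduced b \<and> (\<exists>i. covers v i r \<and> word_perm b = v \<circ> Transposition.transpose i r)}"
  shows "\<exists>f. bij_betw f A B \<and> (\<forall>a\<in>A. decremented a (f a))"
proof -
  let ?F = "bump_step v r" and ?low = "low_word r" and ?high = "high_word r"
  define R where "R s e \<longleftrightarrow> s \<in> bump_states v \<and> reduced (?low s) \<and> ?F\<^sup>*\<^sup>* s e \<and> reduced (?high e)" for s e
  have pos: "\<exists>g. word_perm y r = Suc g" if "(x, y) \<in> bump_states v" for x y
    using bump_state_height(1)[OF v that r] by (cases "word_perm y r") auto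
  \<comment> \<open>A chain stops exactly when the inserted letter yields a reduced word, for then
    there is no second crossing to remove.\<close>
  have last: "(\<nexists>s'. ?F s s') \<longleftrightarrow> reduced (?high s)" if "s \<in> bump_states v" for s
  proof -
    obtain x y where s: "s = (x, y)" by force
    then show ?thesis
      using bump_step_exists bump_step_nonreduced(1) pos that by metis
  qed
  have first: "(\<nexists>s'. ?F s' s) \<longleftrightarrow> reduced (?low s)" if "s \<in> bump_states v" for s
  proof -
    obtain x y where s: "s = (x, y)" by force
    then show ?thesis
      using bump_step_exists_back bump_step_nonreduced(2) that by metis
  qed
  have R_states: "s \<in> bump_states v" "e \<in> bump_states v" if "R s e" for s e
    using that bump_steps_decremented(1)[OF v r, of s e] by (auto simp: R_def)
  have forward: "\<exists>!e. R s e" if s: "s \<in> bump_states v" "reduced (?low s)" for s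
  proof -
    have "\<exists>!z. ?F\<^sup>*\<^sup>* s z \<and> (\<nexists>y. ?F z y)"
      by (rule partial_injection_ends[of ?F "\<lambda>s. sum_list (?low s)"])
        (use bump_step_unique bump_step_sum(1)[OF v r] in \<open>auto\<close>)
    moreover have "R s z \<longleftrightarrow> ?F\<^sup>*\<^sup>* s z \<and> (\<nexists>y. ?F z y)" for z
      using s bump_steps_decremented(1)[OF v r s(1), of z] last[of z] unfolding R_def by blast
    ultimately show ?thesis by simp
  qed
  have backward: "\<exists>!s. R s e" if e: "e \<in> bump_states v" "reduced (?high e)" for e
  proof -
    have "\<exists>!z. ?F\<inverse>\<inverse>\<^sup>*\<^sup>* e z \<and> (\<nexists>y. ?F\<inverse>\<inverse> z y)"
    proof (rule partial_injection_ends[of "?F\<inverse>\<inverse>" "\<lambda>s. n * Suc (card (inversions v)) - sum_list (?low s)"])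
      show "n * Suc (card (inversions v)) - sum_list (?low y) < n * Suc (card (inversions v)) - sum_list (?low x)"
        if "?F\<inverse>\<inverse> x y" for x y
        using bump_step_sum[OF v r, of y x] that by simp
    qed (use bump_step_unique_back in auto)
    moreover have "R z e \<longleftrightarrow> ?F\<inverse>\<inverse>\<^sup>*\<^sup>* e z \<and> (\<nexists>y. ?F\<inverse>\<inverse> z y)" for z
    proof -
      have "z \<in> bump_states v" if "?F\<^sup>*\<^sup>* z e"
        using that e(1) by (induction rule: converse_rtranclp_induct) (auto simp: bump_step_def)
      then show ?thesis
        using e first[of z] unfolding R_def rtranclp_conversep conversep_iff by blast
    qed
    ultimately show ?thesis by simp
  qed
  have low_A: "bij_betw ?low {s \<in> bump_states v. reduced (?low s)} A"
  proof (rule bij_betwI')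
    fix s s' assume "s \<in> {s \<in> bump_states v. reduced (?low s)}" "s' \<in> {s \<in> bump_states v. reduced (?low s)}"
    then show "?low s = ?low s' \<longleftrightarrow> s = s'"
      by (cases s, cases s') (auto simp: low_word_def bump_states_def dest!: two_deletions_reduced)
  next
    fix s assume s: "s \<in> {s \<in> bump_states v. reduced (?low s)}"
    obtain x y where xy: "s = (x, y)" by force
    obtain q where q: "word_perm y q = Suc (word_perm y r)" using ex_wires by metis
    show "?low s \<in> A"
      using s insert_letter_covers[OF _ _ refl q, of x] unfolding A_def xy
      by (auto simp: bump_states_def low_word_def)
  next
    fix a assume "a \<in> A"
    then obtain s where s: "reduced a" "covers v r s" "word_perm a = v \<circ> Transposition.transpose r s"
      by (auto simp: A_def)
    obtain x g y where a: "a = x @ g # y" "reduced (x @ y)" "word_perm (x @ y) = v" "word_perm y r = g"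
      using covers_letter[OF s(2,1,3)] by blast
    then show "\<exists>s\<in>{s \<in> bump_states v. reduced (?low s)}. a = ?low s"
      using s(1) by (intro bexI[of _ "(x, y)"]) (auto simp: low_word_def bump_states_def)
  qed
  have high_B: "bij_betw ?high {s \<in> bump_states v. reduced (?high s)} B"
  proof (rule bij_betwI')
    fix s s' assume "s \<in> {s \<in> bump_states v. reduced (?high s)}" "s' \<in> {s \<in> bump_states v. reduced (?high s)}"
    then show "?high s = ?high s' \<longleftrightarrow> s = s'"
      by (cases s, cases s') (auto simp: high_word_def bump_states_def dest!: two_deletions_reduced)
  next
    fix s assume s: "s \<in> {s \<in> bump_states v. reduced (?high s)}"
    obtain x y where xy: "s = (x, y)" by force
    obtain g where g: "word_perm y r = Suc g" using pos s xy by blast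
    obtain q where q: "word_perm y q = g" using ex_wires by metis
    show "?high s \<in> B"
      using s insert_letter_covers[OF _ _ q g, of x] g unfolding B_def xy
      by (auto simp: bump_states_def high_word_def)
  next
    fix b assume "b \<in> B"
    then obtain i where i: "reduced b" "covers v i r" "word_perm b = v \<circ> Transposition.transpose i r"
      by (auto simp: B_def)
    obtain x g y where b: "b = x @ g # y" "reduced (x @ y)" "word_perm (x @ y) = v" "word_perm y r = Suc g"
      using covers_letter[OF i(2,1,3)] by blast
    then show "\<exists>s\<in>{s \<in> bump_states v. reduced (?high s)}. b = ?high s"
      using i(1) by (intro bexI[of _ "(x, y)"]) (auto simp: high_word_def bump_states_def)
  qed
  define f where "f s = (THE e. R s e)" for s
  have f: "R s (f s)" if "s \<in> bump_states v" "reduced (?low s)" for s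
    unfolding f_def by (rule theI') (rule forward[OF that])
  have bij_f: "bij_betw f {s \<in> bump_states v. reduced (?low s)} {s \<in> bump_states v. reduced (?high s)}"
  proof (rule bij_betwI')
    fix s s' assume s: "s \<in> {s \<in> bump_states v. reduced (?low s)}" "s' \<in> {s \<in> bump_states v. reduced (?low s)}"
    then have "R s (f s)" "R s' (f s')" using f by auto
    then show "f s = f s' \<longleftrightarrow> s = s'"
      using backward[of "f s"] R_states by (metis R_def)
  next
    fix s assume "s \<in> {s \<in> bump_states v. reduced (?low s)}"
    then show "f s \<in> {s \<in> bump_states v. reduced (?high s)}"
      using f[of s] R_states[of s "f s"] by (auto simp: R_def)
  next
    fix e assume "e \<in> {s \<in> bump_states v. reduced (?high s)}"
    then obtain s where s: "R s e" using backward[of e] by auto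
    then have "s \<in> {s \<in> bump_states v. reduced (?low s)}" by (auto simp: R_def)
    moreover from this have "e = f s" using forward[of s] f[of s] s by blast
    ultimately show "\<exists>s\<in>{s \<in> bump_states v. reduced (?low s)}. e = f s" by blast
  qed
  let ?S = "{s \<in> bump_states v. reduced (?low s)}"
  have "bij_betw (?high \<circ> f \<circ> inv_into ?S ?low) A B"
    using bij_betw_trans[OF bij_betw_inv_into[OF low_A] bij_betw_trans[OF bij_f high_B]]
    by (simp add: o_assoc)
  moreover have "decremented a ((?high \<circ> f \<circ> inv_into ?S ?low) a)" if "a \<in> A" for a
  proof -
    let ?s = "inv_into ?S ?low a"
    have s: "?s \<in> ?S" "?low ?s = a"
      using bij_betwE[OF bij_betw_inv_into[OF low_A]] bij_betw_inv_into_right[OF low_A] that by blast+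
    then have "?F\<^sup>*\<^sup>* ?s (f ?s)" using f[of ?s] unfolding R_def by blast
    then have "decremented (?low ?s) (?high (f ?s))"
      using bump_steps_decremented(2)[OF v r, of ?s "f ?s"] s(1) by blast
    then show ?thesis unfolding s(2) comp_def .
  qed
  ultimately show ?thesis by blast
qed

section \<open>Column tableaux\<close>

lemma reduced_append1: "reduced (x @ y) \<Longrightarrow> reduced x"
proof (rule ccontr)
  assume r: "reduced (x @ y)" "\<not> reduced x"
  then obtain b where b: "word_perm b = word_perm x" "length b < length x"
    using nonreduced_shorten by blast
  then have "word_perm (x @ y) = word_perm (b @ y)" by (simp add: word_perm_append)
  from reduced_minimal[OF r(1) this] b(2) show False by simp
qed

lemma reduced_no_repeat: "\<not> reduced (x @ g # g # y)"
proof
  assume r: "reduced (x @ g # g # y)"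
  have "word_perm (x @ g # g # y) = word_perm (x @ y)"
    by (simp add: word_perm_append word_perm_Cons o_assoc[symmetric]) (simp add: o_assoc)
  from reduced_minimal[OF r this] show False by simp
qed

lemma word_perm_run:
  "m \<le> n \<Longrightarrow> word_perm [m..<n] p = (if p = n then m else if m \<le> p \<and> p < n then Suc p else p)"
proof (induction m rule: inc_induct)
  case (step k)
  then have "[k..<n] = k # [Suc k..<n]" by (simp add: upt_conv_Cons)
  then show ?case using step
    by (auto simp: word_perm_Cons Transposition.transpose_def)
qed simp

lemma word_perm_fix: "(\<And>b. b \<in> set B \<Longrightarrow> p \<noteq> b \<and> p \<noteq> Suc b) \<Longrightarrow> word_perm B p = p"
  by (induction B) (auto simp: word_perm_Cons)

text \<open>The letters of \<open>B\<close> lie above the run and those of \<open>A\<close> below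
  it, so the two runs act on the wires ending in \<open>a\<close> and \<open>Suc a\<close> as if
  they were adjacent. These wires cross in the right run and once more at the first letter
  \<open>m\<close>.\<close>

lemma double_run_nonreduced:
  assumes "m \<le> a" "\<And>b. b \<in> set B \<Longrightarrow> Suc a < b" "\<And>b. b \<in> set A \<Longrightarrow> Suc b < m"
  shows "\<not> reduced ([m..<Suc a] @ B @ A @ [m..<Suc a])"
proof -
  let ?y = "[Suc m..<Suc a] @ B @ A @ [m..<Suc a]"
  have fix1: "word_perm A m = m" "word_perm B m = m" "word_perm A (Suc a) = Suc a" "word_perm B (Suc a) = Suc a"
    using assms by (force intro: word_perm_fix)+
  have "word_perm ?y (Suc a) = m"
    using assms(1) fix1 by (simp add: word_perm_append word_perm_run del: upt_Suc)
  moreover have "word_perm ?y a = Suc m"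
    using assms(1) fix1 by (simp add: word_perm_append word_perm_run del: upt_Suc)
  ultimately have "\<not> reduced (m # ?y)" using reduced_Cons[of ?y "Suc a" m a] by simp
  moreover have "[m..<Suc a] @ B @ A @ [m..<Suc a] = m # ?y"
    using assms(1) upt_conv_Cons[of m "Suc a"] by simp
  ultimately show ?thesis by simp
qed

lemma sorted_wrt_less_nth_add:
  fixes xs :: "nat list"
  assumes "sorted_wrt (<) xs" "i \<le> j" "j < length xs"
  shows "xs ! i + (j - i) \<le> xs ! j"
  using assms(2,3)
proof (induction j rule: dec_induct)
  case (step k)
  then have "xs ! k < xs ! Suc k" using assms(1) sorted_wrt_nth_less by fastforce
  with step show ?case by simp
qed simp

lemma sublist_eq_upt:
  assumes "\<And>l. k \<le> l \<Longrightarrow> l \<le> i \<Longrightarrow> xs ! l = m + (l - k)" "k \<le> i" "i < length xs"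
  shows "xs = take k xs @ [m..<m + Suc (i - k)] @ drop (Suc i) xs"
  by (rule nth_equalityI) (use assms in \<open>auto simp: nth_append min_def simp del: upt_Suc\<close>)

text \<open>For a reduced word, weak inequality along the rows of two adjacent columns implies strict
  inequality: at a last equality \<open>c ! i = d ! i\<close> the two columns contain a common run ending there,
  and the two wires crossed by its last letter would cross again at its first letter.\<close>

lemma columns_weak_imp_strict:
  assumes sc: "sorted_wrt (<) c" and sd: "sorted_wrt (<) d" and len: "length d \<le> length c"
    and weak: "\<And>i. i < length d \<Longrightarrow> c ! i \<le> d ! i" and red: "reduced (d @ c)"
  shows "\<forall>i<length d. c ! i < d ! i"
proof (rule ccontr)
  assume "\<not> (\<forall>i<length d. c ! i < d ! i)"
  then have ne: "{i. i < length d \<and> c ! i = d ! i} \<noteq> {}" using weak by force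
  define i where "i = Max {i. i < length d \<and> c ! i = d ! i}"
  have "i \<in> {i. i < length d \<and> c ! i = d ! i}" unfolding i_def using ne by (intro Max_in) auto
  then have i: "i < length d" "c ! i = d ! i" by auto
  have last: "j \<le> i" if "j < length d" "c ! j = d ! j" for j
    unfolding i_def using that by (intro Max_ge) auto
  \<comment> \<open>\<open>k\<close> starts the longest run of consecutive entries of
    \<open>c\<close> that ends at \<open>i\<close>. By its minimality the entries of
    \<open>c\<close> above the run stay at least two below \<open>m\<close>; by the choice of
    \<open>i\<close> the entries of \<open>d\<close> below the run exceed its end by at least
    two.\<close>
  define k where "k = (LEAST k. k \<le> i \<and> c ! k + (i - k) = c ! i)"
  have k: "k \<le> i" "c ! k + (i - k) = c ! i"
    using LeastI[of "\<lambda>k. k \<le> i \<and> c ! k + (i - k) = c ! i" i] by (simp_all add: k_def)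
  have kmin: "\<not> (j \<le> i \<and> c ! j + (i - j) = c ! i)" if "j < k" for j
    using not_less_Least[of j] that unfolding k_def by blast
  define m where "m = c ! k"
  have run_c: "c ! l = m + (l - k)" if "k \<le> l" "l \<le> i" for l
    using sorted_wrt_less_nth_add[OF sc, of k l] sorted_wrt_less_nth_add[OF sc, of l i] that i len k
    by (simp add: m_def)
  \<comment> \<open>\<open>d\<close> is squeezed: weak inequality bounds it from below by the run of
    \<open>c\<close>, strict growth up to the common value at \<open>i\<close> from above.\<close>
  have run_d: "d ! l = m + (l - k)" if "k \<le> l" "l \<le> i" for l
    using sorted_wrt_less_nth_add[OF sd, of l i] weak[of l] run_c[OF that] run_c[of i] that i k by simp
  let ?a = "m + (i - k)"
  have c_split: "c = take k c @ [m..<Suc ?a] @ drop (Suc i) c"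
    using sublist_eq_upt[of k i c m] run_c k i len by (simp del: upt_Suc)
  have d_split: "d = take k d @ [m..<Suc ?a] @ drop (Suc i) d"
    using sublist_eq_upt[of k i d m] run_d k i by (simp del: upt_Suc)
  have A: "Suc b < m" if "b \<in> set (take k c)" for b
  proof -
    obtain l where "l < length (take k c)" "b = take k c ! l" using \<open>b \<in> set (take k c)\<close> by (metis in_set_conv_nth)
    then have l: "l < k" "b = c ! l" by auto
    have lk: "c ! l + (k - 1 - l) \<le> c ! (k - 1)" "c ! (k - 1) + 1 \<le> c ! k"
      using sorted_wrt_less_nth_add[OF sc, of l "k - 1"] sorted_wrt_less_nth_add[OF sc, of "k - 1" k] l k i len
      by auto
    moreover have "c ! (k - 1) + 1 \<noteq> c ! k"
      using kmin[of "k - 1"] l k by auto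
    ultimately show ?thesis using l by (simp add: m_def)
  qed
  have B: "Suc ?a < b" if "b \<in> set (drop (Suc i) d)" for b
  proof -
    obtain l where "l < length (drop (Suc i) d)" "b = drop (Suc i) d ! l"
      using \<open>b \<in> set (drop (Suc i) d)\<close> by (metis in_set_conv_nth)
    then have l: "l < length d - Suc i" "b = d ! (Suc i + l)" by auto
    then have si: "Suc i < length d" by simp
    have "d ! Suc i + l \<le> b" using sorted_wrt_less_nth_add[OF sd, of "Suc i" "Suc i + l"] l by simp
    moreover have "c ! i + 1 \<le> c ! Suc i" using sorted_wrt_less_nth_add[OF sc, of i "Suc i"] si len by simp
    moreover have "c ! Suc i \<le> d ! Suc i" "c ! Suc i \<noteq> d ! Suc i" using weak last[of "Suc i"] si by auto
    ultimately show ?thesis using run_c[of i] k by simp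
  qed
  have "d @ c = take k d @ ([m..<Suc ?a] @ drop (Suc i) d @ take k c @ [m..<Suc ?a]) @ drop (Suc i) c"
    using c_split d_split by (metis append.assoc)
  with red have "reduced ([m..<Suc ?a] @ drop (Suc i) d @ take k c @ [m..<Suc ?a])"
    by (metis reduced_append1 reduced_append2)
  then show False using double_run_nonreduced[of m ?a "drop (Suc i) d" "take k c"] A B by simp
qed

definition column_ok :: "nat list \<Rightarrow> bool" where
  "column_ok c \<longleftrightarrow> c \<noteq> [] \<and> sorted_wrt (<) c \<and> 0 \<notin> set c"

definition columns_ok :: "nat list list \<Rightarrow> bool" where
  "columns_ok cs \<longleftrightarrow> (\<forall>c\<in>set cs. column_ok c) \<and>
     successively (\<lambda>c d. length d \<le> length c \<and> (\<forall>i<length d. c ! i < d ! i)) cs"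

lemma list_all2_concat_rev_split:
  "list_all2 Q (concat (rev cs)) b \<Longrightarrow>
    \<exists>ds. concat (rev ds) = b \<and> list_all2 (list_all2 Q) cs ds"
proof (induction cs arbitrary: b)
  case (Cons c cs)
  then obtain b1 b2 where b: "b = b1 @ b2" "list_all2 Q (concat (rev cs)) b1" "list_all2 Q c b2"
    by (auto simp: list_all2_append1)
  with Cons.IH obtain ds where "concat (rev ds) = b1" "list_all2 (list_all2 Q) cs ds" by blast
  with b show ?case by (intro exI[of _ "b2 # ds"]) auto
qed simp

lemma successively_concat_factor:
  assumes "Suc j < length cs"
  obtains x y where "concat (rev cs) = x @ (cs ! Suc j @ cs ! j) @ y"
proof -
  have "cs = take j cs @ cs ! j # cs ! Suc j # drop (Suc (Suc j)) cs"
    using assms by (simp add: Cons_nth_drop_Suc)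
  then have "concat (rev cs) = concat (rev (take j cs @ cs ! j # cs ! Suc j # drop (Suc (Suc j)) cs))"
    by simp
  also have "\<dots> = concat (rev (drop (Suc (Suc j)) cs)) @ (cs ! Suc j @ cs ! j) @ concat (rev (take j cs))"
    by simp
  finally show thesis using that by blast
qed

lemma concat_factor:
  assumes "c \<in> set cs"
  obtains x y where "concat (rev cs) = x @ c @ y"
proof -
  obtain as bs where "cs = as @ c # bs" using assms by (auto simp: in_set_conv_decomp)
  then show thesis using that[of "concat (rev bs)" "concat (rev as)"] by simp
qed

text \<open>\<open>Q\<close> stands for decrementing by at most one, or for the converse; both
  weaken strict inequalities to weak ones. Equality within a column would repeat a letter in a
  reduced word, and equality along a row is excluded by
  \<open>columns_weak_imp_strict\<close>.\<close>

lemma columns_ok_transfer: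
  assumes Q: "\<And>x y x' y'. Q x x' \<Longrightarrow> Q y y' \<Longrightarrow> x < y \<Longrightarrow> x' \<le> y'"
    and ok: "columns_ok cs" and rel: "list_all2 (list_all2 Q) cs ds"
    and red: "reduced (concat (rev ds))" and pos: "0 \<notin> set (concat (rev ds))"
  shows "columns_ok ds"
proof -
  have len: "length ds = length cs" and lens: "\<And>j. j < length cs \<Longrightarrow> length (ds ! j) = length (cs ! j)"
    and Qn: "\<And>j i. j < length cs \<Longrightarrow> i < length (cs ! j) \<Longrightarrow> Q (cs ! j ! i) (ds ! j ! i)"
    using rel by (auto simp: list_all2_conv_all_nth)
  have okc: "column_ok (cs ! j)" if "j < length cs" for j using ok that by (simp add: columns_ok_def)
  have col: "column_ok (ds ! j)" if j: "j < length cs" for j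
  proof -
    obtain x y where xy: "concat (rev ds) = x @ ds ! j @ y"
      using concat_factor[of "ds ! j" ds] j len by auto
    have "sorted_wrt (<) (ds ! j)"
      unfolding sorted_wrt_iff_nth_Suc_transp[OF transp_on_less]
    proof (intro allI impI)
      fix i assume i': "Suc i < length (ds ! j)"
      have "cs ! j ! i < cs ! j ! Suc i"
        using okc[OF j] i' lens[OF j] by (auto simp: column_ok_def intro: sorted_wrt_nth_less)
      then have le: "ds ! j ! i \<le> ds ! j ! Suc i" using Q[OF Qn[OF j] Qn[OF j]] i' lens[OF j] by simp
      have "ds ! j ! i \<noteq> ds ! j ! Suc i"
      proof
        assume eq: "ds ! j ! i = ds ! j ! Suc i"
        have "ds ! j = take i (ds ! j) @ ds ! j ! i # ds ! j ! Suc i # drop (Suc (Suc i)) (ds ! j)"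
          using i' by (simp add: Cons_nth_drop_Suc)
        then obtain u w where "ds ! j = u @ ds ! j ! i # ds ! j ! i # w" using eq by metis
        then show False
          using red reduced_append1 reduced_append2 reduced_no_repeat unfolding xy by metis
      qed
      with le show "ds ! j ! i < ds ! j ! Suc i" by simp
    qed
    moreover have "ds ! j \<noteq> []" using okc[OF j] lens[OF j] by (auto simp: column_ok_def)
    ultimately show ?thesis using pos j len by (auto simp: column_ok_def)
  qed
  have "length (ds ! Suc j) \<le> length (ds ! j) \<and> (\<forall>i<length (ds ! Suc j). ds ! j ! i < ds ! Suc j ! i)"
    if j: "Suc j < length ds" for j
  proof -
    have old: "length (cs ! Suc j) \<le> length (cs ! j)" "\<And>i. i < length (cs ! Suc j) \<Longrightarrow> cs ! j ! i < cs ! Suc j ! i"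
      using ok j len by (auto simp: columns_ok_def successively_conv_nth)
    obtain x y where xy: "concat (rev ds) = x @ (ds ! Suc j @ ds ! j) @ y"
      using successively_concat_factor[OF j] by blast
    have "reduced (ds ! Suc j @ ds ! j)"
      using red reduced_append1 reduced_append2 unfolding xy by metis
    moreover have le: "length (ds ! Suc j) \<le> length (ds ! j)" using old lens j len by simp
    moreover have "ds ! j ! i \<le> ds ! Suc j ! i" if "i < length (ds ! Suc j)" for i
      using that old lens j len by (intro Q[OF Qn Qn old(2)]) auto
    ultimately show ?thesis
      using columns_weak_imp_strict[of "ds ! j" "ds ! Suc j"] col j len by (auto simp: column_ok_def)
  qed
  then show ?thesis using col len by (auto simp: columns_ok_def successively_conv_nth in_set_conv_nth)
qed

text \<open>Tableaux as lists of columns: the reading word is a plain concatenation that can be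
  changed letter by letter and cut again at the old places.\<close>

definition column_tableaux :: "(nat \<Rightarrow> nat) \<Rightarrow> nat list list set" where
  "column_tableaux w = {cs. columns_ok cs \<and> reduced (concat (rev cs)) \<and> word_perm (concat (rev cs)) = w}"

section \<open>Transposition between rows and columns of a tableau\<close>

lemma lower_set_nat_eq:
  fixes A :: "nat set"
  assumes "finite A" "\<And>i j. j \<in> A \<Longrightarrow> i \<le> j \<Longrightarrow> i \<in> A"
  shows "A = {..<card A}"
proof (cases "A = {}")
  case False
  then have "Max A \<in> A" using assms by simp
  then have A: "A = {..Max A}" using assms(2)[of "Max A"] Max_ge[OF assms(1)] by blast
  have "card {..Max A} = Suc (Max A)" by simp
  then show ?thesis using A lessThan_Suc_atMost by metis
qed simp

lemma partition_shape_iff: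
  "partition_shape (tableau_shape T) \<longleftrightarrow> sorted (rev (map length T)) \<and> [] \<notin> set T"
  unfolding partition_shape_def tableau_shape_def sorted_wrt_rev by (auto simp: image_iff)

lemma transpose_box_iff:
  assumes "sorted (rev (map length T))"
  shows "i < length (List.transpose T) \<and> j < length (List.transpose T ! i) \<longleftrightarrow> j < length T \<and> i < length (T ! j)"
proof -
  let ?A = "{j. j < length T \<and> i < length (T ! j)}"
  have mono: "length (T ! k) \<le> length (T ! j)" if "j \<le> k" "k < length T" for j k
    using assms that unfolding sorted_rev_iff_nth_mono by simp
  have A: "?A = {..<card ?A}"
    by (rule lower_set_nat_eq) (use mono in \<open>auto intro: le_less_trans less_le_trans\<close>)
  have len: "length (List.transpose T) = (if T = [] then 0 else length (T ! 0))"
    by (rule length_transpose_sorted[OF assms])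
  show ?thesis
  proof (cases "i < length (List.transpose T)")
    case True
    then have "length (List.transpose T ! i) = card ?A"
      by (simp add: nth_transpose length_filter_conv_card)
    then show ?thesis using True A by auto
  next
    case False
    then show ?thesis using len mono[of 0 j] by (auto split: if_splits)
  qed
qed

lemma transpose_no_Nil:
  assumes "sorted (rev (map length T))"
  shows "[] \<notin> set (List.transpose T)"
proof
  assume "[] \<in> set (List.transpose T)"
  then obtain i where i: "i < length (List.transpose T)" "List.transpose T ! i = []"
    by (auto simp: in_set_conv_nth)
  then have "T \<noteq> []" "i < length (T ! 0)" using length_transpose_sorted[OF assms] by (auto split: if_splits)
  then show False using transpose_box_iff[OF assms, of i 0] i by simp
qed

lemma transpose_transpose':
  assumes "sorted (rev (map length T))" "[] \<notin> set T"
  shows "List.transpose (List.transpose T) = T"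
proof -
  have "takeWhile (\<lambda>x. x \<noteq> []) T = T" using assms(2) by (auto simp: takeWhile_eq_all_conv)
  then show ?thesis using transpose_transpose[OF assms(1)] by simp
qed

lemma transpose_entry:
  assumes "sorted (rev (map length T))" "j < length T" "i < length (T ! j)"
  shows "List.transpose T ! i ! j = T ! j ! i"
proof -
  have "i < length (List.transpose T)" "j < length (List.transpose T ! i)"
    using transpose_box_iff[OF assms(1)] assms by blast+
  then show ?thesis using nth_nth_transpose_sorted[OF assms(1)] by (simp add: nth_transpose)
qed

lemma young_tableau_shape:
  "young (tableau_shape T) = {(i, j). 1 \<le> i \<and> i \<le> length T \<and> 1 \<le> j \<and> j \<le> length (T ! (i - 1))}"
  by (auto simp: young_def tableau_shape_def)

lemma young_transpose:
  assumes "sorted (rev (map length T))"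
  shows "young (tableau_shape (List.transpose T)) = prod.swap ` young (tableau_shape T)"
proof -
  have "(j, i) \<in> young (tableau_shape (List.transpose T)) \<longleftrightarrow> (i, j) \<in> young (tableau_shape T)" for i j
    using transpose_box_iff[OF assms, of "j - 1" "i - 1"] by (cases i; cases j) (auto simp: young_tableau_shape)
  then show ?thesis by force
qed

lemma increasing_tableau_imp_columns_ok:
  assumes "increasing_tableau T"
  shows "columns_ok (List.transpose T)"
proof -
  let ?C = "List.transpose T"
  have T: "sorted (rev (map length T))" "[] \<notin> set T"
    and rows: "\<And>r. r \<in> set T \<Longrightarrow> 0 \<notin> set r \<and> sorted_wrt (<) r"
    and cols: "\<And>c. c \<in> set ?C \<Longrightarrow> sorted_wrt (<) c"
    using assms unfolding increasing_tableau_def partition_shape_iff by blast+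
  have ent: "j < length T \<and> i < length (T ! j) \<and> ?C ! i ! j = T ! j ! i"
    if "i < length ?C" "j < length (?C ! i)" for i j
    using transpose_box_iff[OF T(1), of i j] transpose_entry[OF T(1), of j i] that by blast
  have "column_ok c" if c: "c \<in> set ?C" for c
  proof -
    obtain i where i: "i < length ?C" "c = ?C ! i" using c by (auto simp: in_set_conv_nth)
    have "0 \<notin> set c"
    proof
      assume "0 \<in> set c"
      then obtain j where "j < length c" "c ! j = 0" by (auto simp: in_set_conv_nth)
      then have "j < length T" "i < length (T ! j)" "T ! j ! i = 0" using ent[of i j] i by auto
      then have "T ! j \<in> set T" "0 \<in> set (T ! j)" by (auto simp: in_set_conv_nth)
      then show False using rows by blast
    qed
    moreover have "c \<noteq> []" using transpose_no_Nil[OF T(1)] c by auto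
    ultimately show ?thesis using cols[OF c] by (simp add: column_ok_def)
  qed
  moreover have "length (?C ! Suc i) \<le> length (?C ! i) \<and> (\<forall>j<length (?C ! Suc i). ?C ! i ! j < ?C ! Suc i ! j)"
    if i: "Suc i < length ?C" for i
  proof -
    have "sorted (rev (map length ?C))" by simp
    then have "length (?C ! Suc i) \<le> length (?C ! i)"
      using i by (auto simp: sorted_rev_iff_nth_mono)
    moreover have "?C ! i ! j < ?C ! Suc i ! j" if j: "j < length (?C ! Suc i)" for j
    proof -
      have a: "j < length T" "Suc i < length (T ! j)" "?C ! Suc i ! j = T ! j ! Suc i"
        using ent[OF i j] by auto
      moreover have "?C ! i ! j = T ! j ! i" using transpose_entry[OF T(1), of j i] a by simp
      moreover have "T ! j ! i < T ! j ! Suc i"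
        using rows[of "T ! j"] a by (intro sorted_wrt_nth_less[of "(<)"]) auto
      ultimately show ?thesis by simp
    qed
    ultimately show ?thesis by blast
  qed
  ultimately show ?thesis by (simp add: columns_ok_def successively_conv_nth)
qed

lemma columns_ok_sorted:
  assumes "columns_ok cs"
  shows "sorted (rev (map length cs))" "[] \<notin> set cs"
proof -
  show "[] \<notin> set cs" using assms by (auto simp: columns_ok_def column_ok_def)
  have "sorted_wrt (\<ge>) (map length cs)"
    using assms unfolding sorted_wrt_iff_nth_Suc_transp[OF transp_on_ge]
    by (auto simp: columns_ok_def successively_conv_nth)
  then show "sorted (rev (map length cs))" by (simp add: sorted_wrt_rev)
qed

lemma columns_ok_imp_increasing_tableau:
  assumes ok: "columns_ok cs"
  shows "increasing_tableau (List.transpose cs)"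
proof -
  let ?T = "List.transpose cs"
  note cs = columns_ok_sorted[OF ok]
  have T: "sorted (rev (map length ?T))" "[] \<notin> set ?T" using transpose_no_Nil[OF cs(1)] by auto
  have tt: "List.transpose ?T = cs" by (rule transpose_transpose'[OF cs])
  have ent: "i < length cs \<and> j < length (cs ! i) \<and> ?T ! j ! i = cs ! i ! j"
    if "j < length ?T" "i < length (?T ! j)" for i j
    using transpose_box_iff[OF cs(1), of j i] transpose_entry[OF cs(1), of i j] that by blast
  have nxt: "cs ! i ! j < cs ! Suc i ! j" if "Suc i < length cs" "j < length (cs ! Suc i)" for i j
    using ok that unfolding columns_ok_def successively_conv_nth by blast
  have "0 \<notin> set r \<and> sorted_wrt (<) r" if r: "r \<in> set ?T" for r
  proof -
    obtain j where j: "j < length ?T" "r = ?T ! j" using r by (auto simp: in_set_conv_nth)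
    have "0 \<notin> set r"
    proof
      assume "0 \<in> set r"
      then obtain i where "i < length r" "r ! i = 0" by (auto simp: in_set_conv_nth)
      then have "i < length cs" "j < length (cs ! i)" "cs ! i ! j = 0" using ent[of j i] j by auto
      then have "cs ! i \<in> set cs" "0 \<in> set (cs ! i)" by (auto simp: in_set_conv_nth)
      then show False using ok by (auto simp: columns_ok_def column_ok_def)
    qed
    moreover have "sorted_wrt (<) r"
      unfolding sorted_wrt_iff_nth_Suc_transp[OF transp_on_less]
    proof (intro allI impI)
      fix i assume "Suc i < length r"
      then have "Suc i < length cs" "j < length (cs ! Suc i)" "r ! Suc i = cs ! Suc i ! j" "r ! i = cs ! i ! j"
        using ent[of j "Suc i"] ent[of j i] j by simp_all
      then show "r ! i < r ! Suc i" using nxt by simp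
    qed
    ultimately show ?thesis by blast
  qed
  moreover have "sorted_wrt (<) c" if "c \<in> set cs" for c
    using ok that by (auto simp: columns_ok_def column_ok_def)
  ultimately show ?thesis
    using T unfolding increasing_tableau_def partition_shape_iff tt by blast
qed

lemma bij_betw_RT_columns:
  assumes w: "w permutes {1..n}"
  shows "bij_betw List.transpose (RT n w) (column_tableaux w)"
proof (rule bij_betw_byWitness[where f' = List.transpose])
  have T: "sorted (rev (map length T))" "[] \<notin> set T" "increasing_tableau T"
    "reduced (concat (rev (List.transpose T)))" "word_perm (concat (rev (List.transpose T))) = w"
    if "T \<in> RT n w" for T
    using that reduced_word_iff[OF w]
    unfolding RT_def increasing_tableau_def partition_shape_iff column_reading_word_def by blast+
  show "\<forall>T\<in>RT n w. List.transpose (List.transpose T) = T"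
    by (intro ballI transpose_transpose' T)
  show "\<forall>cs\<in>column_tableaux w. List.transpose (List.transpose cs) = cs"
    by (intro ballI transpose_transpose' columns_ok_sorted) (simp_all add: column_tableaux_def)
  show "List.transpose ` RT n w \<subseteq> column_tableaux w"
    using increasing_tableau_imp_columns_ok[OF T(3)] T(4,5) by (auto simp: column_tableaux_def)
  show "List.transpose ` column_tableaux w \<subseteq> RT n w"
  proof
    fix T assume "T \<in> List.transpose ` column_tableaux w"
    then obtain cs where cs: "T = List.transpose cs" "columns_ok cs" "reduced (concat (rev cs))"
      "word_perm (concat (rev cs)) = w" by (auto simp: column_tableaux_def)
    have "List.transpose T = cs"
      using transpose_transpose' columns_ok_sorted[OF cs(2)] cs(1) by simp
    then show "T \<in> RT n w"
      using cs columns_ok_imp_increasing_tableau reduced_word_iff[OF w]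
      by (simp add: RT_def column_reading_word_def)
  qed
qed

text \<open>By \<open>uniq\<close> the words entering the bump are those of one permutation, and by
  \<open>no0\<close> the bumped words have no letter \<open>0\<close>, which a tableau could not
  contain. Cutting the bumped word into columns of the old lengths preserves the shape.\<close>

lemma bump_columns:
  assumes v: "v permutes {1..n}" and r: "r \<in> {1..n}"
    and no0: "\<not> covers v 0 r"
    and uniq: "\<And>s'. covers v r s' \<longleftrightarrow> s' = s" and s: "s \<le> n"
  defines "K \<equiv> (\<lambda>i. v \<circ> Transposition.transpose i r) ` {i. covers v i r}"
  shows "\<exists>f. bij_betw f (column_tableaux (v \<circ> Transposition.transpose r s)) (\<Union>w'\<in>K. column_tableaux w') \<and>
    (\<forall>cs\<in>column_tableaux (v \<circ> Transposition.transpose r s). map length (f cs) = map length cs)"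
proof -
  let ?w = "v \<circ> Transposition.transpose r s"
  let ?A = "{a. reduced a \<and> word_perm a = ?w}"
  let ?B = "{b. reduced b \<and> word_perm b \<in> K}"
  obtain g where g: "bij_betw g ?A ?B" "\<And>a. a \<in> ?A \<Longrightarrow> decremented a (g a)"
  proof -
    have "{a. reduced a \<and> (\<exists>s. covers v r s \<and> word_perm a = v \<circ> Transposition.transpose r s)} = ?A"
      using uniq by auto
    moreover have "{b. reduced b \<and> (\<exists>i. covers v i r \<and> word_perm b = v \<circ> Transposition.transpose i r)} = ?B"
      unfolding K_def by auto
    ultimately show thesis using little_bump[OF v r] that by auto
  qed
  have rs: "r < s" using uniq[of s] by (simp add: covers_def)
  have w_perm: "?w permutes {1..n}"
    using v r rs s by (intro permutes_compose permutes_swap_id) auto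
  have K_perm: "u permutes {1..n}" if "u \<in> K" for u
  proof -
    obtain i where i: "covers v i r" "u = v \<circ> Transposition.transpose i r" using \<open>u \<in> K\<close> by (auto simp: K_def)
    then have "i \<noteq> 0" "i < r" using no0 by (auto simp: covers_def intro: ccontr)
    then show ?thesis using i v r by (auto intro!: permutes_compose permutes_swap_id)
  qed
  have pos: "0 \<notin> set a" if "reduced a" "word_perm a permutes {1..n}" for a
    using reduced_letters[OF that] by auto
  have in_A: "concat (rev cs) \<in> ?A" if "cs \<in> column_tableaux ?w" for cs
    using that by (simp add: column_tableaux_def)
  define f where "f cs = (SOME ds. concat (rev ds) = g (concat (rev cs)) \<and>
    list_all2 (list_all2 (\<lambda>a b. a = b \<or> a = Suc b)) cs ds)" for cs
  have f: "concat (rev (f cs)) = g (concat (rev cs))"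
    "list_all2 (list_all2 (\<lambda>a b. a = b \<or> a = Suc b)) cs (f cs)" if "cs \<in> column_tableaux ?w" for cs
  proof -
    from g(2)[OF in_A[OF that]]
    have "list_all2 (\<lambda>a b. a = b \<or> a = Suc b) (concat (rev cs)) (g (concat (rev cs)))"
      unfolding decremented_def .
    from someI_ex[OF list_all2_concat_rev_split[OF this], folded f_def]
    show "concat (rev (f cs)) = g (concat (rev cs))"
      "list_all2 (list_all2 (\<lambda>a b. a = b \<or> a = Suc b)) cs (f cs)" by simp_all
  qed
  have lens: "map length (f cs) = map length cs" if "cs \<in> column_tableaux ?w" for cs
    using f(2)[OF that] by (auto simp: list_all2_conv_all_nth intro: nth_equalityI)
  have concat_inj: "cs = ds" if "concat (rev cs) = concat (rev ds)" "map length cs = map length ds"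
    for cs ds :: "nat list list"
  proof -
    have l: "length cs = length ds" "\<And>i. i < length cs \<Longrightarrow> length (cs ! i) = length (ds ! i)"
      using that(2) by (auto simp: list_eq_iff_nth_eq)
    have "rev cs = rev ds"
    proof (rule concat_injective[OF that(1)])
      show "\<forall>(x, y)\<in>set (zip (rev cs) (rev ds)). length x = length y"
        using l by (auto simp: set_zip rev_nth)
    qed (use l in simp)
    then show ?thesis by simp
  qed
  have "bij_betw f (column_tableaux ?w) (\<Union>w'\<in>K. column_tableaux w')"
  proof (rule bij_betwI')
    fix cs ds assume c: "cs \<in> column_tableaux ?w" "ds \<in> column_tableaux ?w"
    have "cs = ds" if eq: "f cs = f ds"
    proof (rule concat_inj)
      have "g (concat (rev cs)) = g (concat (rev ds))" using f(1) c eq by metis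
      then show "concat (rev cs) = concat (rev ds)"
        using in_A[OF c(1)] in_A[OF c(2)] inj_onD[OF bij_betw_imp_inj_on[OF g(1)]] by blast
      show "map length cs = map length ds" using lens c eq by metis
    qed
    then show "f cs = f ds \<longleftrightarrow> cs = ds" by auto
  next
    fix cs assume c: "cs \<in> column_tableaux ?w"
    then have "concat (rev cs) \<in> ?A" by (rule in_A)
    then have "g (concat (rev cs)) \<in> ?B" by (rule bij_betw_apply[OF g(1)])
    then have b: "reduced (concat (rev (f cs)))" "word_perm (concat (rev (f cs))) \<in> K"
      unfolding f(1)[OF c] by blast+
    have ok: "columns_ok cs" using c by (simp add: column_tableaux_def)
    have "columns_ok (f cs)"
      by (rule columns_ok_transfer[OF _ ok f(2)[OF c] b(1) pos[OF b(1) K_perm[OF b(2)]]]) auto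
    then show "f cs \<in> (\<Union>w'\<in>K. column_tableaux w')" using b by (auto simp: column_tableaux_def)
  next
    fix ds assume "ds \<in> (\<Union>w'\<in>K. column_tableaux w')"
    then have d: "columns_ok ds" "reduced (concat (rev ds))" "word_perm (concat (rev ds)) \<in> K"
      by (auto simp: column_tableaux_def)
    then have "concat (rev ds) \<in> g ` ?A" using bij_betw_imp_surj_on[OF g(1)] by blast
    then obtain a where a: "a \<in> ?A" "g a = concat (rev ds)" by force
    have "list_all2 (\<lambda>a b. a = b \<or> a = Suc b) a (concat (rev ds))"
      using g(2)[OF a(1)] unfolding a(2) decremented_def .
    \<comment> \<open>Backwards the letters grow by at most one, which weakens strict inequalities
      in the same way; so the preimage is a tableau as well.\<close>
    then have "list_all2 (\<lambda>b a. a = b \<or> a = Suc b) (concat (rev ds)) a"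
      by (simp add: list_all2_conv_all_nth)
    then obtain cs where cs: "concat (rev cs) = a" "list_all2 (list_all2 (\<lambda>b a. a = b \<or> a = Suc b)) ds cs"
      using list_all2_concat_rev_split by blast
    have r: "reduced (concat (rev cs))" "word_perm (concat (rev cs)) = ?w" using a(1) cs(1) by simp_all
    have "word_perm (concat (rev cs)) permutes {1..n}" using w_perm r(2) by simp
    then have "columns_ok cs"
      by (intro columns_ok_transfer[OF _ d(1) cs(2) r(1) pos[OF r(1)]]) auto
    then have ct: "cs \<in> column_tableaux ?w" using r by (simp add: column_tableaux_def)
    have "ds = f cs"
    proof (rule concat_inj)
      show "concat (rev ds) = concat (rev (f cs))" using f(1)[OF ct] cs a by simp
      show "map length ds = map length (f cs)"
        unfolding lens[OF ct] using cs(2) by (auto simp: list_all2_conv_all_nth intro: nth_equalityI)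
    qed
    then show "\<exists>cs\<in>column_tableaux ?w. ds = f cs" using ct by blast
  qed
  then show ?thesis using lens by blast
qed

section \<open>Tableaux of dominant permutations\<close>

definition rothe :: "(nat \<Rightarrow> nat) \<Rightarrow> nat \<Rightarrow> nat \<Rightarrow> bool" where
  "rothe w p q \<longleftrightarrow> q < w p \<and> p < inv w q"

text \<open>One letter lowers a value by at most one. This bounds from below the length of a column
  that carries \<open>e\<close> down to \<open>m\<close>.\<close>

lemma word_perm_lower: "p \<le> word_perm a p + length a"
proof (induction a)
  case (Cons h a)
  then show ?case by (auto simp: word_perm_Cons Transposition.transpose_def)
qed simp

lemma reduced_snoc:
  assumes "reduced a" "word_perm a g < word_perm a (Suc g)"
  shows "reduced (a @ [g])"
proof -
  have e: "word_perm (a @ [g]) = word_perm a \<circ> Transposition.transpose g (Suc g)"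
    by (simp add: word_perm_append word_perm_Cons)
  have "Suc (card (inversions (word_perm a))) \<le> card (inversions (word_perm (a @ [g])))"
    using card_inversions_reflection(2)[OF bij_word_perm finite_inversions lessI assms(2)]
      finite_inversions[of "a @ [g]"] unfolding e by blast
  then show ?thesis using card_inversions_le[of "a @ [g]"] assms(1) by (simp add: reduced_def)
qed

lemma reduced_last_descent:
  assumes "reduced (a @ [g])"
  shows "word_perm (a @ [g]) (Suc g) < word_perm (a @ [g]) g"
proof -
  have "(g, Suc g) \<in> inversions (word_perm [g])" by (simp add: inversions_def word_perm_Cons)
  then show ?thesis using inversions_mono[OF assms] by (auto simp: inversions_def)
qed

lemma column_tableaux_id: "column_tableaux id = {[]}"
proof -
  have "cs = []" if "cs \<in> column_tableaux id" for cs
  proof -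
    have "reduced (concat (rev cs))" "word_perm (concat (rev cs)) = id" "[] \<notin> set cs"
      using that columns_ok_sorted(2)[of cs] by (auto simp: column_tableaux_def)
    then have "concat (rev cs) = []" by (simp add: reduced_def)
    then show ?thesis using \<open>[] \<notin> set cs\<close> by (cases cs) auto
  qed
  then show ?thesis by (auto simp: column_tableaux_def columns_ok_def)
qed

lemma columns_ok_Cons:
  "columns_ok (c # cs) \<longleftrightarrow> column_ok c \<and> columns_ok cs \<and>
    (cs = [] \<or> length (hd cs) \<le> length c \<and> (\<forall>i<length (hd cs). c ! i < hd cs ! i))"
  by (cases cs) (auto simp: columns_ok_def)

lemma columns_ok_Cons_lower:
  assumes ok: "columns_ok (c # cs)" and low: "\<And>d. d \<in> set (c # cs) \<Longrightarrow> \<forall>x\<in>set d. m \<le> x"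
    and d: "d \<in> set cs" "x \<in> set d"
  shows "Suc m \<le> x"
proof -
  obtain j where j: "j < length cs" "d = cs ! j" using d(1) by (auto simp: in_set_conv_nth)
  obtain i where i: "i < length d" "x = d ! i" using d(2) by (auto simp: in_set_conv_nth)
  have "length d \<le> length ((c # cs) ! j) \<and> (\<forall>i<length d. (c # cs) ! j ! i < d ! i)"
    using ok j unfolding columns_ok_def successively_conv_nth by fastforce
  moreover have "(c # cs) ! j \<in> set (c # cs)" using j(1) by (intro nth_mem) simp
  ultimately have "m \<le> (c # cs) ! j ! i" "(c # cs) ! j ! i < x" using low i by auto
  then show ?thesis by simp
qed

lemma rothe_descent:
  assumes "bij w" "w (Suc g) < w g"
  shows "rothe w g (w (Suc g))"
  using assms by (simp add: rothe_def bij_is_inj)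

text \<open>A permutation without non-dominant boxes has a single tableau, with entries
  \<open>T\<^sub>i\<^sub>j = i + j - 1\<close>; its first column moves the value \<open>m\<close> from position \<open>m\<close> to its final position.\<close>

lemma dominant_column_tableau:
  assumes "w permutes {m..n}" "1 \<le> m" "m \<le> Suc n"
    "\<And>i p q. m \<le> i \<Longrightarrow> i < p \<Longrightarrow> w i < q \<Longrightarrow> \<not> rothe w p q"
  shows "\<exists>cs. column_tableaux w = {cs} \<and>
    (\<forall>i j. j < length cs \<and> i < length (cs ! j) \<longleftrightarrow> rothe w (m + i) (m + j))"
  using assms(3,1,2,4)
proof (induction m arbitrary: w rule: inc_induct)
  case base
  then have w: "w = id" by simp
  have "\<not> rothe id p q" for p q by (simp add: rothe_def)
  then show "\<exists>cs. column_tableaux w = {cs} \<and>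
    (\<forall>i j. j < length cs \<and> i < length (cs ! j) \<longleftrightarrow> rothe w (Suc n + i) (Suc n + j))"
    using column_tableaux_id unfolding w by (intro exI[of _ "[]"]) simp
next
  case (step m)
  note w = step.prems(1) and dom = step.prems(3)
  have mn: "m \<le> n" using step.hyps by simp
  define e where "e = inv w m"
  have bij: "bij w" using w by (rule permutes_bij)
  have e: "w e = m" using w by (simp add: e_def permutes_inverses(1))
  have e_in: "m \<le> e" "e \<le> n"
    using permutes_in_image[OF permutes_inv[OF w], of m] mn by (auto simp: e_def)
  have w_low: "w p = p" "inv w p = p" if "p < m" for p
    using that permutes_not_in[OF w, of p] permutes_not_in[OF permutes_inv[OF w], of p] by auto
  have w_ge: "m \<le> w p" if "m \<le> p" for p
    using that permutes_in_image[OF w, of p] permutes_not_in[OF w, of p] by (cases "p \<le> n") auto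
  \<comment> \<open>From row \<open>e\<close> on there are no Rothe boxes: the dot
    \<open>(e, m)\<close> is northwest of those further right, and the dots in columns up to
    \<open>m\<close> are no lower than row \<open>e\<close>.\<close>
  have no_rothe: "\<not> rothe w p q" if "e \<le> p" for p q
  proof
    assume r: "rothe w p q"
    show False
    proof (cases "q \<le> m")
      case True
      then show False using r that w_low(2)[of q] e_in by (cases "q = m") (auto simp: rothe_def e_def)
    next
      case False
      then have "p \<noteq> e" using r e by (auto simp: rothe_def)
      then show False using dom[OF e_in(1), of p q] r that False e by simp
    qed
  qed
  show "\<exists>cs. column_tableaux w = {cs} \<and>
    (\<forall>i j. j < length cs \<and> i < length (cs ! j) \<longleftrightarrow> rothe w (m + i) (m + j))"
  proof (cases "e = m")
    case True
    have dom': "\<not> rothe w p q" if "Suc m \<le> i" "i < p" "w i < q" for i p q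
      using dom[of i p q] that by simp
    have "w permutes {Suc m..n}"
    proof (rule permutes_superset[OF w])
      fix x assume "x \<in> {m..n} - {Suc m..n}"
      then have "x = m" by auto
      then show "w x = x" using e True by simp
    qed
    then have "\<exists>cs. column_tableaux w = {cs} \<and>
      (\<forall>i j. j < length cs \<and> i < length (cs ! j) \<longleftrightarrow> rothe w (Suc m + i) (Suc m + j))"
      by (rule step.IH[OF _ _ dom']) simp
    then obtain cs where cs: "column_tableaux w = {cs}"
      "\<And>i j. j < length cs \<and> i < length (cs ! j) \<longleftrightarrow> rothe w (Suc m + i) (Suc m + j)" by metis
    have "cs = []"
    proof (rule ccontr)
      assume "cs \<noteq> []"
      moreover have "[] \<notin> set cs" using cs(1) columns_ok_sorted(2)[of cs] by (auto simp: column_tableaux_def)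
      ultimately have "0 < length cs \<and> 0 < length (cs ! 0)" by (cases cs) auto
      then show False using cs(2)[of 0 0] no_rothe[of "Suc m"] True by simp
    qed
    then show ?thesis using cs(1) no_rothe True by (intro exI[of _ cs]) simp
  next
    case False
    then have me: "m < e" using e_in by simp
    \<comment> \<open>\<open>C\<close> is the cycle given by the first column. Stripped of it,
      \<open>w\<close> becomes \<open>u\<close>, which fixes \<open>m\<close>; the Rothe diagram of
      \<open>u\<close> is that of \<open>w\<close> without column \<open>m\<close>, moved down by
      one row.\<close>
    define C where "C = word_perm [m..<e]"
    have C: "C p = (if p = e then m else if m \<le> p \<and> p < e then Suc p else p)" for p
      using word_perm_run[OF e_in(1), of p] by (simp add: C_def)
    have C_perm: "C permutes {m..n}" using e_in unfolding C_def by (intro word_perm_permutes) auto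
    define u where "u = w \<circ> inv C"
    have uC: "u (C p) = w p" for p using C_perm by (simp add: u_def permutes_inverses(2))
    have uCw: "u \<circ> C = w" using uC by auto
    have um: "u m = m" using uC[of e] e C[of e] by simp
    have "u permutes {m..n}" unfolding u_def by (intro permutes_compose permutes_inv C_perm w)
    then have u_perm: "u permutes {Suc m..n}" 
    proof (rule permutes_superset)
      fix x assume "x \<in> {m..n} - {Suc m..n}"
      then have "x = m" by auto
      then show "u x = x" using um by simp
    qed
    have inv_u: "inv u j = C (inv w j)" for j
      using uC[of "inv w j"] w permutes_inv_eq[OF u_perm] by (simp add: permutes_inverses(1))
    have rothe_u: "rothe u (Suc p) j \<longleftrightarrow> rothe w p j" if "m < j" "m \<le> p" for p j
    proof (cases "p < e")
      case True
      define x where "x = inv w j"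
      have wx: "w x = j" using w by (simp add: x_def permutes_inverses(1))
      then have "x \<noteq> e" "m \<le> x" using e that w_low(1)[of x] by (auto intro: ccontr)
      then show ?thesis using True that uC[of p] inv_u[of j] C[of p] C[of x]
        by (auto simp: rothe_def x_def[symmetric])
    next
      case pe: False
      have "\<not> rothe u (Suc p) j"
      proof
        assume r: "rothe u (Suc p) j"
        have Cp: "C (Suc p) = Suc p" using pe by (simp add: C)
        then have "j < w (Suc p)" "Suc p < C (inv w j)" using r uC[of "Suc p"] inv_u[of j] by (auto simp: rothe_def)
        then have "rothe w (Suc p) j" using C[of "inv w j"] pe me by (auto simp: rothe_def split: if_splits)
        then show False using no_rothe pe by simp
      qed
      then show ?thesis using no_rothe[of p j] pe by simp
    qed
    have u_ge: "Suc m \<le> u p" if "Suc m \<le> p" for p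
      using that permutes_in_image[OF u_perm, of p] permutes_not_in[OF u_perm, of p] by (cases "p \<le> n") auto
    have dom_u: "\<not> rothe u p q" if i: "Suc m \<le> i" "i < p" "u i < q" for i p q
    proof
      assume r: "rothe u p q"
      obtain p' where p': "p = Suc p'" "m \<le> p'" using i by (cases p) auto
      have q: "m < q" using u_ge[OF i(1)] i(3) by simp
      have r': "rothe w p' q" using rothe_u[OF q p'(2)] r p'(1) by simp
      then have "p' < e" using no_rothe by (meson not_le)
      obtain i' where i': "i = Suc i'" "m \<le> i'" using i(1) by (cases i) auto
      have "C i' = i" using i' i(2) p'(1) \<open>p' < e\<close> by (simp add: C)
      then have "w i' = u i" using uC[of i'] by simp
      then show False using dom[of i' p' q] i i' p' r' by simp
    qed
    have "\<exists>cs. column_tableaux u = {cs} \<and>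
      (\<forall>i j. j < length cs \<and> i < length (cs ! j) \<longleftrightarrow> rothe u (Suc m + i) (Suc m + j))"
      by (rule step.IH[OF u_perm _ dom_u]) simp_all
    then obtain cs where cs: "column_tableaux u = {cs}"
      "\<And>i j. j < length cs \<and> i < length (cs ! j) \<longleftrightarrow> rothe u (Suc m + i) (Suc m + j)" by metis
    have cs_in: "columns_ok cs" "reduced (concat (rev cs))" "word_perm (concat (rev cs)) = u"
      using cs(1) by (auto simp: column_tableaux_def)
    have hd_len: "length (hd cs) \<le> e - m" if "cs \<noteq> []"
    proof (rule ccontr)
      assume "\<not> length (hd cs) \<le> e - m"
      then have "rothe u (Suc m + (e - m)) (Suc m)" using cs(2)[of 0 "e - m"] that by (simp add: hd_conv_nth)
      then have "rothe w e (Suc m)" using rothe_u[of "Suc m" e] me by simp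
      then show False using no_rothe by blast
    qed
    have letters: "set (concat (rev cs)) \<subseteq> {Suc m..<n}"
      using reduced_letters[OF cs_in(2)] u_perm cs_in(3) by simp
    have hd_less: "m + i < hd cs ! i" if "cs \<noteq> []" "i < length (hd cs)" for i
    proof -
      have h: "hd cs \<in> set cs" using that by simp
      have "hd cs ! 0 \<in> set (hd cs)" using that(2) by (intro nth_mem) linarith
      then have "Suc m \<le> hd cs ! 0" using letters h by fastforce
      moreover have "sorted_wrt (<) (hd cs)" using cs_in(1) h by (auto simp: columns_ok_def column_ok_def)
      ultimately show ?thesis using sorted_wrt_less_nth_add[of "hd cs" 0 i] that by simp
    qed
    have ok: "columns_ok ([m..<e] # cs)"
      using cs_in(1) hd_len hd_less me step.prems(2) by (auto simp: columns_ok_Cons column_ok_def)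
    have red: "reduced (concat (rev cs) @ [m..<m + j])" if "j \<le> e - m" for j
      using that
    proof (induction j)
      case 0 then show ?case using cs_in by simp
    next
      case (Suc j)
      let ?a = "concat (rev cs) @ [m..<m + j]"
      have "word_perm ?a (m + j) = m" "word_perm ?a (Suc (m + j)) = u (Suc (m + j))"
        using cs_in(3) um by (simp_all add: word_perm_append word_perm_run)
      then have "word_perm ?a (m + j) < word_perm ?a (Suc (m + j))" using u_ge[of "Suc (m + j)"] by simp
      then have "reduced (?a @ [m + j])" using Suc by (intro reduced_snoc) auto
      then show ?case by simp
    qed
    have "[m..<e] # cs \<in> column_tableaux w"
      using ok red[of "e - m"] e_in cs_in(3) uCw by (auto simp: column_tableaux_def word_perm_append C_def)
    \<comment> \<open>Uniqueness: the later columns have entries above \<open>m\<close> and hence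
      fix it, so the first column alone carries \<open>e\<close> to \<open>m\<close> and needs at
      least \<open>e - m\<close> letters. They are at least \<open>m\<close>, and less than
      \<open>e\<close> because the last one is a descent of \<open>w\<close>; only the full run is
      left.\<close>
    moreover have "ds = [m..<e] # cs" if ds: "ds \<in> column_tableaux w" for ds
    proof -
      have ds': "columns_ok ds" "reduced (concat (rev ds))" "word_perm (concat (rev ds)) = w"
        using ds by (auto simp: column_tableaux_def)
      have "ds \<noteq> []" using ds'(3) e me by auto
      then obtain c rest where cr: "ds = c # rest" by (cases ds) auto
      have let_ds: "set (concat (rev ds)) \<subseteq> {m..<n}" using reduced_letters[OF ds'(2)] w ds'(3) by simp
      then have low: "\<forall>x\<in>set d. m \<le> x" if "d \<in> set (c # rest)" for d
        using that cr by fastforce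
      have rest_low: "set (concat (rev rest)) \<subseteq> {Suc m..<n}"
        using columns_ok_Cons_lower[OF ds'(1)[unfolded cr], of m] low let_ds cr by fastforce
      let ?u = "word_perm (concat (rev rest))"
      have w_eq: "?u \<circ> word_perm c = w" using ds'(3) cr by (simp add: word_perm_append)
      have um': "?u m = m" using rest_low by (intro word_perm_fix) fastforce
      have "?u (word_perm c e) = ?u m" using fun_cong[OF w_eq, of e] e um' by simp
      then have ce: "word_perm c e = m" by simp
      have c_ok: "c \<noteq> []" "sorted_wrt (<) c" using ds'(1) cr by (auto simp: columns_ok_Cons column_ok_def)
      obtain a where a: "concat (rev ds) = a @ [last c]"
        using cr c_ok(1) by (metis append_assoc append_butlast_last_id concat_append concat.simps rev.simps(2) append_Nil2)
      have "w (Suc (last c)) < w (last c)"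
        using reduced_last_descent[of a "last c"] ds' a by simp
      then have "last c < e" using rothe_descent[OF bij] no_rothe by (meson not_le)
      moreover have "x \<le> last c" if "x \<in> set c" for x
      proof -
        obtain i where "i < length c" "x = c ! i" using \<open>x \<in> set c\<close> by (auto simp: in_set_conv_nth)
        moreover from this have "i \<le> length c - 1" "length c - 1 < length c" by auto
        ultimately show ?thesis
          using sorted_wrt_less_nth_add[OF c_ok(2), of i "length c - 1"] last_conv_nth[OF c_ok(1)] by linarith
      qed
      ultimately have sub: "set c \<subseteq> {m..<e}" using low[of c] by fastforce
      have "e - m \<le> length c" using word_perm_lower[of e c] ce by simp
      moreover have "length c = card (set c)" using c_ok(2) by (metis distinct_card strict_sorted_iff)
      ultimately have "set c = {m..<e}" using sub by (intro card_seteq) auto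
      then have c: "c = [m..<e]" using c_ok(2) by (intro strict_sorted_equal) auto
      have "?u \<circ> C = u \<circ> C" using w_eq uCw c by (simp add: C_def)
      then have "?u = u" by (simp add: C_def)
      then have "rest \<in> column_tableaux u"
        using ds' cr reduced_append1 by (auto simp: column_tableaux_def columns_ok_Cons)
      then show ?thesis using cs(1) c cr by simp
    qed
    ultimately have "column_tableaux w = {[m..<e] # cs}" by blast
    moreover have "j < length ([m..<e] # cs) \<and> i < length (([m..<e] # cs) ! j) \<longleftrightarrow> rothe w (m + i) (m + j)" for i j
    proof (cases j)
      case 0
      have "m < w (m + i)" if "m + i < e"
        using that w_ge[of "m + i"] e bij by (metis bij_is_inj injD le_add1 le_neq_implies_less nat_less_le)
      then show ?thesis using 0 by (auto simp: rothe_def e_def[symmetric])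
    next
      case (Suc j')
      then show ?thesis using cs(2)[of j' i] rothe_u[of "Suc m + j'" "m + i"] by simp
    qed
    ultimately show ?thesis by blast
  qed
qed

section \<open>Pipes as sequences of columns\<close>

text \<open>\<open>C i k\<close> is the column in which pipe \<open>k\<close> crosses the boundary between rows \<open>i\<close> and \<open>i + 1\<close>, and
  \<open>n + 1\<close> if the pipe has already left the grid below that boundary. In row \<open>i\<close> pipe \<open>k\<close> occupies
  the columns from \<open>C i k\<close> to \<open>C (i - 1) k\<close>. In the last clause pipe \<open>l\<close> either stays to the right of
  pipe \<open>k\<close> or is crossed vertically by it; given that two pipes cross at most once, the pipe
  crossing horizontally has the smaller label.\<close>

definition pipe_columns :: "nat \<Rightarrow> (nat \<Rightarrow> nat) \<Rightarrow> (nat \<Rightarrow> nat \<Rightarrow> nat) \<Rightarrow> bool" where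
  "pipe_columns n w C \<longleftrightarrow>
    (\<forall>i k. n < i \<or> k \<notin> {1..n} \<longrightarrow> C i k = 0) \<and>
    (\<forall>k\<in>{1..n}. C n k = k) \<and>
    (\<forall>i<n. \<forall>k\<in>{1..n}. C (Suc i) k \<le> C i k) \<and>
    (\<forall>i\<le>n. \<forall>k\<in>{1..n}. C i k \<le> Suc n \<and> (C i k = Suc n \<longleftrightarrow> i < inv w k)) \<and>
    (\<forall>i<n. \<forall>k\<in>{1..n}. \<forall>l\<in>{1..n}. C (Suc i) k < C (Suc i) l \<longrightarrow> C (Suc i) l \<le> n \<longrightarrow>
      C i k < C (Suc i) l \<or> (k < l \<and> C i l = C (Suc i) l \<and> C i l < C i k))"

text \<open>The boundary columns of a pipe that runs straight up column \<open>k\<close> and turns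
  east only in its exit row.\<close>

definition hook :: "nat \<Rightarrow> (nat \<Rightarrow> nat) \<Rightarrow> nat \<Rightarrow> nat \<Rightarrow> nat" where
  "hook n w i k = (if inv w k \<le> i then k else Suc n)"

definition covered :: "nat \<Rightarrow> (nat \<Rightarrow> nat \<Rightarrow> nat) \<Rightarrow> nat \<Rightarrow> nat \<Rightarrow> bool" where
  "covered n C i j \<longleftrightarrow> (\<exists>k\<in>{1..n}. C i k \<le> j \<and> j \<le> C (i - 1) k)"

definition blanks :: "nat \<Rightarrow> (nat \<Rightarrow> nat \<Rightarrow> nat) \<Rightarrow> (nat \<times> nat) set" where
  "blanks n C = {(i, j). (i, j) \<in> grid n \<and> \<not> covered n C i j}"

definition EG_columns :: "nat \<Rightarrow> (nat \<Rightarrow> nat) \<Rightarrow> (nat \<Rightarrow> nat \<Rightarrow> nat) set" where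
  "EG_columns n w = {C. pipe_columns n w C \<and> (\<exists>lam. partition_shape lam \<and> blanks n C = young lam)}"

text \<open>The condition \<open>0 < i\<close> discards the fixed point \<open>0\<close> of
  \<open>w\<close>, which would otherwise count as a dot northwest of every box.\<close>

definition nondominant :: "(nat \<Rightarrow> nat) \<Rightarrow> nat \<Rightarrow> nat \<Rightarrow> bool" where
  "nondominant w p q \<longleftrightarrow> rothe w p q \<and> (\<exists>i. 0 < i \<and> i < p \<and> w i < q)"

lemma pipe_columnsD:
  assumes "pipe_columns n w C"
  shows pc_zero: "n < i \<or> k \<notin> {1..n} \<Longrightarrow> C i k = 0"
    and pc_start: "k \<in> {1..n} \<Longrightarrow> C n k = k"
    and pc_mono: "i < n \<Longrightarrow> k \<in> {1..n} \<Longrightarrow> C (Suc i) k \<le> C i k"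
    and pc_le: "i \<le> n \<Longrightarrow> k \<in> {1..n} \<Longrightarrow> C i k \<le> Suc n"
    and pc_exit: "i \<le> n \<Longrightarrow> k \<in> {1..n} \<Longrightarrow> C i k = Suc n \<longleftrightarrow> i < inv w k"
    and pc_row: "i < n \<Longrightarrow> k \<in> {1..n} \<Longrightarrow> l \<in> {1..n} \<Longrightarrow> C (Suc i) k < C (Suc i) l \<Longrightarrow> C (Suc i) l \<le> n \<Longrightarrow>
      C i k < C (Suc i) l \<or> (k < l \<and> C i l = C (Suc i) l \<and> C i l < C i k)"
proof -
  note c = assms[unfolded pipe_columns_def]
  show "C i k = 0" if "n < i \<or> k \<notin> {1..n}"
    using that c[THEN conjunct1] by blast
  show "C n k = k" if "k \<in> {1..n}"
    using that c[THEN conjunct2, THEN conjunct1] by blast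
  show "C (Suc i) k \<le> C i k" if "i < n" "k \<in> {1..n}"
    using that c[THEN conjunct2, THEN conjunct2, THEN conjunct1] by blast
  note c' = c[THEN conjunct2, THEN conjunct2, THEN conjunct2]
  show "C i k \<le> Suc n" "C i k = Suc n \<longleftrightarrow> i < inv w k" if "i \<le> n" "k \<in> {1..n}"
    using that c'[THEN conjunct1] by blast+
  show "C i k < C (Suc i) l \<or> (k < l \<and> C i l = C (Suc i) l \<and> C i l < C i k)"
    if "i < n" "k \<in> {1..n}" "l \<in> {1..n}" "C (Suc i) k < C (Suc i) l" "C (Suc i) l \<le> n"
    using that c'[THEN conjunct2] by blast
qed

lemma pc_active:
  assumes "pipe_columns n w C" "i \<le> n" "k \<in> {1..n}"
  shows "C i k \<le> n \<longleftrightarrow> inv w k \<le> i"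
  using pc_exit[OF assms] pc_le[OF assms] by linarith

lemma pc_inj:
  assumes C: "pipe_columns n w C" and kl: "k \<in> {1..n}" "l \<in> {1..n}" "k \<noteq> l"
  shows "i \<le> n \<Longrightarrow> C i k \<le> n \<Longrightarrow> C i k \<noteq> C i l"
proof (induction i rule: inc_induct)
  case base
  then show ?case using pc_start[OF C] kl by simp
next
  case (step i)
  have "\<not> (C i k' = C i l')"
    if kl': "k' \<in> {1..n}" "l' \<in> {1..n}" "C (Suc i) k' < C (Suc i) l'" "C (Suc i) l' \<le> n" for k' l'
    using pc_row[OF C step.hyps(2) kl'] pc_mono[OF C step.hyps(2) kl'(2)] by linarith
  note this[of k l] this[of l k]
  moreover have "C (Suc i) k \<noteq> C (Suc i) l" if "C i k = C i l"
    using step that pc_mono[OF C step.hyps(2) kl(1)] by linarith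
  ultimately show ?case
    using kl step.prems pc_mono[OF C step.hyps(2) kl(1)] pc_mono[OF C step.hyps(2) kl(2)] by (metis le_trans linorder_neqE_nat)
qed

text \<open>To get to the right of \<open>k\<close> again, pipe \<open>l\<close> would have to cross
  it horizontally, which only the smaller label may do. Hence one crossing is final as long as
  \<open>k\<close> has not left.\<close>

lemma pc_crossed:
  assumes C: "pipe_columns n w C" and kl: "k \<in> {1..n}" "l \<in> {1..n}" "k < l"
    and i: "j \<le> i" "i \<le> n" and cross: "C i l < C i k" and act: "C j k \<le> n"
  shows "C j l < C j k"
  using i(1) act
proof (induction j rule: inc_induct)
  case base show ?case by (rule cross)
next
  case (step j)
  have jn: "j < n" using step.hyps i by simp
  then have "C (Suc j) k \<le> n" using pc_mono[OF C jn kl(1)] step.prems by simp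
  then have "C (Suc j) l < C (Suc j) k" using step.IH by simp
  then show ?case
    using pc_row[OF C jn kl(2,1)] pc_mono[OF C jn kl(1)] kl(3) \<open>C (Suc j) k \<le> n\<close> by linarith
qed

text \<open>When \<open>k\<close> passes the boundary just above which it is about to leave,
  \<open>l\<close> is still to its left, hence still in the grid or leaving in the same row at the
  latest.\<close>

lemma pc_crossed_exit:
  assumes C: "pipe_columns n w C" and kl: "k \<in> {1..n}" "l \<in> {1..n}" "k < l"
    and i: "i \<le> n" and cross: "C i l < C i k" "C i k \<le> n"
  shows "inv w l \<le> inv w k"
proof -
  have "inv w k \<le> i" using pc_active[OF C i kl(1)] cross by simp
  then have "C (inv w k) k \<le> n" using pc_active[OF C _ kl(1), of "inv w k"] i by simp
  with pc_crossed[OF C kl _ i cross(1)] \<open>inv w k \<le> i\<close>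
  have "C (inv w k) l \<le> n" by fastforce
  then show ?thesis using pc_active[OF C _ kl(2), of "inv w k"] i \<open>inv w k \<le> i\<close> by simp
qed

text \<open>A pipe turning north in row \<open>a\<close> at column \<open>q\<close> exhibits the nondominant box \<open>(a, q)\<close>,
  provided all rows below consist of hooks.\<close>

lemma pc_turn_nondominant:
  assumes w: "w permutes {1..n}" and C: "pipe_columns n w C" and a: "i < n" "a = Suc i"
    and hooks: "\<And>k. k \<in> {1..n} \<Longrightarrow> C a k = hook n w a k"
    and k: "k \<in> {1..n}" "inv w k \<le> a" "k \<noteq> w a" "C i k \<noteq> k"
  shows "nondominant w a (C i k)" "k < C i k" "inv w k < a"
proof -
  define q where "q = C i k"
  have wk: "w (inv w k) = k" using w by (rule permutes_inverses(1))
  then have "inv w k \<noteq> a" using k(3) by auto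
  then show lt: "inv w k < a" using k(2) by simp
  have q: "q \<le> n" using pc_active[OF C _ k(1), of i] lt a by (simp add: q_def)
  have xk: "C a k = k" using hooks[OF k(1)] k(2) by (simp add: hook_def)
  then show kq: "k < C i k" using pc_mono[OF C a(1) k(1)] k(4) a(2) by simp
  \<comment> \<open>The pipe leaving in row \<open>a\<close> occupies everything from column
    \<open>w a\<close> to the right, and so bounds the turn on that side.\<close>
  define al where "al = w a"
  have al: "al \<in> {1..n}" "inv w al = a"
    using a permutes_in_image[OF w, of a] permutes_inverses(2)[OF w, of a] by (auto simp: al_def)
  have xal: "C a al = al" "C i al = Suc n"
    using hooks[OF al(1)] al pc_exit[OF C _ al(1), of i] a by (auto simp: hook_def)
  have "k < al"
  proof (rule ccontr)
    assume "\<not> k < al"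
    then have "C a al < C a k" using xk xal k(3) al_def by simp
    then show False using pc_row[OF C a(1) al(1) k(1)] xk xal k a(2) by auto
  qed
  then have "q < al" using pc_row[OF C a(1) k(1) al(1)] xk xal al a(2) by (auto simp: q_def)
  \<comment> \<open>Otherwise the hook of pipe \<open>q\<close> would enter row \<open>a\<close>
    from the south in column \<open>q\<close>, the very box in which pipe \<open>k\<close>
    turns.\<close>
  moreover have "a < inv w q"
  proof (rule ccontr)
    assume "\<not> a < inv w q"
    then have xq: "C a q = q" "q \<in> {1..n}" using hooks[of q] q kq k(1) by (auto simp: hook_def q_def)
    then show False using pc_row[OF C a(1) k(1) xq(2)] xk kq a(2) q by (auto simp: q_def)
  qed
  moreover have "0 < inv w k" using permutes_in_image[OF permutes_inv[OF w], of k] k(1) by auto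
  ultimately show "nondominant w a (C i k)"
    using lt wk kq unfolding nondominant_def rothe_def q_def al_def by auto
qed

text \<open>Going upwards, the first row in which some pipe deviates from its hook would contain a
  turn, hence a nondominant box.\<close>

lemma pc_hooks:
  assumes w: "w permutes {1..n}" and C: "pipe_columns n w C"
    and dom: "\<And>p q. a < p \<Longrightarrow> \<not> nondominant w p q"
    and i: "a \<le> i" "i \<le> n" and k: "k \<in> {1..n}"
  shows "C i k = hook n w i k"
  using i(2,1) k
proof (induction i arbitrary: k rule: inc_induct)
  case base
  then show ?case
    using pc_start[OF C] permutes_in_image[OF permutes_inv[OF w], of k] by (auto simp: hook_def)
next
  case (step i)
  then have IH: "C (Suc i) l = hook n w (Suc i) l" if "l \<in> {1..n}" for l using that by simp
  consider "i < inv w k" | "inv w k \<le> i" by linarith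
  then show ?case
  proof cases
    case 1
    then have "C i k = Suc n" using pc_exit[OF C _ \<open>k \<in> {1..n}\<close>, of i] step.hyps by simp
    then show ?thesis using 1 by (simp add: hook_def)
  next
    case 2
    then have "k \<noteq> w (Suc i)" using permutes_inverses(2)[OF w, of "Suc i"] by auto
    then have "C i k = k"
      using pc_turn_nondominant(1)[OF w C step.hyps(2) refl IH step.prems(2)] 2 dom[of "Suc i"] step.prems
      by fastforce
    then show ?thesis using 2 by (simp add: hook_def)
  qed
qed

lemma hook_row:
  assumes w: "w permutes {1..n}" and kl: "l \<in> {1..n}"
    and lt: "hook n w (Suc i) k < hook n w (Suc i) l" "hook n w (Suc i) l \<le> n"
  shows "hook n w i k < hook n w (Suc i) l \<or>
    (k < l \<and> hook n w i l = hook n w (Suc i) l \<and> hook n w i l < hook n w i k)"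
proof -
  have act: "inv w l \<le> Suc i" "inv w k \<le> Suc i" "k < l"
    using lt by (auto simp: hook_def split: if_splits)
  have "inv w k \<noteq> inv w l" using act(3) permutes_inverses(1)[OF w] by (metis less_irrefl)
  then show ?thesis using act kl by (auto simp: hook_def)
qed

text \<open>The hook with corner at a dot covers what lies weakly below the dot in its column or
  weakly to its right in its row; the Rothe diagram is what remains.\<close>

lemma covered_hook:
  assumes w: "w permutes {1..n}" and p: "p \<in> {1..n}" "j \<in> {1..n}"
    and hooks: "\<And>k. k \<in> {1..n} \<Longrightarrow> C p k = hook n w p k" "\<And>k. k \<in> {1..n} \<Longrightarrow> C (p - 1) k = hook n w (p - 1) k"
  shows "covered n C p j \<longleftrightarrow> \<not> rothe w p j"
proof -
  have wp: "w p \<in> {1..n}" "inv w (w p) = p"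
    using permutes_in_image[OF w] p permutes_inverses(2)[OF w] by auto
  have wj: "w (inv w j) = j" using w by (rule permutes_inverses(1))
  have "covered n C p j \<longleftrightarrow> inv w j < p \<or> w p \<le> j"
  proof
    assume "covered n C p j"
    then obtain k where k: "k \<in> {1..n}" "C p k \<le> j" "j \<le> C (p - 1) k" by (auto simp: covered_def)
    then have act: "inv w k \<le> p" "k \<le> j" using hooks(1)[of k] p by (auto simp: hook_def split: if_splits)
    show "inv w j < p \<or> w p \<le> j"
    proof (cases "inv w k = p")
      case True
      then have "w p = k" using permutes_inverses(1)[OF w, of k] by simp
      then show ?thesis using act by simp
    next
      case False
      then have "inv w k \<le> p - 1" using act by simp
      then have "j = k" using k hooks(2)[of k] act by (auto simp: hook_def)
      then show ?thesis using False act by simp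
    qed
  next
    assume "inv w j < p \<or> w p \<le> j"
    then show "covered n C p j"
    proof
      assume "inv w j < p"
      then show ?thesis using hooks[OF p(2)] p unfolding covered_def
        by (intro bexI[of _ j]) (auto simp: hook_def)
    next
      assume "w p \<le> j"
      then show ?thesis using hooks[OF wp(1)] wp p unfolding covered_def
        by (intro bexI[of _ "w p"]) (auto simp: hook_def)
    qed
  qed
  moreover have "inv w j = p \<longleftrightarrow> w p = j" using wj wp by auto
  ultimately show ?thesis unfolding rothe_def by linarith
qed

section \<open>The transition on pipedreams\<close>

text \<open>\<open>(a, b)\<close> is the last nondominant box in row-reading order.\<close>

locale transition =
  fixes n :: nat and w :: "nat \<Rightarrow> nat" and a b :: nat
  assumes w: "w permutes {1..n}"
    and box: "nondominant w a b"
    and last_row: "\<And>p q. a < p \<Longrightarrow> \<not> nondominant w p q"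
    and last_col: "\<And>q. b < q \<Longrightarrow> \<not> nondominant w a q"
begin

definition s :: nat where "s = inv w b"

definition v :: "nat \<Rightarrow> nat" where "v = w \<circ> Transposition.transpose a s"

definition child :: "nat \<Rightarrow> nat \<Rightarrow> nat" where
  "child i = v \<circ> Transposition.transpose i a"

definition I :: "nat set" where "I = {i. covers v i a}"

lemma w_inv [simp]: "w (inv w x) = x" "inv w (w x) = x"
  using permutes_inverses[OF w] by auto

lemma w_eq_iff: "w p = q \<longleftrightarrow> p = inv w q"
  by auto

lemma w_in [simp]: "w p \<in> {1..n} \<longleftrightarrow> p \<in> {1..n}" "inv w p \<in> {1..n} \<longleftrightarrow> p \<in> {1..n}"
  using permutes_in_image[OF w] permutes_in_image[OF permutes_inv[OF w]] by auto

section \<open>The dots of \<open>w\<close> around the last nondominant box\<close>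

lemma bounds: "0 < a" "a < s" "s \<le> n" "0 < b" "b < w a" "w a \<le> n" "w s = b"
proof -
  have r: "b < w a" "a < s" "\<exists>i. 0 < i \<and> i < a \<and> w i < b"
    using box by (auto simp: nondominant_def rothe_def s_def)
  then show "b < w a" "a < s" "0 < a" by auto
  obtain i where i: "0 < i" "i < a" "w i < b" using r by blast
  then show "0 < b" by simp
  show ws: "w s = b" by (simp add: s_def)
  show "s \<le> n"
  proof (rule ccontr)
    assume "\<not> s \<le> n"
    then have "w s = s" using permutes_not_in[OF w, of s] by auto
    then have "w a > s" using ws r by simp
    then have "w a \<notin> {1..n}" using \<open>\<not> s \<le> n\<close> by simp
    then have "w a = a" using permutes_not_in[OF w, of a] w_in(1)[of a] by blast
    then show False using \<open>w a > s\<close> r by simp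
  qed
  then show "w a \<le> n" using w_in(1)[of a] r by auto
qed

lemma v_simps [simp]: "v a = b" "v s = w a" "p \<noteq> a \<Longrightarrow> p \<noteq> s \<Longrightarrow> v p = w p"
  using bounds by (auto simp: v_def)

lemma v_less: "p < a \<Longrightarrow> v p = w p"
  using bounds by simp

lemma v_permutes: "v permutes {1..n}"
  unfolding v_def using bounds w by (intro permutes_compose permutes_swap_id) auto

lemma w_eq: "w = v \<circ> Transposition.transpose a s"
  by (simp add: v_def o_assoc[symmetric])

text \<open>The dot northwest of \<open>(a, b)\<close> is northwest of such a box too, so a Rothe
  box there would be a later nondominant one.\<close>

lemma below:
  assumes "a < p" "b \<le> q"
  shows "\<not> rothe w p q"
proof
  assume r: "rothe w p q"
  obtain i where "0 < i" "i < a" "w i < b" using box by (auto simp: nondominant_def)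
  then have "0 < i \<and> i < p \<and> w i < q" using assms by simp
  then have "nondominant w p q" using r unfolding nondominant_def by blast
  then show False using last_row[OF assms(1)] by blast
qed

lemma right:
  assumes "b < q"
  shows "\<not> rothe w a q"
proof
  assume r: "rothe w a q"
  obtain i where "0 < i" "i < a" "w i < b" using box by (auto simp: nondominant_def)
  then have "0 < i \<and> i < a \<and> w i < q" using assms by simp
  then have "nondominant w a q" using r unfolding nondominant_def by blast
  then show False using last_col[OF assms(1)] by blast
qed

lemma not_between: "a < p \<Longrightarrow> p < s \<Longrightarrow> w p < b"
proof (rule ccontr)
  assume p: "a < p" "p < s" "\<not> w p < b"
  then have "w p \<noteq> b" using bounds w_eq_iff s_def by auto
  then have "rothe w p b" using p by (simp add: rothe_def s_def)
  then show False using below[of p b] p bounds by simp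
qed

lemma exited: "b < q \<Longrightarrow> q < w a \<Longrightarrow> inv w q < a"
proof -
  assume q: "b < q" "q < w a"
  then have "\<not> a < inv w q" using right[of q] by (auto simp: rothe_def)
  moreover have "inv w q \<noteq> a" using q by auto
  ultimately show ?thesis by simp
qed

text \<open>A position before \<open>s\<close> has too small a value. For one beyond
  \<open>s\<close>, the value \<open>w a\<close> at \<open>s\<close> must exceed the new value,
  which gives a Rothe box in row \<open>a\<close> to the right of column \<open>b\<close>.\<close>

lemma covers_s: "covers v a s' \<longleftrightarrow> s' = s"
proof
  show "covers v a s'" if "s' = s"
    using that bounds not_between by (auto simp: covers_def)
  assume c: "covers v a s'"
  show "s' = s"
  proof (rule ccontr)
    assume ne: "s' \<noteq> s"
    have s': "a < s'" "b < w s'" using c ne by (auto simp: covers_def)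
    then have "s < s'" using not_between[of s'] ne by linarith
    moreover from this have "w a < b \<or> w s' < w a"
      using c bounds ne s' unfolding covers_def by auto
    ultimately have "rothe w a (w s')" using s' bounds by (auto simp: rothe_def)
    then show False using right s' by blast
  qed
qed

text \<open>The dot that makes \<open>(a, b)\<close> nondominant lies between position
  \<open>0\<close> and \<open>a\<close>, with a value between \<open>0\<close> and \<open>b\<close>.
  So the cover that would create the letter \<open>0\<close> does not occur.\<close>

lemma not_covers_0: "\<not> covers v 0 a"
proof
  assume c: "covers v 0 a"
  have w0: "w 0 = 0" using permutes_not_in[OF w, of 0] by simp
  obtain i where i: "0 < i" "i < a" "w i < b" using box by (auto simp: nondominant_def)
  have "w i \<noteq> 0" using i(1) w0 w_eq_iff by (metis gr0_implies_Suc nat.distinct(1) w_inv(2))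
  moreover have "v i < v 0 \<or> v a < v i" using c i unfolding covers_def by blast
  ultimately show False using i w0 bounds v_less[of 0] v_less[of i] by simp
qed

lemma in_I:
  assumes "i \<in> I"
  shows "0 < i" "i < a" "w i < b" "\<And>m. i < m \<Longrightarrow> m < a \<Longrightarrow> w m < w i \<or> b < w m"
proof -
  have c: "covers v i a" using assms by (simp add: I_def)
  then show "i < a" by (simp add: covers_def)
  then show "w i < b" using c v_less[of i] by (simp add: covers_def)
  show "0 < i" using c not_covers_0 by (cases i) auto
  show "w m < w i \<or> b < w m" if "i < m" "m < a" for m
    using c that v_less[of i] v_less[of m] by (auto simp: covers_def)
qed

lemma I_iff:
  "i \<in> I \<longleftrightarrow> 0 < i \<and> i < a \<and> w i < b \<and> (\<forall>m. i < m \<longrightarrow> m < a \<longrightarrow> w m < w i \<or> b < w m)"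
proof
  show "0 < i \<and> i < a \<and> w i < b \<and> (\<forall>m. i < m \<longrightarrow> m < a \<longrightarrow> w m < w i \<or> b < w m)" if "i \<in> I"
    using in_I[OF that] by blast
  show "i \<in> I" if "0 < i \<and> i < a \<and> w i < b \<and> (\<forall>m. i < m \<longrightarrow> m < a \<longrightarrow> w m < w i \<or> b < w m)"
    using that v_less by (auto simp: I_def covers_def)
qed

lemma child_simps:
  assumes "i < a"
  shows "child i i = b" "child i a = w i" "child i s = w a"
    "p \<noteq> i \<Longrightarrow> p \<noteq> a \<Longrightarrow> p \<noteq> s \<Longrightarrow> child i p = w p"
  using assms bounds by (auto simp: child_def)

lemma child_permutes:
  assumes "i \<in> I"
  shows "child i permutes {1..n}"
  using in_I[OF assms] bounds v_permutes
  unfolding child_def by (intro permutes_compose permutes_swap_id) auto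

lemma inv_child:
  assumes i: "i \<in> I"
  shows "inv (child i) b = i" "inv (child i) (w i) = a" "inv (child i) (w a) = s"
    "k \<noteq> b \<Longrightarrow> k \<noteq> w i \<Longrightarrow> k \<noteq> w a \<Longrightarrow> inv (child i) k = inv w k"
proof -
  have inv: "inv (child i) q = p" if "child i p = q" for p q
    using that permutes_inverses(2)[OF child_permutes[OF i]] by metis
  show "inv (child i) b = i" "inv (child i) (w i) = a" "inv (child i) (w a) = s"
    using child_simps(1-3)[OF in_I(2)[OF i]] inv by blast+
  assume k: "k \<noteq> b" "k \<noteq> w i" "k \<noteq> w a"
  have "inv w k \<noteq> i" "inv w k \<noteq> a" "inv w k \<noteq> s" using k bounds(7) w_inv(1)[of k] by metis+
  then show "inv (child i) k = inv w k"
    using child_simps(4)[OF in_I(2)[OF i], of "inv w k"] by (intro inv) simp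
qed

lemma child_lex:
  assumes i: "i \<in> I"
  shows "w i < child i i" "\<And>p. p < i \<Longrightarrow> child i p = w p"
  using in_I[OF i] child_simps[OF in_I(2)[OF i]] bounds by auto

text \<open>Dots move only in the rows \<open>i\<close>, \<open>a\<close>, \<open>s\<close>. Below
  row \<open>a\<close>, column \<open>b\<close> has no Rothe box and column \<open>w i\<close> is
  already used up in both diagrams; column \<open>w a\<close> is blocked by the dots of the rows
  between \<open>a\<close> and \<open>s\<close>, which lie left of \<open>b\<close>, and the longer
  row \<open>s\<close> of the child meets only columns with dots above row \<open>a\<close>.\<close>

lemma rothe_child:
  assumes i: "i \<in> I" and p: "a < p" and q: "q \<in> {1..n}"
  shows "rothe (child i) p q \<longleftrightarrow> rothe w p q"
proof -
  note ii = in_I[OF i] and cs = child_simps[OF in_I(2)[OF i]] and ic = inv_child[OF i]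
  have be: "inv w (w i) < a" using ii by simp
  consider (b) "q = b" | (be) "q = w i" | (al) "q = w a" | (other) "q \<noteq> b" "q \<noteq> w i" "q \<noteq> w a" by blast
  then show ?thesis
  proof cases
    case b
    then show ?thesis using below[OF p, of b] bounds ic ii p by (auto simp: rothe_def)
  next
    case be
    then show ?thesis using ic p ii by (auto simp: rothe_def)
  next
    case al
    have "\<not> rothe (child i) p q"
    proof
      assume r: "rothe (child i) p q"
      then have ps: "p < s" using al ic by (simp add: rothe_def)
      then have "w p < b" using not_between p by simp
      then show False using r cs(4)[of p] al ps p ii bounds by (simp add: rothe_def)
    qed
    then show ?thesis using al p by (simp add: rothe_def)
  next
    case other
    show ?thesis
    proof (cases "p = s")
      case True
      have "\<not> (b \<le> q \<and> q < w a \<and> s < inv w q)"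
        using exited[of q] other bounds by auto
      then show ?thesis using True cs(3) ic(4)[OF other] bounds by (auto simp: rothe_def)
    next
      case False
      then show ?thesis using cs(4)[of p] ic(4)[OF other] p ii by (simp add: rothe_def)
    qed
  qed
qed

text \<open>This forces hooks below row \<open>a\<close> for the child as well, so that the surgery
  can be undone.\<close>

lemma child_dominant_below:
  assumes i: "i \<in> I" and p: "a < p"
  shows "\<not> nondominant (child i) p q"
proof
  note ii = in_I[OF i] and cs = child_simps[OF in_I(2)[OF i]]
  assume "nondominant (child i) p q"
  then obtain j where r: "rothe (child i) p q" and j: "0 < j" "j < p" "child i j < q"
    by (auto simp: nondominant_def)
  have q: "q \<in> {1..n}"
  proof -
    have "q < child i p" using r by (simp add: rothe_def)
    show ?thesis
    proof (cases "p \<in> {1..n}")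
      case True
      then show ?thesis using \<open>q < child i p\<close> permutes_in_image[OF child_permutes[OF i], of p] j by auto
    next
      case False
      then have "child i p = p" using permutes_not_in[OF child_permutes[OF i]] by blast
      then have "q < inv (child i) q" using r by (simp add: rothe_def)
      then show ?thesis
        using permutes_not_in[OF permutes_inv[OF child_permutes[OF i]], of q] by (metis less_irrefl)
    qed
  qed
  then have "rothe w p q" using r rothe_child[OF i p] by simp
  then have dom: "q \<le> w j'" if "0 < j'" "j' < p" for j'
    using last_row[OF p, of q] \<open>rothe w p q\<close> that unfolding nondominant_def by (meson not_less)
  have "q \<le> w i" "q \<le> w j" "q \<le> w a" using dom[of i] dom[of j] dom[of a] ii j p bounds by auto
  then show False using j(3) cs ii bounds by (cases "j = i \<or> j = a \<or> j = s") auto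
qed

text \<open>Used in both directions, with \<open>u = child i\<close> and with \<open>u = w\<close>:
  the boundaries from \<open>a\<close> downwards are refilled with the hooks of \<open>u\<close>,
  and above them the pipes \<open>w i\<close> and \<open>b\<close> exchange their courses.\<close>

definition swap :: "nat \<Rightarrow> (nat \<Rightarrow> nat) \<Rightarrow> (nat \<Rightarrow> nat \<Rightarrow> nat) \<Rightarrow> nat \<Rightarrow> nat \<Rightarrow> nat" where
  "swap i u C = (\<lambda>j k. if n < j \<or> k \<notin> {1..n} then 0 else if a \<le> j then hook n u j k
     else C j (Transposition.transpose (w i) b k))"

lemma swap_apply:
  assumes "k \<in> {1..n}"
  shows "a \<le> j \<Longrightarrow> j \<le> n \<Longrightarrow> swap i u C j k = hook n u j k"
    and "j < a \<Longrightarrow> swap i u C j k = C j (Transposition.transpose (w i) b k)"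
  using assms bounds by (auto simp: swap_def)

lemma tau_in:
  assumes "i \<in> I"
  shows "Transposition.transpose (w i) b k \<in> {1..n} \<longleftrightarrow> k \<in> {1..n}"
    and "w i \<in> {1..n}" "b \<in> {1..n}" "w a \<in> {1..n}"
proof -
  show "w i \<in> {1..n}" using in_I[OF assms] bounds w_in(1)[of i] by simp
  moreover show "b \<in> {1..n}" "w a \<in> {1..n}" using bounds by simp_all
  ultimately show "Transposition.transpose (w i) b k \<in> {1..n} \<longleftrightarrow> k \<in> {1..n}"
    by (auto simp: Transposition.transpose_def)
qed

lemma hooks:
  assumes "pipe_columns n w C" "a \<le> j" "j \<le> n" "k \<in> {1..n}"
  shows "C j k = hook n w j k"
  using pc_hooks[OF w assms(1) last_row assms(2-4)] .

lemma hooks_child: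
  assumes "i \<in> I" "pipe_columns n (child i) C" "a \<le> j" "j \<le> n" "k \<in> {1..n}"
  shows "C j k = hook n (child i) j k"
  using pc_hooks[OF child_permutes[OF assms(1)] assms(2) child_dominant_below[OF assms(1)] assms(3-5)] .

lemma a_Suc: obtains a' where "a = Suc a'" "a' < n"
  using bounds by (cases a) auto

text \<open>Were the box \<open>(a, b)\<close> blank, so would be all boxes to its left, but the pipe \<open>w i\<close> of some
  \<open>i < a\<close> with \<open>w i < b\<close> meets row \<open>a\<close> in column \<open>w i\<close>.\<close>

lemma turning_pipe:
  assumes C: "C \<in> EG_columns n w"
  obtains i where "i \<in> I" "C (a - 1) (w i) = b"
proof -
  obtain lam where pc: "pipe_columns n w C" and lam: "partition_shape lam" "blanks n C = young lam"
    using C by (auto simp: EG_columns_def)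
  obtain a' where a': "a = Suc a'" "a' < n" by (rule a_Suc)
  have hk: "C a k = hook n w a k" if "k \<in> {1..n}" for k
    using hooks[OF pc _ _ that, of a] bounds by simp
  have ab_grid: "(a, j) \<in> grid n \<longleftrightarrow> j \<in> {1..n}" for j using bounds by (auto simp: grid_def)
  have "covered n C a b"
  proof (rule ccontr)
    assume "\<not> covered n C a b"
    then have ab: "(a, b) \<in> young lam" using lam(2) ab_grid[of b] bounds by (auto simp: blanks_def)
    obtain i where i: "0 < i" "i < a" "w i < b" using box by (auto simp: nondominant_def)
    have wi: "w i \<in> {1..n}" using i bounds w_in(1)[of i] by simp
    then have "(a, w i) \<in> young lam" using ab i by (auto simp: young_def)
    then have "\<not> covered n C a (w i)" using lam(2) by (auto simp: blanks_def)
    moreover have "C a (w i) = w i" using hk[OF wi] i by (simp add: hook_def)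
    ultimately show False
      using wi pc_mono[OF pc a'(2) wi] a' unfolding covered_def by (metis diff_Suc_1 order_refl)
  qed
  then obtain k where k: "k \<in> {1..n}" "C a k \<le> b" "b \<le> C a' k" by (auto simp: covered_def a')
  then have act: "inv w k \<le> a" "k \<le> b" using hk[OF k(1)] bounds by (auto simp: hook_def split: if_splits)
  then have "k \<noteq> b" using bounds s_def by auto
  then have kb: "k < b" using act by simp
  then have ne: "k \<noteq> w a" "C a' k \<noteq> k" using bounds k by auto
  note turn = pc_turn_nondominant[OF w pc a'(2) a'(1) hk k(1) act(1) ne]
  \<comment> \<open>The turn is at or beyond column \<open>b\<close>, and no nondominant box of row
    \<open>a\<close> lies further to the right.\<close>
  have "C a' k = b" using turn(1) last_col k(3) by (metis le_neq_implies_less)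
  define i where "i = inv w k"
  have wi: "w i = k" "i < a" using turn(3) by (auto simp: i_def)
  have i0: "0 < i" using k(1) w_in(2)[of k] by (simp add: i_def)
  \<comment> \<open>A pipe \<open>w m\<close> with value in between would go straight through row
    \<open>a\<close>, be crossed there by \<open>w i\<close>, and therefore leave no lower than
    \<open>w i\<close>, contrary to \<open>i < m\<close>.\<close>
  have "w m < w i \<or> b < w m" if m: "i < m" "m < a" for m
  proof (rule ccontr)
    assume "\<not> (w m < w i \<or> b < w m)"
    moreover have "w m \<noteq> w i" "w m \<noteq> b" using m bounds s_def by (auto simp: w_eq_iff)
    ultimately have wm: "k < w m" "w m < b" using wi by auto
    have wmn: "w m \<in> {1..n}" using w_in(1)[of m] m bounds by simp
    have "C a (w m) = w m" "C a k = k" using hk[OF wmn] hk[OF k(1)] m act by (auto simp: hook_def)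
    then have "C a' (w m) < C a' k"
      using pc_row[OF pc a'(2) k(1) wmn] wm \<open>C a' k = b\<close> a'(1) bounds by auto
    then have "inv w (w m) \<le> inv w k"
      using pc_crossed_exit[OF pc k(1) wmn wm(1), of a'] a' \<open>C a' k = b\<close> bounds by simp
    then show False using m by (simp add: i_def)
  qed
  then have "i \<in> I" using I_iff i0 wi kb by simp
  then show thesis using that \<open>C a' k = b\<close> wi a' by simp
qed

lemma turning_pipe_unique:
  assumes pc: "pipe_columns n w C" and i: "i \<in> I" "C (a - 1) (w i) = b" and j: "j \<in> I" "C (a - 1) (w j) = b"
  shows "i = j"
proof -
  have "a - 1 \<le> n" "b \<le> n" using bounds by auto
  then have "w i = w j"
    using pc_inj[OF pc tau_in(2)[OF i(1)] tau_in(2)[OF j(1)], of "a - 1"] i(2) j(2) by metis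
  then show ?thesis by (simp add: w_eq_iff)
qed

text \<open>The part common to both directions. What remains specific is row \<open>a\<close> itself
  and, above it, that the exchange of the labels \<open>w i\<close> and \<open>b\<close> does not
  reverse the label order required at a crossing.\<close>

lemma pipe_columns_swap:
  fixes i :: nat and u u' :: "nat \<Rightarrow> nat" and C :: "nat \<Rightarrow> nat \<Rightarrow> nat"
  defines "t \<equiv> Transposition.transpose (w i) b" and "D \<equiv> swap i u' C"
  assumes i: "i \<in> I" and u': "u' permutes {1..n}" and pc: "pipe_columns n u C"
    and exits: "\<And>j k. j < a \<Longrightarrow> j < inv u (t k) \<longleftrightarrow> j < inv u' k"
    and mono_a: "\<And>k. k \<in> {1..n} \<Longrightarrow> D a k \<le> D (a - 1) k"
    and row_a: "\<And>k l. k \<in> {1..n} \<Longrightarrow> l \<in> {1..n} \<Longrightarrow> D a k < D a l \<Longrightarrow> D a l \<le> n \<Longrightarrow>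
      D (a - 1) k < D a l \<or> (k < l \<and> D (a - 1) l = D a l \<and> D (a - 1) l < D (a - 1) k)"
    and order: "\<And>j k l. Suc j < a \<Longrightarrow> k \<in> {1..n} \<Longrightarrow> l \<in> {1..n} \<Longrightarrow>
      C (Suc j) (t k) < C (Suc j) (t l) \<Longrightarrow> C (Suc j) (t l) \<le> n \<Longrightarrow> t k < t l \<Longrightarrow> C j (t l) < C j (t k) \<Longrightarrow> k < l"
  shows "pipe_columns n u' D"
proof -
  have tin: "t k \<in> {1..n} \<longleftrightarrow> k \<in> {1..n}" for k unfolding t_def by (rule tau_in(1)[OF i])
  have low: "D j k = hook n u' j k" if "a \<le> j" "j \<le> n" "k \<in> {1..n}" for j k
    unfolding D_def by (rule swap_apply(1)[OF that(3,1,2)])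
  have up: "D j k = C j (t k)" if "j < a" "k \<in> {1..n}" for j k
    unfolding D_def t_def by (rule swap_apply(2)[OF that(2,1)])
  show ?thesis
    unfolding pipe_columns_def
  proof (intro conjI allI ballI impI)
    show "D j k = 0" if "n < j \<or> k \<notin> {1..n}" for j k using that by (simp add: D_def swap_def)
    show "D n k = k" if k: "k \<in> {1..n}" for k
      using low[of n k] bounds permutes_in_image[OF permutes_inv[OF u'], of k] k by (auto simp: hook_def)
    show "D (Suc j) k \<le> D j k" if "j < n" "k \<in> {1..n}" for j k
    proof -
      consider "a \<le> j" | "Suc j = a" | "Suc j < a" by linarith
      then show ?thesis
        using that low[of j k] low[of "Suc j" k] mono_a[of k] up[of j k] up[of "Suc j" k]
          pc_mono[OF pc that(1), of "t k"] tin[of k]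
        by cases (auto simp: hook_def)
    qed
    show "D j k \<le> Suc n" "D j k = Suc n \<longleftrightarrow> j < inv u' k" if "j \<le> n" "k \<in> {1..n}" for j k
      using that low[of j k] up[of j k] exits[of j k] tin[of k] pc_le[OF pc that(1), of "t k"]
        pc_exit[OF pc that(1), of "t k"] by (cases "a \<le> j"; auto simp: hook_def)+
    show "D j k < D (Suc j) l \<or> (k < l \<and> D j l = D (Suc j) l \<and> D j l < D j k)"
      if kl: "j < n" "k \<in> {1..n}" "l \<in> {1..n}" "D (Suc j) k < D (Suc j) l" "D (Suc j) l \<le> n" for j k l
    proof -
      consider (low) "a \<le> j" | (mid) "Suc j = a" | (up) "Suc j < a" by linarith
      then show ?thesis
      proof cases
        case low
        then show ?thesis
          using hook_row[OF u' kl(3), of j k] kl \<open>\<And>k j. a \<le> j \<Longrightarrow> j \<le> n \<Longrightarrow> k \<in> {1..n} \<Longrightarrow> D j k = hook n u' j k\<close>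
          by simp
      next
        case mid then show ?thesis using row_a[of k l] kl by auto
      next
        case up
        then have D: "D j m = C j (t m)" "D (Suc j) m = C (Suc j) (t m)" if "m \<in> {1..n}" for m
          using that \<open>\<And>k j. j < a \<Longrightarrow> k \<in> {1..n} \<Longrightarrow> D j k = C j (t k)\<close> by auto
        show ?thesis
          using pc_row[OF pc kl(1), of "t k" "t l"] order[OF up kl(2,3)] tin kl D by auto
      qed
    qed
  qed
qed

lemma pipe_columns_child:
  assumes pc: "pipe_columns n w C" and i: "i \<in> I" and turn: "C (a - 1) (w i) = b"
  shows "pipe_columns n (child i) (swap i (child i) C)"
proof -
  let ?t = "Transposition.transpose (w i) b" and ?u = "child i" and ?D = "swap i (child i) C"
  obtain a' where a': "a = Suc a'" "a' < n" by (rule a_Suc)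
  note ii = in_I[OF i] and ic = inv_child[OF i] and tin = tau_in[OF i]
  have hk: "C a k = hook n w a k" if "k \<in> {1..n}" for k
    using hooks[OF pc _ _ that, of a] bounds by simp
  have Da: "?D a k = hook n ?u a k" if "k \<in> {1..n}" for k
    using swap_apply(1)[OF that, of a] bounds by simp
  have Da': "?D a' k = C a' (?t k)" if "k \<in> {1..n}" for k
    using swap_apply(2)[OF that, of a'] a' by simp
  have t: "?t b = w i" "?t (w i) = b" "k \<noteq> b \<Longrightarrow> k \<noteq> w i \<Longrightarrow> ?t k = k" for k by simp_all
  have a1: "a - 1 = a'" using a' by simp
  have turn': "C a' (w i) = b" using turn a' by simp
  have exited_b: "C j b = Suc n" if "j < a" for j
    using pc_exit[OF pc _ tin(3), of j] that bounds s_def by simp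
  have exited_al: "C j (w a) = Suc n" if "j < a" for j
    using pc_exit[OF pc _ tin(4), of j] that bounds by simp
  have inv_ne: "inv w (w i) = i" "inv w b = s" "inv w (w a) = a" using bounds s_def by auto
  have wne: "w i \<noteq> b" "w a \<noteq> b" "w i \<noteq> w a" using ii bounds by auto
  \<comment> \<open>A turn of \<open>k\<close> would take place no further right than column
    \<open>b\<close>, but there pipe \<open>w i\<close> occupies row \<open>a\<close>
    horizontally.\<close>
  have turned: "C a' k = k" if k: "k \<in> {1..n}" "inv w k \<le> a" "k \<noteq> w a" "w i < k" for k
  proof (rule ccontr)
    assume ne: "C a' k \<noteq> k"
    note tn = pc_turn_nondominant[OF w pc a'(2) a'(1) hk k(1-3) ne]
    have "C a' k \<le> b" using tn(1) last_col by (meson not_le)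
    moreover have xk: "C a k = k" using hk[OF k(1)] k(2) by (simp add: hook_def)
    moreover have "C a (w i) = w i" using hk[OF tin(2)] ii by (simp add: hook_def)
    ultimately show False
      using pc_row[OF pc a'(2) tin(2) k(1)] turn' tn(2) k a'(1) by auto
  qed
  have exits: "j < inv w (?t k) \<longleftrightarrow> j < inv ?u k" if ja: "j < a" for j k
    using ic inv_ne t(3)[of k] ja bounds ii wne by (cases "k = b \<or> k = w i \<or> k = w a") auto
  have mono_a: "?D a k \<le> ?D a' k" if k: "k \<in> {1..n}" for k
  proof -
    consider "k = b" | "k = w i" | "k = w a" | "k \<noteq> b" "k \<noteq> w i" "k \<noteq> w a" by blast
    then show ?thesis
    proof cases
      case 1 then show ?thesis using Da[OF k] Da'[OF k] turn' ic ii by (simp add: hook_def)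
    next
      case 2 then show ?thesis using Da[OF k] Da'[OF k] exited_b a' ic k by (simp add: hook_def)
    next
      case 3 then show ?thesis using Da[OF k] Da'[OF k] exited_al[of a'] a' t(3)[of "w a"] wne k
        by (simp add: hook_def)
    next
      case 4 then show ?thesis using Da[OF k] Da'[OF k] hk[OF k] pc_mono[OF pc a'(2) k] a' ic(4) t(3)[of k]
        by (simp add: hook_def)
    qed
  qed
  have row_a: "?D a' k < ?D a l \<or> (k < l \<and> ?D a' l = ?D a l \<and> ?D a' l < ?D a' k)"
    if kl: "k \<in> {1..n}" "l \<in> {1..n}" "?D a k < ?D a l" "?D a l \<le> n" for k l
  proof -
    have act: "inv ?u l \<le> a" "inv ?u k \<le> a" and Dkl: "?D a k = k" "?D a l = l"
      using kl Da[OF kl(1)] Da[OF kl(2)] by (auto simp: hook_def split: if_splits)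
    then have lt: "k < l" using kl by simp
    have not_al: "l \<noteq> w a" "k \<noteq> w a" using act ic bounds by auto
    have other: "inv w m \<le> a \<and> C a m = m" if "m \<in> {k, l}" "m \<noteq> b" "m \<noteq> w i" for m
      using that act ic(4)[of m] hk[of m] kl not_al by (auto simp: hook_def)
    have xi: "C a (w i) = w i" using hk[OF tin(2)] ii by (simp add: hook_def)
    consider (ki) "k = w i" | (li) "l = w i" | (kb) "k = b" | (lb) "l = b" "k \<noteq> w i"
      | (o) "k \<noteq> w i" "l \<noteq> w i" "k \<noteq> b" "l \<noteq> b" by blast
    then show ?thesis
    proof cases
      case ki
      then have "?D a' k = Suc n" using Da'[OF kl(1)] exited_b a' by simp
      moreover have "?D a' l = l"
      proof (cases "l = b")
        case True then show ?thesis using Da'[OF kl(2)] turn' by simp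
      next
        case False
        then have "l \<noteq> w i" using lt ki by simp
        with False show ?thesis using turned[of l] other[of l] Da'[OF kl(2)] kl lt ki not_al t(3)[of l] by simp
      qed
      ultimately show ?thesis using Dkl lt kl by simp
    next
      case li
      then have "k \<noteq> b" using lt ii by simp
      then have k: "C a k = k" "?D a' k = C a' k" using other[of k] lt li Da'[OF kl(1)] t(3)[of k] by auto
      then have "C a' k < w i" using pc_row[OF pc a'(2) kl(1) tin(2)] xi lt li a' turn' kl tin(2) wne by auto
      then show ?thesis using k Dkl li by simp
    next
      case kb
      then show ?thesis using Da'[OF kl(1)] turn' Dkl lt by simp
    next
      case lb
      then have k: "?D a' k = C a' k" using Da'[OF kl(1)] t(3)[of k] lt by simp
      have "C a' k \<noteq> b" using pc_inj[OF pc tin(2) kl(1), of a'] turn' lb a' bounds by auto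
      moreover have "?D a' l = b" using Da'[OF kl(2)] turn' lb by simp
      ultimately show ?thesis using k Dkl lb lt by auto
    next
      case o
      then show ?thesis
        using pc_row[OF pc a'(2) kl(1,2)] other[of k] other[of l] Da'[OF kl(1)] Da'[OF kl(2)] t(3) lt Dkl a' kl
        by auto
    qed
  qed
  have order: "k < l"
    if j: "Suc j < a" and kl: "k \<in> {1..n}" "l \<in> {1..n}" "C (Suc j) (?t k) < C (Suc j) (?t l)"
      "C (Suc j) (?t l) \<le> n" and lt: "?t k < ?t l" for j k l
  proof -
    have jn: "j < n" "Suc j \<le> n" using j bounds by auto
    have ne: "k \<noteq> w i" "l \<noteq> w i" using kl exited_b[OF j] by auto
    show ?thesis
    \<comment> \<open>The critical case: the pipe now labelled \<open>b\<close> follows the old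
      course of \<open>w i\<close>. A pipe \<open>l\<close> with \<open>w i < l < b\<close> has
      already been crossed by it in row \<open>a\<close>, so it cannot be to its right further
      up.\<close>
    proof (cases "k = b")
      case True
      moreover have "k \<noteq> l" using kl(3) by auto
      ultimately have "l \<noteq> b" "?t l = l" using t(3)[of l] ne by simp_all
      then have l: "l \<noteq> b" "?t l = l" "w i < l" using lt True by simp_all
      have "b < l"
      proof (rule ccontr)
        assume "\<not> b < l"
        then have lb: "l < b" using l by simp
        have act: "inv w l \<le> Suc j" using pc_active[OF pc jn(2) kl(2)] kl(4) l by simp
        then have la: "C a l = l" using hk[OF kl(2)] j by (simp add: hook_def)
        have "l \<noteq> w a" using lb bounds by simp
        then have "C a' l = l" using turned[OF kl(2)] act j l by simp
        then have "C a' l < C a' (w i)" using lb turn' by simp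
        then have "C (Suc j) l < C (Suc j) (w i)"
          using pc_crossed[OF pc tin(2) kl(2) l(3), of "Suc j" a'] j a' kl(3,4) True l by auto
        then show False using kl(3) True l by simp
      qed
      then show ?thesis using True by simp
    next
      case False
      then have "?t k = k" using ne t by simp
      then show ?thesis using lt ne t ii(3) by (cases "l = b") auto
    qed
  qed
  show ?thesis
    using pipe_columns_swap[OF i child_permutes[OF i] pc exits mono_a[folded a1] row_a[folded a1] order] .
qed

lemma pipe_columns_parent:
  assumes i: "i \<in> I" and pc: "pipe_columns n (child i) C"
  shows "pipe_columns n w (swap i w C)" and "swap i w C (a - 1) (w i) = b"
proof -
  let ?t = "Transposition.transpose (w i) b" and ?u = "child i" and ?D = "swap i w C"
  obtain a' where a': "a = Suc a'" "a' < n" by (rule a_Suc)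
  note u = child_permutes[OF i]
  note ii = in_I[OF i] and ic = inv_child[OF i] and tin = tau_in[OF i] and cs = child_simps[OF in_I(2)[OF i]]
  have hk: "C a k = hook n ?u a k" if "k \<in> {1..n}" for k
    using hooks_child[OF i pc _ _ that, of a] bounds by simp
  have Da: "?D a k = hook n w a k" if "k \<in> {1..n}" for k
    using swap_apply(1)[OF that, of a] bounds by simp
  have Da': "?D a' k = C a' (?t k)" if "k \<in> {1..n}" for k
    using swap_apply(2)[OF that, of a'] a' by simp
  have t: "?t b = w i" "?t (w i) = b" "k \<noteq> b \<Longrightarrow> k \<noteq> w i \<Longrightarrow> ?t k = k" for k by simp_all
  have a1: "a - 1 = a'" using a' by simp
  have exited_be: "C j (w i) = Suc n" if "j < a" for j
    using pc_exit[OF pc _ tin(2), of j] that bounds ic by simp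
  have exited_al: "C j (w a) = Suc n" if "j < a" for j
    using pc_exit[OF pc _ tin(4), of j] that bounds ic by simp
  have inv_ne: "inv w (w i) = i" "inv w b = s" "inv w (w a) = a" using bounds s_def by auto
  have wne: "w i \<noteq> b" "w a \<noteq> b" "w i \<noteq> w a" using ii bounds by auto
  \<comment> \<open>In the child, pipe \<open>w i\<close> leaves in row \<open>a\<close> and
    occupies it from column \<open>w i\<close> on, so no pipe to its right can turn there.\<close>
  have turned: "C a' k = k" if k: "k \<in> {1..n}" "inv ?u k \<le> a" "w i < k" for k
  proof (rule ccontr)
    assume ne: "C a' k \<noteq> k"
    have "k \<noteq> ?u a" using k cs by simp
    note tn = pc_turn_nondominant[OF u pc a'(2) a'(1) hk k(1,2) this ne]
    have "C a' k < ?u a" using tn(1) by (simp add: nondominant_def rothe_def)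
    then show False using tn(2) k cs by simp
  qed
  have turn': "C a' b = b" using turned[OF tin(3)] ic ii by simp
  show "?D (a - 1) (w i) = b" using Da'[OF tin(2)] a' turn' by simp
  have exits: "j < inv ?u (?t k) \<longleftrightarrow> j < inv w k" if ja: "j < a" for j k
    using ic inv_ne t(3)[of k] ja bounds ii wne by (cases "k = b \<or> k = w i \<or> k = w a") auto
  have mono_a: "?D a k \<le> ?D a' k" if k: "k \<in> {1..n}" for k
  proof -
    consider "k = b" | "k = w i" | "k = w a" | "k \<noteq> b" "k \<noteq> w i" "k \<noteq> w a" by blast
    then show ?thesis
    proof cases
      case 1 then show ?thesis using Da[OF k] Da'[OF k] exited_be[of a'] a' k by (simp add: hook_def)
    next
      case 2 then show ?thesis using Da[OF k] Da'[OF k] turn' ii by (simp add: hook_def)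
    next
      case 3 then show ?thesis using Da[OF k] Da'[OF k] exited_al[of a'] a' t(3)[of "w a"] wne k
        by (simp add: hook_def)
    next
      case 4 then show ?thesis using Da[OF k] Da'[OF k] hk[OF k] pc_mono[OF pc a'(2) k] a' ic(4) t(3)[of k]
        by (simp add: hook_def)
    qed
  qed
  have xi: "C a (w i) = w i" using hk[OF tin(2)] ic by (simp add: hook_def)
  have row_a: "?D a' k < ?D a l \<or> (k < l \<and> ?D a' l = ?D a l \<and> ?D a' l < ?D a' k)"
    if kl: "k \<in> {1..n}" "l \<in> {1..n}" "?D a k < ?D a l" "?D a l \<le> n" for k l
  proof -
    have act: "inv w l \<le> a" "inv w k \<le> a" and Dkl: "?D a k = k" "?D a l = l"
      using kl Da[OF kl(1)] Da[OF kl(2)] by (auto simp: hook_def split: if_splits)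
    then have lt: "k < l" using kl by simp
    have not_b: "l \<noteq> b" "k \<noteq> b" using act inv_ne bounds by auto
    have other: "inv ?u m \<le> a" "C a m = m" "?D a' m = C a' m"
      if "m \<in> {k, l}" "m \<noteq> w a" "m \<noteq> w i" for m
      using that act ic(4)[of m] hk[of m] kl not_b Da'[of m] t(3)[of m] by (auto simp: hook_def)
    have left: "C a' m < w i" if "m \<in> {k, l}" "m < w i" "m \<noteq> w a" for m
      using pc_row[OF pc a'(2) _ tin(2), of m] other[of m] that xi exited_be[of a'] a' kl tin(2) by auto
    consider (ki) "k = w i" | (li) "l = w i" | (ka) "k = w a" | (la) "l = w a" "k \<noteq> w i"
      | (o) "k \<noteq> w i" "l \<noteq> w i" "k \<noteq> w a" "l \<noteq> w a" by blast
    then show ?thesis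
    proof cases
      case ki
      then have Dk: "?D a' k = b" using Da'[OF kl(1)] turn' by simp
      show ?thesis
      proof (cases "l = w a")
        case True then show ?thesis using Dk Dkl bounds by simp
      next
        case False
        then have "?D a' l = l" using turned[OF kl(2)] other[of l] lt ki by simp
        then show ?thesis using Dk Dkl lt not_b by auto
      qed
    next
      case li
      then have "k \<noteq> w a" using lt ii bounds by simp
      then show ?thesis using left[of k] other(3)[of k] lt li Dkl by simp
    next
      case ka
      then have "?D a' k = Suc n" using Da'[OF kl(1)] exited_al[of a'] a' t(3)[of "w a"] wne by simp
      moreover have "?D a' l = l" using turned[OF kl(2)] other[of l] lt ka ii bounds by simp
      ultimately show ?thesis using Dkl lt kl by simp
    next
      case la
      then have ka: "k \<noteq> w a" using lt by simp
      show ?thesis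
      proof (cases "k < w i")
        case True
        then show ?thesis using left[of k] other(3)[of k] la ka Dkl ii bounds by simp
      next
        case False
        then have "w i < k" using la by simp
        then have "?D a' k = k" using turned[OF kl(1)] other[of k] la ka by simp
        then show ?thesis using Dkl lt by simp
      qed
    next
      case o
      then show ?thesis
        using pc_row[OF pc a'(2) kl(1,2)] other[of k] other[of l] lt Dkl a' kl by auto
    qed
  qed
  have order: "k < l"
    if j: "Suc j < a" and kl: "k \<in> {1..n}" "l \<in> {1..n}" "C (Suc j) (?t k) < C (Suc j) (?t l)"
      "C (Suc j) (?t l) \<le> n" and lt: "?t k < ?t l" and cross: "C j (?t l) < C j (?t k)" for j k l
  proof -
    have jn: "j < n" "Suc j \<le> n" using j bounds by auto
    have ne: "k \<noteq> b" "l \<noteq> b" "k \<noteq> l" using kl exited_be[OF j] by auto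
    show ?thesis
    proof (cases "l = w i")
      \<comment> \<open>The critical case: \<open>w i\<close> takes over the course of
        \<open>b\<close>. For a pipe \<open>k\<close> between \<open>w i\<close> and
        \<open>b\<close> the cover condition on \<open>i\<close> gives \<open>inv w k < i\<close>;
        but a pipe crossing \<open>b\<close> horizontally cannot leave above row \<open>i\<close>,
        the exit row of \<open>b\<close>.\<close>
      case True
      then have k: "?t k = k" "k < b" "C j b < C j k" using lt ne t cross by auto
      show ?thesis
      proof (rule ccontr)
        assume "\<not> k < l"
        then have be: "w i < k" using ne True by simp
        have act: "inv ?u k \<le> Suc j" using pc_active[OF pc jn(2) kl(1)] kl(3,4) k(1) by simp
        then have "k \<noteq> w a" using ic(3) j bounds by auto
        then have m: "inv ?u k = inv w k" using ic(4)[of k] k be by simp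
        have "w (inv w k) = k" by simp
        then have "\<not> i < inv w k" using ii(4)[of "inv w k"] act m j k(2) be by auto
        moreover have "inv w k \<noteq> i" using be by auto
        ultimately have lt_i: "inv w k < i" by simp
        show False
        proof (cases "C j k \<le> n")
          case True
          then have "inv ?u b \<le> inv ?u k"
            using pc_crossed_exit[OF pc kl(1) tin(3) k(2) _ k(3)] jn by simp
          then show False using ic m lt_i by simp
        next
          case False
          then have "j < inv ?u k" using pc_active[OF pc _ kl(1), of j] jn by simp
          moreover have "C j b \<le> n" using k(3) pc_le[OF pc _ kl(1), of j] jn by simp
          then have "i \<le> j" using pc_active[OF pc _ tin(3), of j] jn ic by simp
          ultimately show False using lt_i act m by simp
        qed
      qed
    next
      case False
      then have "?t l = l" using ne t by simp
      then show ?thesis using lt ne t ii(3) by (cases "k = w i") auto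
    qed
  qed
  show "pipe_columns n w ?D"
    using pipe_columns_swap[OF i w pc exits mono_a[folded a1] row_a[folded a1] order] .
qed

text \<open>Overwriting the lower rows loses nothing, since they are forced to be hooks for
  \<open>w\<close> and for the child; above them the same two courses are exchanged twice.\<close>

lemma swap_swap:
  assumes "i \<in> I"
  shows "pipe_columns n w C \<Longrightarrow> swap i w (swap i u C) = C"
    and "pipe_columns n (child i) C \<Longrightarrow> swap i (child i) (swap i u C) = C"
proof -
  note tin = tau_in(1)[OF assms]
  show "swap i w (swap i u C) = C" if pc: "pipe_columns n w C"
  proof (intro ext)
    fix j k show "swap i w (swap i u C) j k = C j k"
      using pc_zero[OF pc, of j k] hooks[OF pc, of j k] tin[of k] by (auto simp: swap_def)
  qed
  show "swap i (child i) (swap i u C) = C" if pc: "pipe_columns n (child i) C"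
  proof (intro ext)
    fix j k show "swap i (child i) (swap i u C) j k = C j k"
      using pc_zero[OF pc, of j k] hooks_child[OF assms pc, of j k] tin[of k] by (auto simp: swap_def)
  qed
qed

text \<open>Above row \<open>a\<close> pipes are only relabelled, and below it the Rothe diagrams
  agree. In row \<open>a\<close> the child's pipe \<open>w i\<close> also covers the columns
  strictly between \<open>b\<close> and \<open>w a\<close>; in the parent these are covered by pipes
  passing through the row to exits above it.\<close>

lemma blanks_swap:
  assumes pc: "pipe_columns n w C" and i: "i \<in> I" and turn: "C (a - 1) (w i) = b"
  shows "blanks n (swap i (child i) C) = blanks n C"
proof -
  let ?t = "Transposition.transpose (w i) b" and ?u = "child i" and ?D = "swap i (child i) C"
  obtain a' where a': "a = Suc a'" "a' < n" by (rule a_Suc)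
  note ii = in_I[OF i] and ic = inv_child[OF i] and tin = tau_in[OF i]
  have hk: "C a k = hook n w a k" if "k \<in> {1..n}" for k
    using hooks[OF pc _ _ that, of a] bounds by simp
  have Da: "?D a k = hook n ?u a k" if "k \<in> {1..n}" for k
    using swap_apply(1)[OF that, of a] bounds by simp
  have Da': "?D a' k = C a' (?t k)" if "k \<in> {1..n}" for k
    using swap_apply(2)[OF that, of a'] a' by simp
  have turn': "C a' (w i) = b" using turn a' by simp
  have inv_ne: "inv w (w i) = i" "inv w b = s" "inv w (w a) = a" using bounds s_def by auto
  have "covered n ?D p q \<longleftrightarrow> covered n C p q" if pq: "p \<in> {1..n}" "q \<in> {1..n}" for p q
  proof -
    consider "a < p" | "p < a" | "p = a" by linarith
    then show ?thesis
    proof cases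
      case 1
      have D: "?D p k = hook n ?u p k" "?D (p - 1) k = hook n ?u (p - 1) k" if "k \<in> {1..n}" for k
        using swap_apply(1)[OF that, of p] swap_apply(1)[OF that, of "p - 1"] 1 pq by auto
      have E: "C p k = hook n w p k" "C (p - 1) k = hook n w (p - 1) k" if "k \<in> {1..n}" for k
        using hooks[OF pc _ _ that, of p] hooks[OF pc _ _ that, of "p - 1"] 1 pq by auto
      show ?thesis
        using covered_hook[OF child_permutes[OF i] pq D] covered_hook[OF w pq E] rothe_child[OF i 1 pq(2)]
        by simp
    next
      case 2
      then have D: "?D p k = C p (?t k)" "?D (p - 1) k = C (p - 1) (?t k)" if "k \<in> {1..n}" for k
        using swap_apply(2)[OF that] by auto
      show ?thesis
      proof
        assume "covered n ?D p q"
        then obtain k where "k \<in> {1..n}" "?D p k \<le> q" "q \<le> ?D (p - 1) k" by (auto simp: covered_def)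
        then show "covered n C p q" using D tin(1)[of k] unfolding covered_def by (intro bexI[of _ "?t k"]) auto
      next
        assume "covered n C p q"
        then obtain k where k: "k \<in> {1..n}" "C p k \<le> q" "q \<le> C (p - 1) k" by (auto simp: covered_def)
        then have "?t k \<in> {1..n}" using tin(1)[of k] by simp
        then show "covered n ?D p q" using D[of "?t k"] k unfolding covered_def by (intro bexI[of _ "?t k"]) auto
      qed
    next
      case 3
      have same: "?D a k = C a k \<and> ?D a' k = C a' k" if "k \<in> {1..n}" "k \<noteq> b" "k \<noteq> w i" "k \<noteq> w a" for k
        using that Da Da' hk ic(4) by (simp add: hook_def)
      have Dbe: "?D a (w i) = w i" "?D a' (w i) = Suc n" "?D a b = b" "?D a' b = b" "?D a (w a) = Suc n"
        using Da[OF tin(2)] Da'[OF tin(2)] Da[OF tin(3)] Da'[OF tin(3)] Da[OF tin(4)] ic turn' ii bounds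
          pc_exit[OF pc _ tin(3), of a'] inv_ne a' by (auto simp: hook_def)
      have Cbe: "C a (w i) = w i" "C a b = Suc n" "C a (w a) = w a" "C a' (w a) = Suc n"
        using hk[OF tin(2)] hk[OF tin(3)] hk[OF tin(4)] inv_ne ii bounds pc_exit[OF pc _ tin(4), of a'] a'
        by (auto simp: hook_def)
      have cov: "covered n X a q \<longleftrightarrow> (\<exists>k\<in>{1..n}. X a k \<le> q \<and> q \<le> X a' k)" for X
        by (simp add: covered_def a')
      have "covered n ?D a q" if cC: "covered n C a q"
      proof -
        obtain k where k: "k \<in> {1..n}" "C a k \<le> q" "q \<le> C a' k"
          using cC[unfolded cov] by blast
        consider "k = w a \<or> k = w i" | "k = b" | "k \<noteq> b" "k \<noteq> w i" "k \<noteq> w a" by blast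
        then show ?thesis
        proof cases
          case 1 then show ?thesis unfolding cov using Dbe Cbe k pq ii bounds tin(2)
            by (intro bexI[of _ "w i"]) auto
        next
          case 2 then show ?thesis using Cbe k pq by simp
        next
          case 3 then show ?thesis unfolding cov using same[of k] k by (intro bexI[of _ k]) auto
        qed
      qed
      moreover have "covered n C a q" if cD: "covered n ?D a q"
      proof -
        obtain k where k: "k \<in> {1..n}" "?D a k \<le> q" "q \<le> ?D a' k"
          using cD[unfolded cov] by blast
        consider "k = w i \<or> k = b" | "k = w a" | "k \<noteq> b" "k \<noteq> w i" "k \<noteq> w a" by blast
        then show ?thesis
        proof cases
          case 1
          then have q: "w i \<le> q" using k Dbe ii by auto
          consider "q \<le> b" | "w a \<le> q" | "b < q" "q < w a" by linarith
          then show ?thesis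
          proof cases
            case 1 then show ?thesis unfolding cov using q Cbe turn' tin(2) by (intro bexI[of _ "w i"]) auto
          next
            case 2 then show ?thesis unfolding cov using Cbe tin(4) pq by (intro bexI[of _ "w a"]) auto
          next
            case 3
            then have "C a q = q" using exited[of q] hk[OF pq(2)] by (simp add: hook_def)
            then show ?thesis unfolding cov using pc_mono[OF pc a'(2) pq(2)] a' pq by (intro bexI[of _ q]) auto
          qed
        next
          case 2 then show ?thesis using Dbe k pq by simp
        next
          case 3 then show ?thesis unfolding cov using same[of k] k by (intro bexI[of _ k]) auto
        qed
      qed
      ultimately show ?thesis using 3 by blast
    qed
  qed
  then show ?thesis by (auto simp: blanks_def grid_def)
qed

lemma transition_EG_columns:
  "\<exists>f. bij_betw f (EG_columns n w) (\<Union>i\<in>I. EG_columns n (child i)) \<and>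
    (\<forall>C\<in>EG_columns n w. blanks n (f C) = blanks n C)"
proof -
  define turn where "turn C i \<longleftrightarrow> i \<in> I \<and> C (a - 1) (w i) = b" for C :: "nat \<Rightarrow> nat \<Rightarrow> nat" and i
  define f where "f C = swap (SOME i. turn C i) (child (SOME i. turn C i)) C" for C
  have f: "\<exists>i. turn C i \<and> f C = swap i (child i) C" if "C \<in> EG_columns n w" for C
  proof -
    have "\<exists>i. turn C i" using turning_pipe[OF that] by (auto simp: turn_def)
    then show ?thesis unfolding f_def by (metis someI_ex)
  qed
  have bl: "blanks n (f C) = blanks n C" if C: "C \<in> EG_columns n w" for C
  proof -
    obtain i where "turn C i" "f C = swap i (child i) C" using f[OF C] by blast
    then show ?thesis using C blanks_swap[of C i] by (simp add: EG_columns_def turn_def)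
  qed
  have "bij_betw f (EG_columns n w) (\<Union>i\<in>I. EG_columns n (child i))"
  proof (rule bij_betwI')
    fix C D assume C: "C \<in> EG_columns n w" and D: "D \<in> EG_columns n w"
    have "C = D" if eq: "f C = f D"
    proof -
      obtain i j where i: "turn C i" "f C = swap i (child i) C" and j: "turn D j" "f D = swap j (child j) D"
        using f[OF C] f[OF D] by blast
      have pcC: "pipe_columns n w C" and pcD: "pipe_columns n w D" using C D by (auto simp: EG_columns_def)
      have pi: "pipe_columns n (child i) (f C)" using pipe_columns_child[OF pcC] i by (auto simp: turn_def)
      have pj: "pipe_columns n (child j) (f C)" using pipe_columns_child[OF pcD] j eq by (auto simp: turn_def)
      have iI: "i \<in> I" and jI: "j \<in> I" using i j by (auto simp: turn_def)
      note wi = tau_in(2)[OF iI]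
      \<comment> \<open>The columns determine the exit rows, so the pipe leaving in row
        \<open>a\<close> is the same for both children; it is \<open>w i\<close> for one and
        \<open>w j\<close> for the other.\<close>
      have "inv (child i) (w i) = a" by (rule inv_child(2)[OF iI])
      moreover have an: "a \<le> n" "a - 1 \<le> n" using bounds by auto
      moreover have "a < inv (child i) (w i) \<longleftrightarrow> a < inv (child j) (w i)"
        using pc_exit[OF pi an(1) wi] pc_exit[OF pj an(1) wi] by simp
      moreover have "a - 1 < inv (child i) (w i) \<longleftrightarrow> a - 1 < inv (child j) (w i)"
        using pc_exit[OF pi an(2) wi] pc_exit[OF pj an(2) wi] by simp
      ultimately have "inv (child j) (w i) = a" using bounds(1) by linarith
      then have "child j a = w i" using permutes_inverses(1)[OF child_permutes[OF jI], of "w i"] by simp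
      then have "w j = w i" using child_simps(2)[OF in_I(2)[OF jI]] by simp
      then have "j = i" by (simp add: w_eq_iff)
      then show "C = D" using i j eq swap_swap(1)[OF iI pcC] swap_swap(1)[OF iI pcD] by metis
    qed
    then show "f C = f D \<longleftrightarrow> C = D" by auto
  next
    fix C assume C: "C \<in> EG_columns n w"
    then obtain i where i: "turn C i" "f C = swap i (child i) C" using f by blast
    have "pipe_columns n (child i) (f C)"
      using pipe_columns_child[of C i] C i by (auto simp: turn_def EG_columns_def)
    then have "f C \<in> EG_columns n (child i)" using bl[OF C] C by (simp add: EG_columns_def)
    then show "f C \<in> (\<Union>i\<in>I. EG_columns n (child i))" using i by (auto simp: turn_def)
  next
    fix D assume "D \<in> (\<Union>i\<in>I. EG_columns n (child i))"
    then obtain i where i: "i \<in> I" "D \<in> EG_columns n (child i)" by blast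
    define C where "C = swap i w D"
    have pcD: "pipe_columns n (child i) D" using i by (simp add: EG_columns_def)
    have pc: "pipe_columns n w C" "C (a - 1) (w i) = b"
      using pipe_columns_parent[OF i(1) pcD] by (auto simp: C_def)
    have D: "D = swap i (child i) C" using swap_swap(2)[OF i(1) pcD] by (simp add: C_def)
    then have "blanks n C = blanks n D" using blanks_swap[OF pc(1) i(1) pc(2)] by simp
    then have CE: "C \<in> EG_columns n w" using pc i(2) by (simp add: EG_columns_def)
    then obtain j where "turn C j" "f C = swap j (child j) C" using f by blast
    moreover from this have "j = i" using turning_pipe_unique[OF pc(1)] i pc by (auto simp: turn_def)
    ultimately show "\<exists>C\<in>EG_columns n w. D = f C" using CE D by (intro bexI[of _ C]) simp_all
  qed
  with bl show ?thesis by blast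
qed

end

text \<open>Without nondominant boxes the hooks are forced in all rows, by \<open>pc_hooks\<close>
  with \<open>a = 0\<close>.\<close>

lemma dominant_EG_columns:
  assumes w: "w permutes {1..n}" and dom: "\<And>p q. \<not> nondominant w p q"
    and lam: "partition_shape lam" "young lam = {(i, j). (i, j) \<in> grid n \<and> rothe w i j}"
  shows "\<exists>C. EG_columns n w = {C} \<and> blanks n C = young lam"
proof -
  define H where "H i k = (if n < i \<or> k \<notin> {1..n} then 0 else hook n w i k)" for i k
  have inv_in: "inv w k \<in> {1..n}" if "k \<in> {1..n}" for k
    using permutes_in_image[OF permutes_inv[OF w]] that by simp
  have Hh: "H i k = hook n w i k" if "i \<le> n" "k \<in> {1..n}" for i k using that by (auto simp: H_def)
  have pc: "pipe_columns n w H"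
    unfolding pipe_columns_def
  proof (intro conjI allI ballI impI)
    show "H n k = k" if "k \<in> {1..n}" for k using that inv_in[OF that] by (simp add: H_def hook_def)
    show "H (Suc i) k \<le> H i k" if "i < n" "k \<in> {1..n}" for i k using that by (auto simp: H_def hook_def)
    show "H i k \<le> Suc n" "H i k = Suc n \<longleftrightarrow> i < inv w k" if "i \<le> n" "k \<in> {1..n}" for i k
      using that by (auto simp: H_def hook_def)
    show "H i k < H (Suc i) l \<or> k < l \<and> H i l = H (Suc i) l \<and> H i l < H i k"
      if h: "i < n" "k \<in> {1..n}" "l \<in> {1..n}" "H (Suc i) k < H (Suc i) l" "H (Suc i) l \<le> n" for i k l
      using hook_row[OF w h(3), of i k] h by (simp add: H_def)
  qed (simp add: H_def)
  have "covered n H p q \<longleftrightarrow> \<not> rothe w p q" if "p \<in> {1..n}" "q \<in> {1..n}" for p q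
    by (rule covered_hook[OF w that]) (use Hh that in auto)
  then have bl: "blanks n H = young lam" unfolding blanks_def lam(2) by (auto simp: grid_def)
  have "C = H" if C: "C \<in> EG_columns n w" for C
  proof (intro ext)
    fix i k
    have pcC: "pipe_columns n w C" using C by (simp add: EG_columns_def)
    show "C i k = H i k"
      using pc_zero[OF pcC, of i k] pc_hooks[OF w pcC dom, of 0 i k] by (auto simp: H_def)
  qed
  moreover have "H \<in> EG_columns n w" using pc bl lam(1) unfolding EG_columns_def by blast
  ultimately have "EG_columns n w = {H}" by blast
  then show ?thesis using bl by blast
qed

section \<open>Pipes as lists of boxes\<close>

text \<open>The boxes from row \<open>i\<close> up to the exit row \<open>e\<close>. With
  \<open>c (e - 1) = Suc n\<close> the last entry is the position \<open>(e, Suc n)\<close> outside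
  the grid, as the encoding of pipes demands.\<close>

fun path :: "(nat \<Rightarrow> nat) \<Rightarrow> nat \<Rightarrow> nat \<Rightarrow> (nat \<times> nat) list" where
  "path c e i = map (Pair i) [c i..<Suc (c (i - 1))] @ (if e < i then path c e (i - 1) else [])"

declare path.simps [simp del]

lemma steps_Cons: "steps (x # y # zs) = insert (x, y) (steps (y # zs))"
  by (simp add: steps_def)

lemma steps_single [simp]: "steps [x] = {}" "steps [] = {}"
  by (simp_all add: steps_def)

lemma steps_append:
  "xs \<noteq> [] \<Longrightarrow> ys \<noteq> [] \<Longrightarrow> steps (xs @ ys) = steps xs \<union> steps ys \<union> {(last xs, hd ys)}"
proof (induction xs rule: induct_list012)
  case (2 x)
  then show ?case by (cases ys) (auto simp: steps_Cons)
next
  case (3 x y zs)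
  then show ?case by (auto simp: steps_Cons)
qed simp

lemma steps_row: "steps (map (Pair i) [p..<Suc q]) = {((i, j), (i, Suc j)) |j. p \<le> j \<and> j < q}"
proof (induction q)
  case 0
  then show ?case by (cases p) auto
next
  case (Suc q)
  show ?case
  proof (cases "p \<le> q")
    case True
    then have "map (Pair i) [p..<Suc (Suc q)] = map (Pair i) [p..<Suc q] @ [(i, Suc q)]" by simp
    then have "steps (map (Pair i) [p..<Suc (Suc q)]) =
      steps (map (Pair i) [p..<Suc q]) \<union> {((i, q), (i, Suc q))}"
      using True steps_append[of "map (Pair i) [p..<Suc q]" "[(i, Suc q)]"] by simp
    then show ?thesis using Suc True by (auto simp: less_Suc_eq simp del: upt_Suc)
  next
    case False
    then have "steps (map (Pair i) [p..<Suc (Suc q)]) = {}" by (cases "p = Suc q") simp_all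
    then show ?thesis using False by auto
  qed
qed

lemma path_base: "path c e e = map (Pair e) [c e..<Suc (c (e - 1))]"
  by (subst path.simps) simp

lemma path_step: "e < i \<Longrightarrow> path c e i = map (Pair i) [c i..<Suc (c (i - 1))] @ path c e (i - 1)"
  by (subst path.simps) simp

lemma path_cong: "(\<And>r. e - 1 \<le> r \<Longrightarrow> r \<le> i \<Longrightarrow> c r = d r) \<Longrightarrow> e \<le> i \<Longrightarrow> path c e i = path d e i"
proof (induction i rule: less_induct)
  case (less i)
  show ?case
  proof (cases "e < i")
    case True
    then have "path c e (i - 1) = path d e (i - 1)" using less by (intro less.IH) auto
    then show ?thesis using True less.prems by (simp add: path_step)
  next
    case False
    then have "i = e" using less.prems by simp
    then show ?thesis using less.prems by (simp add: path_base)
  qed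
qed

context
  fixes c :: "nat \<Rightarrow> nat" and e n :: nat
  assumes e: "0 < e" and mono: "\<And>r. e \<le> r \<Longrightarrow> r \<le> n \<Longrightarrow> c r \<le> c (r - 1)"
begin

lemma path_ends:
  assumes "e \<le> i" "i \<le> n"
  shows "path c e i \<noteq> []" "hd (path c e i) = (i, c i)" "last (path c e i) = (e, c (e - 1))"
proof -
  have nonempty: "[c i..<Suc (c (i - 1))] \<noteq> []" "hd [c i..<Suc (c (i - 1))] = c i" "last [c i..<Suc (c (i - 1))] = c (i - 1)"
    if "e \<le> i" "i \<le> n" for i
    using mono[OF that] upt_conv_Cons[of "c i" "Suc (c (i - 1))"] by simp_all
  show "path c e i \<noteq> []" "hd (path c e i) = (i, c i)"
    using nonempty[OF assms] by (subst path.simps, simp add: hd_map del: upt_Suc)+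
  show "last (path c e i) = (e, c (e - 1))"
    using assms
  proof (induction i rule: dec_induct)
    case base
    then show ?case using nonempty[of e] by (simp add: path_base last_map del: upt_Suc)
  next
    case (step i)
    have "path c e i \<noteq> []" using nonempty[of i] step by (subst path.simps) (simp del: upt_Suc)
    then show ?case using step by (simp add: path_step)
  qed
qed

lemma set_path:
  assumes "e \<le> i" "i \<le> n"
  shows "set (path c e i) = {(r, j). e \<le> r \<and> r \<le> i \<and> c r \<le> j \<and> j \<le> c (r - 1)}"
  using assms
proof (induction i rule: dec_induct)
  case base
  then show ?case by (auto simp: path_base)
next
  case (step i)
  then show ?case by (auto simp: path_step le_Suc_eq simp del: upt_Suc)
qed

lemma steps_path:
  assumes "e \<le> i" "i \<le> n"
  shows "steps (path c e i) = {((Suc r, c r), (r, c r)) |r. e \<le> r \<and> r < i} \<union>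
    {((r, j), (r, Suc j)) |r j. e \<le> r \<and> r \<le> i \<and> c r \<le> j \<and> j < c (r - 1)}"
  using assms
proof (induction i rule: dec_induct)
  case base
  then show ?case by (auto simp: path_base steps_row simp del: upt_Suc)
next
  case (step i)
  let ?row = "map (Pair (Suc i)) [c (Suc i)..<Suc (c i)]"
  have row: "?row \<noteq> []" "last ?row = (Suc i, c i)"
    using mono[of "Suc i"] step by (auto simp: last_map)
  have "steps (path c e (Suc i)) = steps ?row \<union> steps (path c e i) \<union> {((Suc i, c i), (i, c i))}"
    using steps_append[OF row(1), of "path c e i"] path_ends[of i] row(2) step by (simp add: path_step del: upt_Suc)
  also have "\<dots> = {((Suc r, c r), (r, c r)) |r. e \<le> r \<and> r < Suc i} \<union>
    {((r, j), (r, Suc j)) |r j. e \<le> r \<and> r \<le> Suc i \<and> c r \<le> j \<and> j < c (r - 1)}"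
    using step unfolding steps_row step.IH[OF Suc_leD[OF step.prems]]
    by (auto simp: less_Suc_eq le_Suc_eq)
  finally show ?case .
qed

lemma ne_step_path:
  assumes "e \<le> i" "i \<le> n"
  shows "successively ne_step (path c e i)"
proof -
  have row: "successively ne_step (map (Pair r) [p..<q])" for r p q
    by (auto simp: successively_conv_nth ne_step_def)
  show ?thesis
    using assms
  proof (induction i rule: dec_induct)
    case base
    then show ?case by (simp add: path_base row del: upt_Suc)
  next
    case (step i)
    let ?row = "map (Pair (Suc i)) [c (Suc i)..<Suc (c i)]"
    have "last ?row = (Suc i, c i)"
      using mono[of "Suc i"] step by (auto simp: last_map)
    then have "ne_step (last ?row) (hd (path c e i))"
      using path_ends(2)[of i] step by (simp add: ne_step_def del: upt_Suc)
    then show ?case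
      using step row[of "Suc i"] by (simp add: path_step successively_append_iff del: upt_Suc)
  qed
qed

lemma set_butlast_path:
  assumes "e \<le> i" "i \<le> n" "c (e - 1) = Suc m" "\<And>r. e \<le> r \<Longrightarrow> r \<le> n \<Longrightarrow> 0 < c r \<and> c r \<le> m"
  shows "set (butlast (path c e i)) \<subseteq> {e..i} \<times> {1..m}"
  using assms(1,2)
proof (induction i rule: dec_induct)
  case base
  have "butlast (path c e e) = map (Pair e) [c e..<Suc m]"
    using assms(3) assms(4)[of e] base by (simp add: path_base butlast_append)
  then show ?case using assms(4)[of e] base by auto
next
  case (step i)
  then have "butlast (path c e (Suc i)) = map (Pair (Suc i)) [c (Suc i)..<Suc (c i)] @ butlast (path c e i)"
    using path_ends(1)[of i] by (simp add: path_step butlast_append del: upt_Suc)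
  then show ?case using step assms(4)[of i] assms(4)[of "Suc i"] by (auto simp del: upt_Suc)
qed

end

lemma steps_butlast: "(x, y) \<in> steps p \<Longrightarrow> x \<in> set (butlast p)"
proof (induction p rule: induct_list012)
  case (3 u v zs)
  then show ?case by (auto simp: steps_Cons)
qed auto

text \<open>Induction from the front of the list: an east step lowers the entry column
  \<open>c i\<close> of the current row by one, and a north step adds a row consisting of a single
  box.\<close>

lemma ne_path_exists:
  assumes "successively ne_step ((i, j) # q)" "last ((i, j) # q) = (e, N)" "0 < e"
  shows "\<exists>c. c i = j \<and> (i, j) # q = path c e i \<and> c (e - 1) = N \<and> e \<le> i \<and> (\<forall>r. e \<le> r \<longrightarrow> r \<le> i \<longrightarrow> c r \<le> c (r - 1))"
  using assms
proof (induction q arbitrary: i j)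
  case Nil
  then show ?case by (intro exI[of _ "\<lambda>_. j"]) (simp add: path_base)
next
  case (Cons x q)
  obtain i' j' where x: "x = (i', j')" by force
  have st: "ne_step (i, j) (i', j')" "successively ne_step ((i', j') # q)" using Cons.prems x by auto
  have "last ((i', j') # q) = (e, N)" using Cons.prems x by simp
  from Cons.IH[OF st(2) this Cons.prems(3)] obtain c where c: "c i' = j'" "(i', j') # q = path c e i'"
    "c (e - 1) = N" "e \<le> i'" "\<forall>r. e \<le> r \<longrightarrow> r \<le> i' \<longrightarrow> c r \<le> c (r - 1)" by blast
  define d where "d = c(i := j)"
  consider (east) "i' = i" "j' = Suc j" | (north) "i = Suc i'" "j' = j" using st(1) by (auto simp: ne_step_def)
  then show ?case
  proof cases
    case east
    have ei: "0 < i" "e \<le> i" using c(4) Cons.prems(3) east by auto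
    have cle: "Suc j \<le> c (i - 1)" using c(1,4,5) east by auto
    have "path d e i = (i, j) # path c e i"
    proof (cases "e < i")
      case True
      have "path d e (i - 1) = path c e (i - 1)" using True by (intro path_cong) (auto simp: d_def)
      moreover have "[d i..<Suc (d (i - 1))] = j # [c i..<Suc (c (i - 1))]"
        using cle c(1) east ei by (simp add: d_def upt_conv_Cons)
      ultimately show ?thesis using True by (simp add: path_step del: upt_Suc)
    next
      case False
      then have "i = e" using ei by simp
      moreover have "[d i..<Suc (d (i - 1))] = j # [c i..<Suc (c (i - 1))]"
        using cle c(1) east ei by (simp add: d_def upt_conv_Cons)
      ultimately show ?thesis by (simp add: path_base del: upt_Suc)
    qed
    moreover have "d r \<le> d (r - 1)" if "e \<le> r" "r \<le> i" for r
      using c(1,5) that east cle Cons.prems(3) ei by (cases "r = i") (auto simp: d_def)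
    moreover have "d i = j" "d (e - 1) = N" using c ei Cons.prems(3) by (auto simp: d_def)
    ultimately show ?thesis using c x east ei by (intro exI[of _ d]) auto
  next
    case north
    have "path d e i' = path c e i'" using north c(4) by (intro path_cong) (auto simp: d_def)
    then have "path d e i = (i, j) # path c e i'"
      using c(1,4) north by (simp add: path_step d_def)
    moreover have "d r \<le> d (r - 1)" if "e \<le> r" "r \<le> i" for r
      using c(1,5) that north by (cases "r = i") (auto simp: d_def)
    moreover have "d i = j" "d (e - 1) = N" "e \<le> i" using c north by (auto simp: d_def)
    ultimately show ?thesis using c x north by (intro exI[of _ d]) auto
  qed
qed

definition make_pipes :: "nat \<Rightarrow> (nat \<Rightarrow> nat) \<Rightarrow> (nat \<Rightarrow> nat \<Rightarrow> nat) \<Rightarrow> nat \<Rightarrow> pipe" where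
  "make_pipes n w C = restrict (\<lambda>k. (Suc n, k) # path (\<lambda>i. C i k) (inv w k) n) {1..n}"

lemma crossings_commute: "crossings n P k l = crossings n P l k"
  unfolding crossings_def insert_commute[of k l "{}"] ..

text \<open>The conditions of \<^const>\<open>pipe_columns\<close> on single pipes.\<close>

locale columns =
  fixes n :: nat and w :: "nat \<Rightarrow> nat" and C :: "nat \<Rightarrow> nat \<Rightarrow> nat"
  assumes w: "w permutes {1..n}"
    and zero: "n < i \<or> k \<notin> {1..n} \<Longrightarrow> C i k = 0"
    and start: "k \<in> {1..n} \<Longrightarrow> C n k = k"
    and mono: "i < n \<Longrightarrow> k \<in> {1..n} \<Longrightarrow> C (Suc i) k \<le> C i k"
    and le: "i \<le> n \<Longrightarrow> k \<in> {1..n} \<Longrightarrow> C i k \<le> Suc n"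
    and exit: "i \<le> n \<Longrightarrow> k \<in> {1..n} \<Longrightarrow> C i k = Suc n \<longleftrightarrow> i < inv w k"
begin

lemma inv_in: "k \<in> {1..n} \<Longrightarrow> inv w k \<in> {1..n}"
  using permutes_in_image[OF permutes_inv[OF w]] by simp

lemma active: "i \<le> n \<Longrightarrow> k \<in> {1..n} \<Longrightarrow> C i k \<le> n \<longleftrightarrow> inv w k \<le> i"
  using exit[of i k] le[of i k] by linarith

lemma positive: "i \<le> n \<Longrightarrow> k \<in> {1..n} \<Longrightarrow> 0 < C i k"
proof (induction i rule: inc_induct)
  case base then show ?case using start[of k] by simp
next
  case (step i) then show ?case using mono[of i k] by simp
qed

lemma path_mono: "k \<in> {1..n} \<Longrightarrow> inv w k \<le> r \<Longrightarrow> r \<le> n \<Longrightarrow> C r k \<le> C (r - 1) k"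
  using mono[of "r - 1" k] inv_in[of k] by (cases r) auto

lemma pipe: "k \<in> {1..n} \<Longrightarrow> make_pipes n w C k = (Suc n, k) # path (\<lambda>i. C i k) (inv w k) n"
  by (simp add: make_pipes_def)

lemma exit_column: "k \<in> {1..n} \<Longrightarrow> C (inv w k - 1) k = Suc n"
  using inv_in[of k] exit[of "inv w k - 1" k] by auto

lemma is_pipe_make_pipes:
  assumes k: "k \<in> {1..n}"
  shows "is_pipe n k (inv w k) (make_pipes n w C k)"
proof -
  let ?c = "\<lambda>i. C i k" and ?e = "inv w k"
  let ?p = "path ?c ?e n"
  have e: "0 < ?e" "?e \<le> n" using inv_in[OF k] by auto
  note ends = path_ends[where c = "\<lambda>i. C i k", OF e(1) path_mono[OF k] e(2) order_refl]
  have sub: "set (butlast ?p) \<subseteq> {?e..n} \<times> {1..n}"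
    by (rule set_butlast_path[where c = "\<lambda>i. C i k", OF e(1) path_mono[OF k] e(2) order_refl])
      (use exit_column[OF k] positive[OF _ k] active[OF _ k] in auto)
  have "?p = butlast ?p @ [(?e, Suc n)]"
    using ends(1,3) exit_column[OF k] append_butlast_last_id[of ?p] by simp
  then have "make_pipes n w C k = (Suc n, k) # butlast ?p @ [(?e, Suc n)]" by (simp add: pipe[OF k])
  moreover have "set (butlast ?p) \<subseteq> grid n" using sub e by (force simp: grid_def)
  moreover have "successively ne_step (make_pipes n w C k)"
    using ne_step_path[where c = "\<lambda>i. C i k", OF e(1) path_mono[OF k] e(2) order_refl] ends(1,2) start[OF k]
    by (cases ?p) (auto simp: pipe[OF k] ne_step_def)
  ultimately show ?thesis unfolding is_pipe_def by blast
qed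

text \<open>This turns the four predicates for entering and leaving a box, and with them all tiles,
  into inequalities between columns.\<close>

lemma steps_make_pipes:
  assumes k: "k \<in> {1..n}"
  shows "steps (make_pipes n w C k) = {((Suc r, C r k), (r, C r k)) |r. inv w k \<le> r \<and> r \<le> n} \<union>
    {((r, j), (r, Suc j)) |r j. inv w k \<le> r \<and> r \<le> n \<and> C r k \<le> j \<and> j < C (r - 1) k}"
proof -
  let ?c = "\<lambda>i. C i k" and ?e = "inv w k"
  let ?p = "path ?c ?e n"
  have e: "0 < ?e" "?e \<le> n" using inv_in[OF k] by auto
  note ends = path_ends[where c = "\<lambda>i. C i k", OF e(1) path_mono[OF k] e(2) order_refl]
  have "steps (make_pipes n w C k) = insert ((Suc n, k), (n, k)) (steps ?p)"
    using ends(1,2) start[OF k] by (cases ?p) (auto simp: pipe[OF k] steps_Cons)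
  also have "steps ?p = {((Suc r, C r k), (r, C r k)) |r. ?e \<le> r \<and> r < n} \<union>
    {((r, j), (r, Suc j)) |r j. ?e \<le> r \<and> r \<le> n \<and> C r k \<le> j \<and> j < C (r - 1) k}"
    by (rule steps_path[where c = "\<lambda>i. C i k", OF e(1) path_mono[OF k] e(2) order_refl])
  also have "insert ((Suc n, k), (n, k)) \<dots> = {((Suc r, C r k), (r, C r k)) |r. ?e \<le> r \<and> r \<le> n} \<union>
    {((r, j), (r, Suc j)) |r j. ?e \<le> r \<and> r \<le> n \<and> C r k \<le> j \<and> j < C (r - 1) k}"
    using e start[OF k] by (auto simp: le_less)
  finally show ?thesis .
qed

lemma enters_south_iff:
  "k \<in> {1..n} \<Longrightarrow> i \<le> n \<Longrightarrow> j \<le> n \<Longrightarrow> enters_south (make_pipes n w C k) (i, j) \<longleftrightarrow> j = C i k"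
  using active[of i k] by (auto simp: enters_south_def steps_make_pipes)

lemma enters_west_iff:
  "k \<in> {1..n} \<Longrightarrow> i \<le> n \<Longrightarrow> j \<le> n \<Longrightarrow> enters_west (make_pipes n w C k) (i, j) \<longleftrightarrow> C i k < j \<and> j \<le> C (i - 1) k"
  using active[of i k] by (cases j) (auto simp: enters_west_def steps_make_pipes)

lemma exits_north_iff:
  "k \<in> {1..n} \<Longrightarrow> i \<in> {1..n} \<Longrightarrow> j \<le> n \<Longrightarrow> exits_north (make_pipes n w C k) (i, j) \<longleftrightarrow> j = C (i - 1) k"
  using active[of "i - 1" k] by (cases i) (auto simp: exits_north_def steps_make_pipes)

lemma exits_east_iff:
  "k \<in> {1..n} \<Longrightarrow> i \<le> n \<Longrightarrow> j \<le> n \<Longrightarrow> exits_east (make_pipes n w C k) (i, j) \<longleftrightarrow> C i k \<le> j \<and> j < C (i - 1) k"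
  using active[of i k] by (auto simp: exits_east_def steps_make_pipes)

lemma pipes_through_iff:
  assumes "i \<in> {1..n}" "j \<in> {1..n}"
  shows "k \<in> pipes_through n (make_pipes n w C) (i, j) \<longleftrightarrow> k \<in> {1..n} \<and> C i k \<le> j \<and> j \<le> C (i - 1) k"
proof (cases "k \<in> {1..n}")
  case True
  have e: "0 < inv w k" "inv w k \<le> n" using inv_in[OF True] by auto
  show ?thesis
    using True assms active[of i k] set_path[where c = "\<lambda>i. C i k", OF e(1) path_mono[OF True] e(2) order_refl]
    by (auto simp: pipes_through_def pipe)
qed (auto simp: pipes_through_def)

lemma empty_boxes_make_pipes: "empty_boxes n (make_pipes n w C) = blanks n C"
proof -
  have "pipes_through n (make_pipes n w C) (i, j) = {} \<longleftrightarrow> \<not> covered n C i j"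
    if "(i, j) \<in> grid n" for i j
    using pipes_through_iff[of i j] that by (auto simp: grid_def covered_def)
  then show ?thesis by (auto simp: empty_boxes_def blanks_def)
qed

text \<open>If \<open>k\<close> does not stay to the left of \<open>l\<close>, then both pass
  through the box in which \<open>l\<close> enters the row. Two pipes in a box form a crossing tile,
  and \<open>l\<close>, coming from the south, is its vertical pipe.\<close>

lemma bumpless_imp_pipe_columns:
  assumes P: "bumpless_pipedream n w (make_pipes n w C)"
  shows "pipe_columns n w C"
proof -
  let ?P = "make_pipes n w C"
  have disj: "steps (?P k) \<inter> steps (?P l) = {}" and card: "card (crossings n ?P k l) \<le> 1"
    if "k \<in> {1..n}" "l \<in> {1..n}" "k \<noteq> l" for k l
    using P that unfolding bumpless_pipedream_def by blast+
  have tile: "\<exists>t. has_tile n ?P b t" if "b \<in> grid n" for b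
    using P that unfolding bumpless_pipedream_def by blast
  have inj: "C i k \<noteq> C i l" if kl: "k \<in> {1..n}" "l \<in> {1..n}" "k \<noteq> l" "i \<le> n" "C i k \<le> n" for i k l
  proof
    assume eq: "C i k = C i l"
    have "((Suc i, C i k), (i, C i k)) \<in> steps (?P k)" "((Suc i, C i k), (i, C i k)) \<in> steps (?P l)"
      using kl eq active[of i k] active[of i l] by (auto simp: steps_make_pipes)
    then show False using disj[OF kl(1-3)] by blast
  qed
  have weak: "C i k < C (Suc i) l \<or> (C i l = C (Suc i) l \<and> C i l < C i k \<and> (Suc i, C i l) \<in> crossings n ?P k l)"
    if kl: "i < n" "k \<in> {1..n}" "l \<in> {1..n}" "C (Suc i) k < C (Suc i) l" "C (Suc i) l \<le> n" for i k l
  proof (cases "C i k < C (Suc i) l")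
    case False
    define j where "j = C (Suc i) l"
    have b: "(Suc i, j) \<in> grid n" "Suc i \<in> {1..n}" "j \<in> {1..n}" "Suc i \<le> n" "j \<le> n"
      using kl by (auto simp: grid_def j_def)
    have kin: "k \<in> pipes_through n ?P (Suc i, j)" and lin: "l \<in> pipes_through n ?P (Suc i, j)"
      using pipes_through_iff[OF b(2,3)] kl False mono[of i l] by (auto simp: j_def)
    have "k \<noteq> l" using kl by auto
    then have not1: "pipes_through n ?P (Suc i, j) \<noteq> {m}" for m using kin lin by auto
    obtain t where t: "has_tile n ?P (Suc i, j) t" using tile[OF b(1)] by blast
    then have "t = Crossing" using kin not1 by (cases t) auto
    then have "has_tile n ?P (Suc i, j) Crossing" using t by simp
    then obtain k' l' where kl': "pipes_through n ?P (Suc i, j) = {k', l'}" "k' \<noteq> l'"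
      "enters_west (?P k') (Suc i, j)" "exits_east (?P k') (Suc i, j)"
      "enters_south (?P l') (Suc i, j)" "exits_north (?P l') (Suc i, j)" by auto
    have "\<not> enters_west (?P l) (Suc i, j)" using enters_west_iff[OF kl(3) b(4,5)] by (simp add: j_def)
    then have "l \<noteq> k'" using kl'(3) by auto
    then have eq: "l' = l" "k' = k" using kl'(1) kin lin \<open>k \<noteq> l\<close> by auto
    have "C i l = j" using exits_north_iff[OF kl(3) b(2,5)] kl'(6) eq by simp
    moreover have "j < C i k" using exits_east_iff[OF kl(2) b(4,5)] kl'(4) eq by simp
    moreover have "(Suc i, j) \<in> crossings n ?P k l"
      using b(1) \<open>has_tile n ?P (Suc i, j) Crossing\<close> kl'(1) eq by (simp add: crossings_def)
    ultimately show ?thesis by (simp add: j_def)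
  qed simp
  have order: "k < l"
    if kl: "i < n" "k \<in> {1..n}" "l \<in> {1..n}" "C (Suc i) k < C (Suc i) l" "C (Suc i) l \<le> n"
      "(Suc i, C i l) \<in> crossings n ?P k l" for i k l
  proof (rule ccontr)
    assume "\<not> k < l"
    moreover have "k \<noteq> l" using kl by auto
    ultimately have lk: "l < k" by simp
    have act: "C r l \<le> n" "C r k \<le> n" if "Suc i \<le> r" "r \<le> n" for r
      using active[of "Suc i" l] active[of r l] active[of "Suc i" k] active[of r k] kl that by auto
    \<comment> \<open>Pipe \<open>l\<close> starts to the left of \<open>k\<close> but is to its
      right at boundary \<open>Suc i\<close>. Where this order flips there is another crossing, in a
      lower row.\<close>
    have "\<exists>r. Suc i \<le> r \<and> r < n \<and> C (Suc r) l < C (Suc r) k \<and> \<not> C r l < C r k"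
    proof (rule ccontr)
      assume neg: "\<not> (\<exists>r. Suc i \<le> r \<and> r < n \<and> C (Suc r) l < C (Suc r) k \<and> \<not> C r l < C r k)"
      have "C r l < C r k" if "Suc i \<le> r" "r \<le> n" for r
        using that(2,1)
      proof (induction r rule: inc_induct)
        case base then show ?case using start[OF kl(2)] start[OF kl(3)] lk by simp
      next
        case (step r) then show ?case using neg by simp
      qed
      from this[of "Suc i"] show False using kl by simp
    qed
    then obtain r where r: "Suc i \<le> r" "r < n" "C (Suc r) l < C (Suc r) k" "\<not> C r l < C r k" by blast
    have "(Suc r, C r k) \<in> crossings n ?P l k"
      using weak[OF r(2) kl(3,2) r(3)] act(2)[of "Suc r"] r mono[OF r(2) kl(2)] by auto
    then have "(Suc r, C r k) \<in> crossings n ?P k l" unfolding crossings_commute[of n ?P k l] .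
    then have "{(Suc r, C r k), (Suc i, C i l)} \<subseteq> crossings n ?P k l" using kl(6) by simp
    moreover have "finite (crossings n ?P k l)"
      by (rule finite_subset[of _ "grid n"]) (auto simp: crossings_def grid_def)
    ultimately have "card {(Suc r, C r k), (Suc i, C i l)} \<le> 1"
      using card[OF kl(2,3) \<open>k \<noteq> l\<close>] card_mono by (meson le_trans)
    then show False using r by simp
  qed
  show ?thesis
    unfolding pipe_columns_def
  proof (intro conjI allI ballI impI)
    show "C i k < C (Suc i) l \<or> k < l \<and> C i l = C (Suc i) l \<and> C i l < C i k"
      if "i < n" "k \<in> {1..n}" "l \<in> {1..n}" "C (Suc i) k < C (Suc i) l" "C (Suc i) l \<le> n" for i k l
      using weak[OF that] order[OF that] by blast
  qed (use zero start mono le exit in blast)+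
qed

lemma pipe_columns_imp_bumpless:
  assumes pc: "pipe_columns n w C"
  shows "bumpless_pipedream n w (make_pipes n w C)"
proof -
  let ?P = "make_pipes n w C"
  have row: "C (i - 1) k < C i l \<or> (k < l \<and> C (i - 1) l = C i l \<and> C (i - 1) l < C (i - 1) k)"
    if "i \<in> {1..n}" "k \<in> {1..n}" "l \<in> {1..n}" "C i k < C i l" "C i l \<le> n" for i k l
  proof -
    have "i - 1 < n" "Suc (i - 1) = i" using that(1) by auto
    then show ?thesis using pc_row[OF pc, of "i - 1" k l] that by simp
  qed
  have no_step: "\<not> (C i k \<le> j \<and> j < C (i - 1) k \<and> C i l \<le> j \<and> j < C (i - 1) l)"
    if "i \<in> {1..n}" "k \<in> {1..n}" "l \<in> {1..n}" "C i k < C i l" "C i l \<le> n" for i j k l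
    using row[OF that] by linarith
  have disj: "steps (?P k) \<inter> steps (?P l) = {}" if kl: "k \<in> {1..n}" "l \<in> {1..n}" "k \<noteq> l" for k l
  proof -
    have north: False if "inv w k \<le> r" "r \<le> n" "C r k = C r l" for r
      using pc_inj[OF pc kl, of r] active[of r k] that kl by auto
    have east: False if "inv w k \<le> r" "inv w l \<le> r" "r \<le> n" "C r k \<le> j" "j < C (r - 1) k" "C r l \<le> j" "j < C (r - 1) l" for r j
    proof -
      have r: "r \<in> {1..n}" "C r k \<le> n" "C r l \<le> n" using that inv_in[OF kl(1)] active[of r] kl by auto
      have "C r k \<noteq> C r l" using pc_inj[OF pc kl, of r] r by simp
      then show False using no_step[OF r(1) kl(1,2), of j] no_step[OF r(1) kl(2,1), of j] r that by linarith
    qed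
    show ?thesis using north east by (auto simp: steps_make_pipes[OF kl(1)] steps_make_pipes[OF kl(2)])
  qed
  have card: "card (crossings n ?P k l) \<le> 1" if kl: "k \<in> {1..n}" "l \<in> {1..n}" "k < l" for k l
  proof -
    have cross: "C i k < j \<and> j < C (i - 1) k \<and> C i l = j \<and> C (i - 1) l = j" if ij: "(i, j) \<in> crossings n ?P k l" for i j
    proof -
      have b: "i \<in> {1..n}" "j \<in> {1..n}" "i \<le> n" "j \<le> n" using ij by (auto simp: crossings_def grid_def)
      have c: "has_tile n ?P (i, j) Crossing" "pipes_through n ?P (i, j) = {k, l}"
        using ij unfolding crossings_def by blast+
      obtain k' l' where thr: "pipes_through n ?P (i, j) = {k', l'}" and kl': "k' \<noteq> l'"
        "enters_west (?P k') (i, j)" "exits_east (?P k') (i, j)"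
        "enters_south (?P l') (i, j)" "exits_north (?P l') (i, j)" using c(1)[unfolded has_tile.simps] by blast
      have kl_eq: "{k, l} = {k', l'}" using c(2) thr by simp
      have in': "k' \<in> {1..n}" "l' \<in> {1..n}" using kl_eq kl by (auto simp: doubleton_eq_iff)
      have *: "C i k' < j" "j < C (i - 1) k'" "C i l' = j" "C (i - 1) l' = j"
        using kl' enters_west_iff[OF in'(1) b(3,4)] exits_east_iff[OF in'(1) b(3,4)]
          enters_south_iff[OF in'(2) b(3,4)] exits_north_iff[OF in'(2) b(1,4)] by auto
      then have "k' < l'" using row[OF b(1) in'] b by auto
      then have "k' = k" "l' = l" using kl_eq kl(3) by (auto simp: doubleton_eq_iff)
      with * show ?thesis by simp
    qed
    \<comment> \<open>Above a crossing, \<open>l\<close> stays to the left of \<open>k\<close>,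
      whereas a second crossing would need \<open>k\<close> to enter its row left of
      \<open>l\<close>.\<close>
    have one: "i1 = i2" if "(i1, j1) \<in> crossings n ?P k l" "(i2, j2) \<in> crossings n ?P k l" "i2 \<le> i1" for i1 i2 j1 j2
    proof (rule ccontr)
      assume "i1 \<noteq> i2"
      then have i: "i2 \<le> i1 - 1" "i1 - 1 \<le> n" using that by (auto simp: crossings_def grid_def)
      have "j2 \<le> n" using that by (auto simp: crossings_def grid_def)
      then have "C i2 k \<le> n" using cross[OF that(2)] by simp
      moreover have "C (i1 - 1) l < C (i1 - 1) k" using cross[OF that(1)] by simp
      ultimately have "C i2 l < C i2 k" using pc_crossed[OF pc kl i] by simp
      then show False using cross[OF that(2)] by simp
    qed
    have "b1 = b2" if b: "b1 \<in> crossings n ?P k l" "b2 \<in> crossings n ?P k l" for b1 b2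
    proof -
      obtain i1 j1 i2 j2 where ij: "b1 = (i1, j1)" "b2 = (i2, j2)" by (cases b1, cases b2) auto
      then have "i1 = i2" using one[of i1 j1 i2 j2] one[of i2 j2 i1 j1] b by (metis nle_le)
      moreover have "C i1 l = j1" "C i2 l = j2" using cross b ij by auto
      ultimately show ?thesis using ij by simp
    qed
    moreover have "finite (crossings n ?P k l)"
      by (rule finite_subset[of _ "grid n"]) (auto simp: crossings_def grid_def)
    ultimately show ?thesis by (simp add: card_le_Suc0_iff_eq)
  qed
  have card': "card (crossings n ?P k l) \<le> 1" if "k \<in> {1..n}" "l \<in> {1..n}" "k \<noteq> l" for k l
  proof (cases "k < l")
    case False
    then show ?thesis using card[of l k] that crossings_commute[of n ?P k l] by simp
  qed (use card that in simp)
  have tile: "\<exists>t. has_tile n ?P (i, j) t" if ij: "(i, j) \<in> grid n" for i j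
  proof -
    have b: "i \<in> {1..n}" "j \<in> {1..n}" "i \<le> n" "j \<le> n" using ij by (auto simp: grid_def)
    let ?S = "pipes_through n ?P (i, j)"
    note through = pipes_through_iff[OF b(1,2)]
    consider "?S = {}" | k where "?S = {k}" | k l where "k \<in> ?S" "l \<in> ?S" "k \<noteq> l" by blast
    then show ?thesis
    proof cases
      case 1 then have "has_tile n ?P (i, j) Blank" by simp
      then show ?thesis by blast
    next
      case (2 k)
      then have k: "k \<in> {1..n}" "C i k \<le> j" "j \<le> C (i - 1) k" using through[of k] by auto
      note iffs = enters_west_iff[OF k(1) b(3,4)] exits_east_iff[OF k(1) b(3,4)]
        enters_south_iff[OF k(1) b(3,4)] exits_north_iff[OF k(1) b(1,4)]
      consider "C i k = j" "j = C (i - 1) k" | "C i k = j" "j < C (i - 1) k"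
        | "C i k < j" "j = C (i - 1) k" | "C i k < j" "j < C (i - 1) k" using k by linarith
      then show ?thesis
      proof cases
        case 1 then have "has_tile n ?P (i, j) Vertical" using 2 iffs by auto
        then show ?thesis by blast
      next
        case 2 then have "has_tile n ?P (i, j) SE_Elbow" using \<open>?S = {k}\<close> iffs by auto
        then show ?thesis by blast
      next
        case 3 then have "has_tile n ?P (i, j) NW_Elbow" using \<open>?S = {k}\<close> iffs by auto
        then show ?thesis by blast
      next
        case 4 then have "has_tile n ?P (i, j) Horizontal" using \<open>?S = {k}\<close> iffs by auto
        then show ?thesis by blast
      qed
    next
      case (3 k l)
      have inj: "C i x \<noteq> C i y" if "x \<in> ?S" "y \<in> ?S" "x \<noteq> y" for x y
        using pc_inj[OF pc _ _ that(3) b(3)] through[of x] through[of y] that b by auto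
      have two: "C i y = j \<and> C (i - 1) y = j \<and> C i x < j \<and> j < C (i - 1) x"
        if "x \<in> ?S" "y \<in> ?S" "C i x < C i y" for x y
        using row[OF b(1), of x y] through[of x] through[of y] that b by auto
      obtain x y where xy: "x \<in> ?S" "y \<in> ?S" "C i x < C i y" "x \<noteq> y"
        using 3 inj[of k l] by (metis linorder_neqE_nat)
      \<comment> \<open>Of two pipes in the box the one further right enters from the south in
        column \<open>j\<close>. A third pipe would give two pipes entering there, or make
        \<open>x\<close> do so.\<close>
      have "z = x \<or> z = y" if z: "z \<in> ?S" for z
      proof (rule ccontr)
        assume ne: "\<not> (z = x \<or> z = y)"
        then have "C i z \<noteq> C i x" "C i z \<noteq> C i y" using inj[of z x] inj[of z y] z xy by auto
        then show False using two[OF xy(1-3)] two[of z x] two[of x z] z xy by linarith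
      qed
      then have S: "?S = {x, y}" using xy by blast
      have in': "x \<in> {1..n}" "y \<in> {1..n}" using through xy by auto
      have "has_tile n ?P (i, j) Crossing"
        using S xy(4) two[OF xy(1-3)] enters_west_iff[OF in'(1) b(3,4)] exits_east_iff[OF in'(1) b(3,4)]
          enters_south_iff[OF in'(2) b(3,4)] exits_north_iff[OF in'(2) b(1,4)]
        unfolding has_tile.simps by (intro exI[of _ x] exI[of _ y]) auto
      then show ?thesis by blast
    qed
  qed
  show ?thesis
    unfolding bumpless_pipedream_def
  proof (intro conjI ballI impI)
    show "?P \<in> extensional {1..n}" by (simp add: make_pipes_def)
    show "is_pipe n k (inv w k) (?P k)" if "k \<in> {1..n}" for k by (rule is_pipe_make_pipes[OF that])
    show "steps (?P k) \<inter> steps (?P l) = {}" "card (crossings n ?P k l) \<le> 1"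
      if "k \<in> {1..n}" "l \<in> {1..n}" "k \<noteq> l" for k l using disj card' that by auto
    show "\<exists>t. has_tile n ?P b t" if "b \<in> grid n" for b using tile that by (cases b) auto
  qed
qed

end

lemma columns_if_pipe_columns:
  assumes "w permutes {1..n}" "pipe_columns n w C"
  shows "columns n w C"
  using assms(1) pipe_columnsD[OF assms(2)] by unfold_locales

lemma make_pipes_inject:
  assumes C: "columns n w C" and D: "columns n w D" and eq: "make_pipes n w C = make_pipes n w D"
  shows "C = D"
proof (intro ext)
  fix i k
  show "C i k = D i k"
  proof (cases "i \<le> n \<and> k \<in> {1..n}")
    case True
    then have ik: "i \<le> n" "k \<in> {1..n}" by auto
    show ?thesis
    proof (cases "C i k \<le> n")
      case True
      then show ?thesis
        using columns.enters_south_iff[OF C ik(2,1) True] columns.enters_south_iff[OF D ik(2,1) True] eq by simp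
    next
      case False
      then show ?thesis
        using columns.active[OF C ik] columns.active[OF D ik] columns.le[OF C ik] columns.le[OF D ik] by linarith
    qed
  next
    case False
    then show ?thesis using columns.zero[OF C, of i k] columns.zero[OF D, of i k] by auto
  qed
qed

lemma make_pipes_exists:
  assumes w: "w permutes {1..n}" and ext: "P \<in> extensional {1..n}"
    and pipes: "\<And>k. k \<in> {1..n} \<Longrightarrow> is_pipe n k (inv w k) (P k)"
  shows "\<exists>C. columns n w C \<and> P = make_pipes n w C"
proof -
  have inv_in: "inv w k \<in> {1..n}" if "k \<in> {1..n}" for k
    using permutes_in_image[OF permutes_inv[OF w]] that by simp
  have "\<exists>c. c n = k \<and> P k = (Suc n, k) # path c (inv w k) n \<and> c (inv w k - 1) = Suc n \<and>
    (\<forall>r. inv w k \<le> r \<longrightarrow> r \<le> n \<longrightarrow> c r \<le> c (r - 1) \<and> c r \<le> n)" if k: "k \<in> {1..n}" for k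
  proof -
    let ?e = "inv w k"
    have e: "0 < ?e" "?e \<le> n" using inv_in[OF k] by auto
    obtain q where q: "P k = (Suc n, k) # q @ [(?e, Suc n)]" "set q \<subseteq> grid n" "successively ne_step (P k)"
      using pipes[OF k] by (auto simp: is_pipe_def)
    obtain x p where xp: "q @ [(?e, Suc n)] = x # p" by (cases q) auto
    obtain i j where x: "x = (i, j)" by force
    have "ne_step (Suc n, k) (i, j)" "successively ne_step ((i, j) # p)" using q xp x by auto
    moreover have "i \<le> n"
    proof (cases q)
      case Nil then show ?thesis using xp x e by simp
    next
      case (Cons y ys) then show ?thesis using xp x q(2) by (auto simp: grid_def)
    qed
    ultimately have ij: "i = n" "j = k" by (auto simp: ne_step_def)
    have "last ((n, k) # p) = (?e, Suc n)" using xp x ij by (metis last_snoc)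
    from ne_path_exists[OF _ this e(1)] \<open>successively ne_step ((i, j) # p)\<close> ij
    obtain c where c: "c n = k" "(n, k) # p = path c ?e n" "c (?e - 1) = Suc n"
      "\<forall>r. ?e \<le> r \<longrightarrow> r \<le> n \<longrightarrow> c r \<le> c (r - 1)" by blast
    have Pk: "P k = (Suc n, k) # path c ?e n" using q(1) xp x ij c(2) by simp
    have "c r \<le> n" if r: "?e \<le> r" "r \<le> n" for r
    proof (cases "r = n")
      case True then show ?thesis using c(1) k by simp
    next
      case False
      have mono: "c r \<le> c (r - 1)" if "?e \<le> r" "r \<le> n" for r using c(4) that by blast
      have "steps (path c ?e n) = {((Suc r, c r), (r, c r)) |r. ?e \<le> r \<and> r < n} \<union>
        {((r, j), (r, Suc j)) |r j. ?e \<le> r \<and> r \<le> n \<and> c r \<le> j \<and> j < c (r - 1)}"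
        by (rule steps_path[where c = c, OF e(1) mono e(2) order_refl])
      \<comment> \<open>The box below a vertical step is not the final position of the path, so it
        belongs to the grid part of the pipe.\<close>
      then have "((Suc r, c r), (r, c r)) \<in> steps (path c ?e n)" using r False by auto
      then have "(Suc r, c r) \<in> set (butlast (path c ?e n))" by (rule steps_butlast)
      moreover have "path c ?e n = q @ [(?e, Suc n)]" using xp x ij c(2) by simp
      ultimately have "(Suc r, c r) \<in> set q" by simp
      then show ?thesis using q(2) by (auto simp: grid_def)
    qed
    then show ?thesis using c Pk by blast
  qed
  then obtain c where c: "\<And>k. k \<in> {1..n} \<Longrightarrow> c k n = k"
    "\<And>k. k \<in> {1..n} \<Longrightarrow> P k = (Suc n, k) # path (c k) (inv w k) n"
    "\<And>k. k \<in> {1..n} \<Longrightarrow> c k (inv w k - 1) = Suc n"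
    "\<And>k r. k \<in> {1..n} \<Longrightarrow> inv w k \<le> r \<Longrightarrow> r \<le> n \<Longrightarrow> c k r \<le> c k (r - 1) \<and> c k r \<le> n"
    by metis
  \<comment> \<open>The value \<open>Suc n\<close> above the exit and \<open>0\<close> outside the
    index range are the defaults fixed by \<open>pipe_columns\<close>; they make \<open>C\<close>
    unique.\<close>
  define C where "C i k = (if n < i \<or> k \<notin> {1..n} then 0 else if i < inv w k then Suc n else c k i)" for i k
  have C: "columns n w C"
  proof
    show "w permutes {1..n}" by (rule w)
    show "C n k = k" if "k \<in> {1..n}" for k using that inv_in[OF that] c(1) by (simp add: C_def)
    show "C (Suc i) k \<le> C i k" if "i < n" "k \<in> {1..n}" for i k
      using that c(4)[OF that(2), of "Suc i"] by (auto simp: C_def)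
    show "C i k \<le> Suc n" if "i \<le> n" "k \<in> {1..n}" for i k
      using that c(4)[OF that(2), of i] by (auto simp: C_def)
    show "C i k = Suc n \<longleftrightarrow> i < inv w k" if "i \<le> n" "k \<in> {1..n}" for i k
      using that c(4)[OF that(2), of i] by (auto simp: C_def)
  qed (auto simp: C_def)
  have "P k = make_pipes n w C k" for k
  proof (cases "k \<in> {1..n}")
    case True
    have "path (c k) (inv w k) n = path (\<lambda>i. C i k) (inv w k) n"
      using inv_in[OF True] True c(3)[OF True]
      by (intro path_cong) (auto simp: C_def not_less le_less_Suc_eq dest: le_antisym)
    then show ?thesis using True c(2) by (simp add: make_pipes_def)
  next
    case False
    then show ?thesis using ext by (auto simp: make_pipes_def extensional_def)
  qed
  with C show ?thesis by blast
qed

lemma bij_betw_make_pipes: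
  assumes w: "w permutes {1..n}"
  shows "bij_betw (make_pipes n w) (EG_columns n w) (EG n w)"
proof (rule bij_betwI')
  fix C D assume "C \<in> EG_columns n w" "D \<in> EG_columns n w"
  then have "columns n w C" "columns n w D" using columns_if_pipe_columns[OF w] by (auto simp: EG_columns_def)
  then show "make_pipes n w C = make_pipes n w D \<longleftrightarrow> C = D" using make_pipes_inject by blast
next
  fix C assume C: "C \<in> EG_columns n w"
  then have pc: "pipe_columns n w C" by (simp add: EG_columns_def)
  then have cols: "columns n w C" by (rule columns_if_pipe_columns[OF w])
  show "make_pipes n w C \<in> EG n w"
    using C columns.pipe_columns_imp_bumpless[OF cols pc] columns.empty_boxes_make_pipes[OF cols]
    by (auto simp: EG_def EG_columns_def has_shape_def)
next
  fix P assume P: "P \<in> EG n w"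
  then have b: "bumpless_pipedream n w P" by (simp add: EG_def)
  then have "P \<in> extensional {1..n}" "\<And>k. k \<in> {1..n} \<Longrightarrow> is_pipe n k (inv w k) (P k)"
    unfolding bumpless_pipedream_def by blast+
  from make_pipes_exists[OF w this] obtain C where C: "columns n w C" "P = make_pipes n w C" by blast
  then have "pipe_columns n w C" using columns.bumpless_imp_pipe_columns b by blast
  then have "C \<in> EG_columns n w"
    using P C columns.empty_boxes_make_pipes[OF C(1)] by (auto simp: EG_def EG_columns_def has_shape_def)
  then show "\<exists>C\<in>EG_columns n w. P = make_pipes n w C" using C by blast
qed

section \<open>The bijection\<close>

lemma rothe_bounds:
  assumes w: "w permutes {1..n}" and r: "rothe w p q" and p: "0 < p"
  shows "p \<le> n" "q < n"
proof -
  have qp: "q < w p" "p < inv w q" using r by (auto simp: rothe_def)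
  show pn: "p \<le> n"
  proof (rule ccontr)
    assume "\<not> p \<le> n"
    then have "w p = p" using permutes_not_in[OF w, of p] by simp
    moreover have "inv w q \<notin> {1..n}" using qp \<open>\<not> p \<le> n\<close> by simp
    then have "inv w q = q"
      using permutes_in_image[OF permutes_inv[OF w], of q] permutes_not_in[OF permutes_inv[OF w], of q] by blast
    ultimately show False using qp by simp
  qed
  then show "q < n" using permutes_in_image[OF w, of p] p qp by auto
qed

text \<open>The exit rows can be read off from \<open>C\<close>. Hence different children have
  disjoint sets of pipedreams.\<close>

lemma pipe_columns_perm_unique:
  assumes "u permutes {1..n}" "w permutes {1..n}" "pipe_columns n u C" "pipe_columns n w C"
  shows "u = w"
proof -
  have "inv u k = inv w k" if k: "k \<in> {1..n}" for k
  proof -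
    have "i < inv u k \<longleftrightarrow> i < inv w k" if "i \<le> n" for i
      using pc_exit[OF assms(3) that k] pc_exit[OF assms(4) that k] by simp
    moreover have "inv u k \<le> n" "inv w k \<le> n"
      using permutes_in_image[OF permutes_inv[OF assms(1)], of k] permutes_in_image[OF permutes_inv[OF assms(2)], of k] k
      by auto
    ultimately show ?thesis by (metis less_irrefl linorder_neqE_nat)
  qed
  then have "inv u k = inv w k" for k
    using permutes_not_in[OF permutes_inv[OF assms(1)], of k] permutes_not_in[OF permutes_inv[OF assms(2)], of k]
    by (cases "k \<in> {1..n}") auto
  then have "inv u = inv w" by blast
  then show ?thesis using permutes_inv_inv[OF assms(1)] permutes_inv_inv[OF assms(2)] by metis
qed

lemma bij_betw_UN_disjoint:
  assumes "\<And>i. i \<in> K \<Longrightarrow> bij_betw f (A i) (B i)"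
    and "\<And>i j. i \<in> K \<Longrightarrow> j \<in> K \<Longrightarrow> i \<noteq> j \<Longrightarrow> B i \<inter> B j = {}"
  shows "bij_betw f (\<Union>i\<in>K. A i) (\<Union>i\<in>K. B i)"
proof -
  have f: "inj_on f (A i)" "f ` A i = B i" if "i \<in> K" for i
    using assms(1)[OF that] by (auto simp: bij_betw_def)
  have "inj_on f (\<Union>i\<in>K. A i)"
  proof (rule inj_onI)
    fix x y assume "x \<in> (\<Union>i\<in>K. A i)" "y \<in> (\<Union>i\<in>K. A i)" and eq: "f x = f y"
    then obtain i j where i: "i \<in> K" "x \<in> A i" and j: "j \<in> K" "y \<in> A j" by blast
    then have "f x \<in> B i" "f y \<in> B j" using f(2) by blast+
    then have "i = j" using assms(2)[OF i(1) j(1)] eq by auto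
    then show "x = y" using inj_onD[OF f(1)[OF i(1)] eq] i j by simp
  qed
  moreover have "f ` (\<Union>i\<in>K. A i) = (\<Union>i\<in>K. B i)" using f(2) by blast
  ultimately show ?thesis by (simp add: bij_betw_def)
qed

text \<open>For a list of columns \<open>tableau_shape\<close> is the conjugate partition, whence
  the reflection.\<close>

definition shape_bijection :: "nat \<Rightarrow> (nat \<Rightarrow> nat) \<Rightarrow> (nat list list \<Rightarrow> nat \<Rightarrow> nat \<Rightarrow> nat) \<Rightarrow> bool" where
  "shape_bijection n w f \<longleftrightarrow> bij_betw f (column_tableaux w) (EG_columns n w) \<and>
    (\<forall>cs\<in>column_tableaux w. blanks n (f cs) = prod.swap ` young (tableau_shape cs))"

lemma dominant_shape_bijection:
  assumes w: "w permutes {1..n}" and dom: "\<And>p q. \<not> nondominant w p q"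
  shows "\<exists>f. shape_bijection n w f"
proof -
  have "\<not> rothe w p q" if "1 \<le> i" "i < p" "w i < q" for i p q
    using dom[of p q] that unfolding nondominant_def by auto
  then obtain cs where cs: "column_tableaux w = {cs}"
    "\<And>i j. j < length cs \<and> i < length (cs ! j) \<longleftrightarrow> rothe w (1 + i) (1 + j)"
    using dominant_column_tableau[OF w order_refl] by (metis Suc_eq_plus1_left le_add1)
  have ok: "columns_ok cs" using cs(1) by (auto simp: column_tableaux_def)
  define lam where "lam = tableau_shape (List.transpose cs)"
  have part: "partition_shape lam"
    using columns_ok_imp_increasing_tableau[OF ok] by (simp add: lam_def increasing_tableau_def)
  have young_lam: "young lam = prod.swap ` young (tableau_shape cs)"
    unfolding lam_def by (rule young_transpose[OF columns_ok_sorted(1)[OF ok]])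
  have "young lam = {(i, j). (i, j) \<in> grid n \<and> rothe w i j}"
  proof -
    have "(j, i) \<in> young (tableau_shape cs) \<longleftrightarrow> (i, j) \<in> grid n \<and> rothe w i j" for i j
      using cs(2)[of "j - 1" "i - 1"] rothe_bounds[OF w, of i j]
      by (cases i; cases j) (auto simp: young_tableau_shape grid_def)
    then show ?thesis unfolding young_lam by force
  qed
  from dominant_EG_columns[OF w dom part this] obtain C
    where C: "EG_columns n w = {C}" "blanks n C = young lam" by blast
  have "shape_bijection n w (\<lambda>_. C)"
    using cs(1) C young_lam by (simp add: shape_bijection_def bij_betw_def)
  then show ?thesis by blast
qed

lemma (in transition) transition_shape_bijection:
  assumes IH: "\<And>i. i \<in> I \<Longrightarrow> \<exists>f. shape_bijection n (child i) f"
  shows "\<exists>f. shape_bijection n w f"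
proof -
  define K where "K = child ` I"
  obtain g where g: "bij_betw g (column_tableaux w) (\<Union>u\<in>K. column_tableaux u)"
    "\<And>cs. cs \<in> column_tableaux w \<Longrightarrow> map length (g cs) = map length cs"
  proof -
    have "(\<lambda>i. v \<circ> Transposition.transpose i a) ` {i. covers v i a} = K"
      by (auto simp: K_def I_def child_def)
    then show thesis
      using bump_columns[OF v_permutes _ not_covers_0 covers_s bounds(3)] that bounds w_eq by auto
  qed
  obtain h where h: "bij_betw h (EG_columns n w) (\<Union>i\<in>I. EG_columns n (child i))"
    "\<And>C. C \<in> EG_columns n w \<Longrightarrow> blanks n (h C) = blanks n C"
    using transition_EG_columns by blast
  have Kp: "u permutes {1..n}" if "u \<in> K" for u using that child_permutes by (auto simp: K_def)
  have "\<forall>u\<in>K. \<exists>f. shape_bijection n u f" using IH by (auto simp: K_def)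
  then obtain F where F: "\<And>u. u \<in> K \<Longrightarrow> shape_bijection n u (F u)" by metis
  \<comment> \<open>The permutation of the reading word tells which child's bijection
    applies.\<close>
  define f where "f cs = F (word_perm (concat (rev cs))) cs" for cs
  have f_eq: "f cs = F u cs" if "cs \<in> column_tableaux u" for cs u
    using that by (simp add: f_def column_tableaux_def)
  have "bij_betw f (\<Union>u\<in>K. column_tableaux u) (\<Union>u\<in>K. EG_columns n u)"
  proof (rule bij_betw_UN_disjoint)
    fix u assume u: "u \<in> K"
    have "bij_betw (F u) (column_tableaux u) (EG_columns n u)"
      using F[OF u] by (simp add: shape_bijection_def)
    then show "bij_betw f (column_tableaux u) (EG_columns n u)"
      using f_eq by (subst bij_betw_cong) auto
  next
    fix u u' assume "u \<in> K" "u' \<in> K" "u \<noteq> u'"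
    then show "EG_columns n u \<inter> EG_columns n u' = {}"
      using pipe_columns_perm_unique[OF Kp Kp] by (auto simp: EG_columns_def)
  qed
  moreover have "(\<Union>u\<in>K. EG_columns n u) = (\<Union>i\<in>I. EG_columns n (child i))" by (simp add: K_def)
  ultimately have f: "bij_betw f (\<Union>u\<in>K. column_tableaux u) (\<Union>i\<in>I. EG_columns n (child i))" by simp
  let ?h = "inv_into (EG_columns n w) h"
  have bij: "bij_betw (?h \<circ> (f \<circ> g)) (column_tableaux w) (EG_columns n w)"
    by (rule bij_betw_trans[OF bij_betw_trans[OF g(1) f] bij_betw_inv_into[OF h(1)]])
  have "blanks n ((?h \<circ> (f \<circ> g)) cs) = prod.swap ` young (tableau_shape cs)"
    if cs: "cs \<in> column_tableaux w" for cs
  proof -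
    define C where "C = ?h (f (g cs))"
    have gcs: "g cs \<in> (\<Union>u\<in>K. column_tableaux u)" by (rule bij_betw_apply[OF g(1) cs])
    then obtain u where u: "u \<in> K" "g cs \<in> column_tableaux u" by blast
    have fg: "f (g cs) \<in> (\<Union>i\<in>I. EG_columns n (child i))" by (rule bij_betw_apply[OF f gcs])
    have C_in: "C \<in> EG_columns n w"
      unfolding C_def by (rule bij_betw_apply[OF bij_betw_inv_into[OF h(1)] fg])
    have "h C = f (g cs)" unfolding C_def by (rule bij_betw_inv_into_right[OF h(1) fg])
    then have "blanks n C = blanks n (F u (g cs))" using h(2)[OF C_in] f_eq[OF u(2)] by simp
    also have "\<dots> = prod.swap ` young (tableau_shape (g cs))"
      using F[OF u(1)] u(2) by (simp add: shape_bijection_def)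
    also have "tableau_shape (g cs) = tableau_shape cs" using g(2)[OF cs] by (simp add: tableau_shape_def)
    finally show ?thesis by (simp add: C_def)
  qed
  with bij show ?thesis unfolding shape_bijection_def by blast
qed

lemma shape_bijection_exists:
  assumes "w permutes {1..n}"
  shows "\<exists>f. shape_bijection n w f"
proof -
  \<comment> \<open>The measure \<open>n - x\<close> reverses the order of letters, so
    lexicographically larger one-line words count as smaller.\<close>
  let ?r = "inv_image (lex (measure (\<lambda>x. n - x))) (\<lambda>w. map w [1..<Suc n])"
  have wf: "wf ?r" by (intro wf_inv_image wf_lex wf_measure)
  show ?thesis
    using wf assms
  proof (induction w rule: wf_induct_rule)
    case (less w)
    note w = less.prems
    show "\<exists>f. shape_bijection n w f"
    proof (cases "\<exists>p q. nondominant w p q")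
      case False
      then show ?thesis using dominant_shape_bijection[OF w] by blast
    next
      case True
      have bound: "p \<le> n \<and> q < n" if "nondominant w p q" for p q
        using that rothe_bounds[OF w, of p q] by (auto simp: nondominant_def)
      obtain a where a: "\<exists>q. nondominant w a q" "\<And>p. \<exists>q. nondominant w p q \<Longrightarrow> p \<le> a"
        using ex_has_greatest_nat[of "\<lambda>p. \<exists>q. nondominant w p q" _ "\<lambda>p. p" "Suc n"] True bound
        by (metis le_imp_less_Suc)
      obtain b where b: "nondominant w a b" "\<And>q. nondominant w a q \<Longrightarrow> q \<le> b"
        using ex_has_greatest_nat[of "nondominant w a" _ "\<lambda>q. q" n] a(1) bound by metis
      interpret transition n w a b
        by unfold_locales (use w a b in \<open>auto simp: not_le[symmetric]\<close>)
      show ?thesis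
      proof (rule transition_shape_bijection, rule less.IH)
        fix i assume i: "i \<in> I"
        show "child i permutes {1..n}" by (rule child_permutes[OF i])
        have "[1..<Suc n] = [1..<i] @ i # [Suc i..<Suc n]"
          using in_I[OF i] bounds upt_add_eq_append[of 1 i "Suc n - i"] upt_conv_Cons[of i "Suc n"] by simp
        moreover have "map (child i) [1..<i] = map w [1..<i]" using child_lex(2)[OF i] by simp
        ultimately have split:
          "map (child i) [1..<Suc n] = map w [1..<i] @ child i i # map (child i) [Suc i..<Suc n]"
          "map w [1..<Suc n] = map w [1..<i] @ w i # map w [Suc i..<Suc n]" by (simp_all only: map_append list.map)
        have "child i i \<le> n"
          using permutes_in_image[OF child_permutes[OF i], of i] in_I[OF i] bounds by simp
        then have lt: "(child i i, w i) \<in> measure (\<lambda>x. n - x)" using child_lex(1)[OF i] by simp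
        have "(map (child i) [1..<Suc n], map w [1..<Suc n]) \<in> lex (measure (\<lambda>x. n - x))"
          unfolding split using lt by (intro lex_append_leftI) simp
        then show "(child i, w) \<in> ?r" by (simp only: in_inv_image)
      qed
    qed
  qed
qed

theorem theorem6p1:
  fixes n :: nat and w :: "nat \<Rightarrow> nat"
  assumes "w permutes {1..n}"
  shows "\<exists>f. bij_betw f (RT n w) (EG n w) \<and>
             (\<forall>T \<in> RT n w. has_shape n (f T) (tableau_shape T))"
proof -
  obtain f where f: "bij_betw f (column_tableaux w) (EG_columns n w)"
    "\<And>cs. cs \<in> column_tableaux w \<Longrightarrow> blanks n (f cs) = prod.swap ` young (tableau_shape cs)"
    using shape_bijection_exists[OF assms] unfolding shape_bijection_def by blast
  let ?f = "make_pipes n w \<circ> (f \<circ> List.transpose)"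
  have "bij_betw ?f (RT n w) (EG n w)"
    by (rule bij_betw_trans[OF bij_betw_trans[OF bij_betw_RT_columns[OF assms] f(1)] bij_betw_make_pipes[OF assms]])
  moreover have "has_shape n (?f T) (tableau_shape T)" if T: "T \<in> RT n w" for T
  proof -
    have inc: "increasing_tableau T" using T by (simp add: RT_def)
    then have part: "partition_shape (tableau_shape T)" by (simp add: increasing_tableau_def)
    have cs: "List.transpose T \<in> column_tableaux w" by (rule bij_betw_apply[OF bij_betw_RT_columns[OF assms] T])
    have C: "f (List.transpose T) \<in> EG_columns n w" by (rule bij_betw_apply[OF f(1) cs])
    then have "columns n w (f (List.transpose T))"
      using columns_if_pipe_columns[OF assms] by (simp add: EG_columns_def)
    then have "empty_boxes n (?f T) = blanks n (f (List.transpose T))"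
      by (simp add: columns.empty_boxes_make_pipes)
    \<comment> \<open>Passing to columns reflects the shape once and \<open>shape_bijection\<close>
      reflects it back.\<close>
    also have "\<dots> = prod.swap ` prod.swap ` young (tableau_shape T)"
      using f(2)[OF cs] young_transpose part partition_shape_iff by simp
    also have "\<dots> = young (tableau_shape T)" by (simp add: image_image)
    finally show ?thesis using part by (simp add: has_shape_def)
  qed
  ultimately show ?thesis by blast
qed

end
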